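(* Let $\mathbf p=\{p_j\}_{j\ge0}$ be a probability distribution with $\sum_jjp_j=1$, such that $\sum_jp_js^j$ has convergence radius $R>1$, and such that $p_0>0$, $p_1=0$ and $\mathrm{g.c.d.}(j\ge1:\,p_{j+1}>0)=1$. (i) The random tree $T_n$, i.e. the finite terminal tree of the Galton--Watson process with offspring distribution $\mathbf p$, conditioned on having $n$ leaves, with leaves labelled uniformly at random by the elements of $[n]$, is well defined for every $n\ge1$ (that is, the terminal tree has $n$ leaves with positive probability). (ii) Let $X_{n,a}$ be the total number of subsets $S\subset[n]$, $|S|=a$, such that $S$ induces the same subtree in two independent copies of $T_n$. Define the constant $$c(\mathbf p):=e\,p_0\,\lambda\Bigl[\max_r\Bigl(r-\sum_{j\ge2}p_j^2r^j\Bigr)\Bigr]^{-1/2},$$ $$\lambda:=\max(\chi^{-2},\chi^{-1}),\qquad \chi:=(2p_0\sigma^2)^{1/2},\qquad \sigma^2:=\sum_{j\ge2}j(j-1)p_j,$$ so that $c(\mathbf p)=e/2$ if $p_0=p_2=1/2$. Then for $\varepsilon\in(0,1/2]$ and $a\ge(1+\varepsilon)c(\mathbf p)n^{1/2}$, $$\mathbb E[X_{n,a}]\le(1-\varepsilon)^a.$$ So, with probability at least $1-(1-\varepsilon)^{(1+\varepsilon)c(\mathbf p)n^{1/2}}$, the largest number of leaves in a common induced subtree of the two independent copies of $T_n$ is at most $(1+\varepsilon)c(\mathbf p)n^{1/2}$.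
   Context: $[n]=\{1,\dots,n\}$. The maximum defining $c(\mathbf p)$ is over $r\ge0$ for which the series converges. The Galton--Watson process starts from a single progenitor (the root); each individual independently has $j$ children with probability $p_j$, and the children of each individual are ordered. Under the stated conditions it terminates almost surely; the terminal tree is the resulting finite rooted tree with ordered children. A leaf is a vertex with no children. Let $\mathcal T$ be a rooted tree with ordered children and with leaves labelled bijectively by a nonempty set $S\subset[n]$, every non-leaf vertex having at least two children; leaf-labelled trees are regarded up to isomorphism preserving root, order of children and leaf labels. The LCA subtree of $S$ in $T_n$ is the subtree formed by the paths from the lowest common ancestor $v(S)$ of the leaves in $S$ to these leaves, rooted at $v(S)$, with inherited order of children. $S$ induces $\mathcal T$ in $T_n$ if (a) the LCA subtree for $S$ in $T_n$ becomes $\mathcal T$ after suppressing its vertices, other than the root, that have total degree 2 in this LCA subtree; and (b) the out-degree in $T_n$ of every other (non-suppressed) vertex of the LCA subtree is the same as its out-degree in $\mathcal T$. $S$ induces the same subtree in two trees if there is a single $\mathcal T$ with leaf-set $S$ that is induced by $S$ in both; such a $\mathcal T$ is a common induced subtree.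
   Formalization: In (i), positivity for every n≥1 is claimed only if p_2>0 (if p_2=0, no tree has exactly 2 leaves); in general only for all large n. In (ii), both bounds are claimed for n≥n_0(p,ε), uniformly in a, since they can fail for small n. *)

theory Defs
  imports "HOL-Probability.Probability" "HOL-Library.Sublist"
begin

text \<open>
  Rooted trees with ordered children are represented by their Ulam--Harris addresses: the root
  is \<open>[]\<close> and \<open>v @ [i]\<close> is the child number \<open>i\<close> (counted from 0) of \<open>v\<close>.  Ancestry is the prefix
  order.  Two trees in the sense of \<open>plane_tree\<close> are isomorphic (as rooted ordered trees) iff
  they are equal.
\<close>

type_synonym vertex = "nat list"

definition plane_tree :: "vertex set \<Rightarrow> bool" where
  "plane_tree V \<longleftrightarrow> finite V \<and> [] \<in> V \<and>
     (\<forall>v i. v @ [i] \<in> V \<longrightarrow> v \<in> V \<and> (\<forall>j<i. v @ [j] \<in> V))"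

definition outdeg :: "vertex set \<Rightarrow> vertex \<Rightarrow> nat" where
  "outdeg V v = card {i. v @ [i] \<in> V}"

definition leaves :: "vertex set \<Rightarrow> vertex set" where
  "leaves V = {v \<in> V. \<forall>i. v @ [i] \<notin> V}"

text \<open>
  The labelling of a leaf-labelled tree is a function on vertices of which only
  the values at the leaves matter.
\<close>

type_synonym labelled_tree = "vertex set \<times> (vertex \<Rightarrow> nat)"

definition leaf_labelled :: "nat set \<Rightarrow> labelled_tree \<Rightarrow> bool" where
  "leaf_labelled S = (\<lambda>(V, l). plane_tree V \<and> bij_betw l (leaves V) S)"

subsection \<open>The Galton--Watson tree conditioned on its number of leaves\<close>

text \<open>
  Every potential individual \<open>v\<close> has an offspring number \<open>\<omega> v\<close>, and these are independent
  with distribution \<open>p\<close>.  The individuals that are actually born form \<open>gw_tree \<omega>\<close>, which may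
  be infinite.
\<close>

definition gw_space :: "nat pmf \<Rightarrow> (vertex \<Rightarrow> nat) measure" where
  "gw_space p = (\<Pi>\<^sub>M v\<in>(UNIV :: vertex set). measure_pmf p)"

definition gw_tree :: "(vertex \<Rightarrow> nat) \<Rightarrow> vertex set" where
  "gw_tree \<omega> = {v. \<forall>k<length v. v ! k < \<omega> (take k v)}"

definition has_n_leaves :: "nat \<Rightarrow> vertex set \<Rightarrow> bool" where
  "has_n_leaves n V \<longleftrightarrow> finite V \<and> card (leaves V) = n"

definition prob_n_leaves :: "nat pmf \<Rightarrow> nat \<Rightarrow> real" where
  "prob_n_leaves p n = \<P>(\<omega> in gw_space p. has_n_leaves n (gw_tree \<omega>))"

text \<open>
  The next distribution is meaningful only if \<open>prob_n_leaves p n > 0\<close>; then the conditional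
  probabilities below sum to 1.
\<close>

definition conditioned_gw_tree :: "nat pmf \<Rightarrow> nat \<Rightarrow> vertex set pmf" where
  "conditioned_gw_tree p n =
     embed_pmf (\<lambda>V. \<P>(\<omega> in gw_space p. gw_tree \<omega> = V \<bar> has_n_leaves n (gw_tree \<omega>)))"

definition labellings :: "nat \<Rightarrow> vertex set \<Rightarrow> (vertex \<Rightarrow> nat) set" where
  "labellings n V = {l \<in> leaves V \<rightarrow>\<^sub>E {1..n}. bij_betw l (leaves V) {1..n}}"

definition random_tree :: "nat pmf \<Rightarrow> nat \<Rightarrow> labelled_tree pmf" where
  "random_tree p n =
     bind_pmf (conditioned_gw_tree p n) (\<lambda>V. map_pmf (Pair V) (pmf_of_set (labellings n V)))"

definition two_copies :: "nat pmf \<Rightarrow> nat \<Rightarrow> (labelled_tree \<times> labelled_tree) pmf" where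
  "two_copies p n = pair_pmf (random_tree p n) (random_tree p n)"

subsection \<open>Induced subtrees\<close>

definition leaves_with_label :: "nat set \<Rightarrow> labelled_tree \<Rightarrow> vertex set" where
  "leaves_with_label S = (\<lambda>(V, l). {u \<in> leaves V. l u \<in> S})"

definition lca :: "nat set \<Rightarrow> labelled_tree \<Rightarrow> vertex" where
  "lca S T = Longest_common_prefix (leaves_with_label S T)"

definition lca_subtree :: "nat set \<Rightarrow> labelled_tree \<Rightarrow> vertex set" where
  "lca_subtree S T = {w. prefix (lca S T) w \<and> (\<exists>u \<in> leaves_with_label S T. prefix w u)}"

definition total_degree :: "vertex set \<Rightarrow> vertex \<Rightarrow> nat" where
  "total_degree U w = card {x \<in> U. \<exists>i. x = w @ [i] \<or> w = x @ [i]}"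

definition kept_vertices :: "nat set \<Rightarrow> labelled_tree \<Rightarrow> vertex set" where
  "kept_vertices S T =
     {w \<in> lca_subtree S T. w = lca S T \<or> total_degree (lca_subtree S T) w \<noteq> 2}"

text \<open>
  Suppressing vertices of a tree leaves a set \<open>K\<close> of addresses that is no longer closed under
  taking prefixes.  In the resulting tree the parent of a vertex is its closest proper ancestor
  in \<open>K\<close>, and the children \<open>x\<close>, \<open>y\<close> of \<open>w\<close> are ordered as the edges by which the
  original paths from \<open>w\<close> to \<open>x\<close> and to \<open>y\<close> leave \<open>w\<close>.  If \<open>K\<close> is a \<open>plane_tree\<close>, both notions
  are the usual ones.
\<close>

definition is_child :: "vertex set \<Rightarrow> vertex \<Rightarrow> vertex \<Rightarrow> bool" where
  "is_child K w x \<longleftrightarrow> w \<in> K \<and> x \<in> K \<and> strict_prefix w x \<and>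
     \<not> (\<exists>y\<in>K. strict_prefix w y \<and> strict_prefix y x)"

definition sibling_less :: "vertex \<Rightarrow> vertex \<Rightarrow> vertex \<Rightarrow> bool" where
  "sibling_less w x y \<longleftrightarrow> x ! length w < y ! length w"

text \<open>
  In \<open>induces S T W\<close>, the isomorphism \<open>\<phi>\<close> identifies the given tree \<open>W\<close> with the LCA subtree
  after suppression.  The last conjunct is condition (b) on the out-degrees in \<open>T\<close>.
\<close>

definition induces :: "nat set \<Rightarrow> labelled_tree \<Rightarrow> labelled_tree \<Rightarrow> bool" where
  "induces S T = (\<lambda>(W, m).
     leaf_labelled S (W, m) \<and> (\<forall>x \<in> W - leaves W. 2 \<le> outdeg W x) \<and>
     (\<exists>\<phi>. bij_betw \<phi> W (kept_vertices S T) \<and>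
        \<phi> [] = lca S T \<and>
        (\<forall>x\<in>W. \<forall>y\<in>W. is_child W x y \<longleftrightarrow> is_child (kept_vertices S T) (\<phi> x) (\<phi> y)) \<and>
        (\<forall>x\<in>W. \<forall>y z. is_child W x y \<and> is_child W x z \<longrightarrow>
           (sibling_less x y z \<longleftrightarrow> sibling_less (\<phi> x) (\<phi> y) (\<phi> z))) \<and>
        (\<forall>x\<in>leaves W. \<phi> x \<in> leaves (fst T) \<and> snd T (\<phi> x) = m x) \<and>
        (\<forall>x\<in>W. outdeg (fst T) (\<phi> x) = outdeg W x)))"

definition same_induced :: "nat set \<Rightarrow> labelled_tree \<Rightarrow> labelled_tree \<Rightarrow> bool" where
  "same_induced S T T' \<longleftrightarrow> (\<exists>W. induces S T W \<and> induces S T' W)"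

definition X :: "nat \<Rightarrow> nat \<Rightarrow> labelled_tree \<times> labelled_tree \<Rightarrow> nat" where
  "X n a = (\<lambda>(T, T'). card {S. S \<subseteq> {1..n} \<and> card S = a \<and> same_induced S T T'})"

definition max_common :: "nat \<Rightarrow> labelled_tree \<times> labelled_tree \<Rightarrow> nat" where
  "max_common n = (\<lambda>(T, T'). Max {card S | S. S \<subseteq> {1..n} \<and> S \<noteq> {} \<and> same_induced S T T'})"

subsection \<open>The constant\<close>

definition offspring_var :: "nat pmf \<Rightarrow> real" where
  "offspring_var p = (\<Sum>\<^sub>\<infinity>j\<in>{2..}. real j * (real j - 1) * pmf p j)"

definition chi :: "nat pmf \<Rightarrow> real" where
  "chi p = sqrt (2 * pmf p 0 * offspring_var p)"

definition lam :: "nat pmf \<Rightarrow> real" where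
  "lam p = max (1 / (chi p)^2) (1 / chi p)"

definition max_term :: "nat pmf \<Rightarrow> real" where
  "max_term p = (GREATEST y. \<exists>r\<ge>0. (\<lambda>j. (pmf p j)^2 * r^j) summable_on {2..} \<and>
      y = r - (\<Sum>\<^sub>\<infinity>j\<in>{2..}. (pmf p j)^2 * r^j))"

definition c_const :: "nat pmf \<Rightarrow> real" where
  "c_const p = exp 1 * pmf p 0 * lam p * max_term p powr (- 1 / 2)"

end

theory Submission
  imports Defs "HOL-Combinatorics.Permutations" "HOL-Real_Asymp.Real_Asymp"
begin

text \<open>
  The proof is a first moment computation with explicit generating function bounds.

  A set \<open>S\<close> of \<open>a\<close> labels induces the labelled tree \<open>(W, m)\<close> in a labelled tree only if \<open>W\<close> embeds into it so
  that the children of every vertex of \<open>W\<close> are sent below the corresponding children of its image, with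
  equal out-degrees (\<open>induces_imp_embedding\<close>).  Given the embedding, the labels of \<open>a\<close> leaves are
  prescribed.  If \<open>A(W)\<close> is the sum over trees with \<open>n\<close> leaves of their Galton--Watson probability times
  the number of embeddings of \<open>W\<close>, and \<open>q n\<close> is the probability of \<open>n\<close> leaves, then the probability that
  \<open>S\<close> induces \<open>(W, m)\<close> is at most \<open>A(W) / q n * (n - a)! / n!\<close>.  By independence of the two copies
  (\<open>expectation_X_le\<close>)
  \<open>E X \<le> (n - a)! / n! * (\<Sum>W. (A(W) / q n)\<^sup>2)\<close>.

  Three ingredients are needed.

  \<^item> An upper bound for \<open>A(W)\<close>.  A tree with a marked copy of \<open>W\<close> consists of the vertices of the copy and of
    chains of suppressed vertices, one above each vertex of \<open>W\<close>.  If \<open>u\<close> is the value of the generating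
    function of \<open>q\<close> at \<open>x\<close>, every chain contributes \<open>1 / (1 - \<Phi>'(u))\<close> with \<open>\<Phi>(u) = \<Sum>j\<ge>2. p\<^sub>j u ^ j\<close>.
    Hence \<open>A(W) x ^ n\<close> is at most \<open>x ^ a (1 - \<Phi>'(u)) ^ (- v)\<close> times the probability of \<open>W\<close>,
    where \<open>v\<close> is the number of vertices of \<open>W\<close>
    (\<open>sum_weight_embeddings_le\<close>, \<open>embedding_weight_le\<close>).  Criticality
    makes \<open>1 - \<Phi>'(u)\<close> asymptotic to \<open>chi p * sqrt (1 - x)\<close> as \<open>x\<close> tends to 1.

  \<^item> An upper bound for the sum of the squared probabilities of all \<open>W\<close> with \<open>a\<close> leaves.  It is exponential
    in \<open>a\<close> with the rate \<open>p\<^sub>0\<^sup>2 / max_term p\<close>, by the same fixed point argument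
    (\<open>sum_sq_weights_le\<close>).

  \<^item> A lower bound for \<open>q n\<close>.  As \<open>a\<close> is at least of order \<open>sqrt n\<close>, a loss of \<open>exp (\<delta> sqrt n)\<close> for small \<open>\<delta>\<close>
    is affordable.  For large \<open>M\<close>, a Tauberian argument finds in the window \<open>(M, K M]\<close> some \<open>m\<close> such that \<open>q m\<close> is not
    smaller than a constant times \<open>M ^ (-2)\<close>; joining two trees under a new root then reaches every large \<open>n\<close>
    (\<open>leafprob_window\<close>, \<open>leafprob_subexponential\<close>).

  With \<open>1 - x\<close> close to \<open>a / n\<close> these bounds combine to \<open>E X \<le> (c\<^sup>2 n / a\<^sup>2) ^ a\<close>, up to factors that are
  absorbed by \<open>(1 + \<epsilon>)\<^sup>2 (1 - \<epsilon>) > 1\<close>.  This is for \<open>a\<close> smaller than a fraction of \<open>n\<close>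
  (\<open>expected_X_le_small\<close>); for larger \<open>a\<close> the factor \<open>1 / a!\<close> beats all exponentials
  (\<open>expected_X_le_large\<close>).  The statement on the largest common subtree follows by summation over \<open>a\<close>.
\<close>

section \<open>Plane trees and their weights\<close>

text \<open>
  The same plane trees in recursive form: a sum over trees then becomes a sum over lists of
  subtrees, and generating functions satisfy their functional equation by construction.
\<close>

datatype ptree = Node (kids: "ptree list")

primrec num_leaves :: "ptree \<Rightarrow> nat" where
  "num_leaves (Node ts) = (if ts = [] then 1 else sum_list (map num_leaves ts))"

primrec num_verts :: "ptree \<Rightarrow> nat" where
  "num_verts (Node ts) = Suc (sum_list (map num_verts ts))"

primrec nounary :: "ptree \<Rightarrow> bool" where
  "nounary (Node ts) \<longleftrightarrow> length ts \<noteq> 1 \<and> list_all id (map nounary ts)"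

text \<open>
  For \<open>f = pmf p\<close> this is the probability that the Galton--Watson tree is the given one.  Two other
  choices of \<open>f\<close> occur: the squares of these probabilities, and the weights with \<open>f 0\<close> multiplied by
  a variable \<open>x\<close> that counts leaves.
\<close>

primrec weight :: "(nat \<Rightarrow> real) \<Rightarrow> ptree \<Rightarrow> real" where
  "weight f (Node ts) = f (length ts) * prod_list (map (weight f) ts)"

primrec verts :: "ptree \<Rightarrow> vertex set" where
  "verts (Node ts) = insert [] (\<Union>i<length ts. (#) i ` (map verts ts ! i))"

lemma nounary_Node [simp]:
  "nounary (Node ts) \<longleftrightarrow> length ts \<noteq> 1 \<and> (\<forall>t\<in>set ts. nounary t)"
  by (simp add: list_all_iff)

lemma verts_Node: "verts (Node ts) = insert [] (\<Union>i<length ts. (#) i ` verts (ts ! i))"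
  by simp

declare nounary.simps [simp del] verts.simps [simp del]

lemma Nil_in_verts [simp]: "[] \<in> verts t"
  by (cases t) (simp add: verts_Node)

lemma Cons_in_verts [simp]:
  "i # v \<in> verts (Node ts) \<longleftrightarrow> i < length ts \<and> v \<in> verts (ts ! i)"
  by (auto simp: verts_Node)

lemma finite_verts [simp]: "finite (verts t)"
proof (induction t)
  case (Node ts)
  show ?case unfolding verts_Node
    by (rule finite.insertI, rule finite_UN_I) (use Node in auto)
qed

lemma plane_tree_verts: "plane_tree (verts t)"
proof (induction t)
  case (Node ts)
  have "v \<in> verts (Node ts) \<and> (\<forall>j<i. v @ [j] \<in> verts (Node ts))"
    if "v @ [i] \<in> verts (Node ts)" for v i
  proof (cases v)
    case Nil
    then show ?thesis using that by auto
  next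
    case (Cons k u)
    then have "k < length ts" "u @ [i] \<in> verts (ts ! k)" using that by auto
    moreover have "plane_tree (verts (ts ! k))" using Node calculation(1) by simp
    ultimately have "u \<in> verts (ts ! k) \<and> (\<forall>j<i. u @ [j] \<in> verts (ts ! k))"
      unfolding plane_tree_def by blast
    then show ?thesis using Cons \<open>k < length ts\<close> by simp
  qed
  then show ?case unfolding plane_tree_def by (intro conjI allI impI; blast?) simp_all
qed

lemma inj_verts: "verts t = verts t' \<Longrightarrow> t = t'"
proof (induction t arbitrary: t')
  case (Node ts)
  obtain ts' where t': "t' = Node ts'" by (cases t')
  have mem: "i < length ts \<and> v \<in> verts (ts ! i) \<longleftrightarrow> i < length ts' \<and> v \<in> verts (ts' ! i)" for i v
    using Node.prems t' by (metis Cons_in_verts)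
  from mem[of _ "[]"] have len: "length ts = length ts'"
    by (metis Nil_in_verts linorder_neqE_nat less_irrefl)
  have "ts ! i = ts' ! i" if "i < length ts" for i
    using Node.IH[of "ts ! i" "ts' ! i"] that mem[of i] len by auto
  then show ?case using t' len by (simp add: list_eq_iff_nth_eq)
qed

text \<open>
  Children are numbered without gaps, so the out-degree decides which children exist.
\<close>

lemma plane_tree_outdeg:
  assumes "plane_tree V"
  shows "{i. v @ [i] \<in> V} = {..<outdeg V v}"
proof -
  let ?A = "{i. v @ [i] \<in> V}"
  have "inj_on (\<lambda>i. v @ [i]) ?A" by (auto simp: inj_on_def)
  moreover have "(\<lambda>i. v @ [i]) ` ?A \<subseteq> V" by auto
  ultimately have fin: "finite ?A"
    using assms unfolding plane_tree_def by (meson finite_imageD finite_subset)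
  have down: "j \<in> ?A" if "i \<in> ?A" "j \<le> i" for i j
    using that assms unfolding plane_tree_def by (metis le_neq_implies_less mem_Collect_eq)
  have "?A = {..<card ?A}"
  proof (cases "?A = {}")
    case True then show ?thesis by simp
  next
    case False
    define m where "m = Suc (Max ?A)"
    have "?A = {..<m}"
    proof (intro equalityI subsetI)
      fix i assume "i \<in> ?A"
      then have "i \<le> Max ?A" using Max_ge fin by blast
      then show "i \<in> {..<m}" by (simp add: m_def)
    next
      fix i assume "i \<in> {..<m}"
      then have "i \<le> Max ?A" by (simp add: m_def)
      then show "i \<in> ?A" by (rule down[OF Max_in[OF fin False]])
    qed
    then show ?thesis by (metis card_lessThan)
  qed
  then show ?thesis by (simp add: outdeg_def)
qed

lemma plane_tree_append_iff:
  assumes "plane_tree V"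
  shows "v @ [i] \<in> V \<longleftrightarrow> i < outdeg V v"
  using plane_tree_outdeg[OF assms, of v] by blast

lemma plane_tree_prefix:
  assumes "plane_tree V" "v \<in> V" "prefix u v"
  shows "u \<in> V"
proof -
  have "u @ w \<in> V \<Longrightarrow> u \<in> V" for w
  proof (induction w rule: rev_induct)
    case (snoc i w)
    then show ?case using assms(1) unfolding plane_tree_def by (metis append_assoc)
  qed simp
  then show ?thesis using assms by (auto simp: prefix_def)
qed

lemma outdeg_Nil [simp]: "outdeg (verts (Node ts)) [] = length ts"
proof -
  have "{i. [] @ [i] \<in> verts (Node ts)} = {..<length ts}" by auto
  then show ?thesis by (simp add: outdeg_def)
qed

lemma outdeg_Cons [simp]:
  "i < length ts \<Longrightarrow> outdeg (verts (Node ts)) (i # v) = outdeg (verts (ts ! i)) v"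
  by (simp add: outdeg_def)

text \<open>
  By induction on the number of vertices: the addresses that begin with the letter \<open>i\<close>, with this
  letter removed, form a smaller plane tree.
\<close>

lemma plane_tree_is_verts:
  assumes "plane_tree V"
  shows "\<exists>t. V = verts t"
  using assms
proof (induction "card V" arbitrary: V rule: less_induct)
  case less
  define d where "d = outdeg V []"
  define U where "U i = {v. i # v \<in> V}" for i
  have fV: "finite V" and NV: "[] \<in> V" using less.prems by (auto simp: plane_tree_def)
  have d: "[i] \<in> V \<longleftrightarrow> i < d" for i
    using plane_tree_append_iff[OF less.prems, of "[]" i] by (simp add: d_def)
  have ex: "\<exists>t. U i = verts t" if "i < d" for i
  proof (rule less.hyps)
    have "(#) i ` U i \<subset> V" using NV by (auto simp: U_def)
    then have "card ((#) i ` U i) < card V" using fV by (intro psubset_card_mono)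
    then show "card (U i) < card V" by (simp add: card_image)
    have "finite ((#) i ` U i)" using fV by (rule finite_subset[rotated]) (auto simp: U_def)
    then have "finite (U i)" by (rule finite_imageD) simp
    moreover have "v \<in> U i \<and> (\<forall>j<k. v @ [j] \<in> U i)" if "v @ [k] \<in> U i" for v k
      using that less.prems unfolding plane_tree_def U_def by (metis append_Cons mem_Collect_eq)
    ultimately show "plane_tree (U i)" using that d by (auto simp: plane_tree_def U_def)
  qed
  then obtain t where t: "\<And>i. i < d \<Longrightarrow> U i = verts (t i)" by metis
  have "V = verts (Node (map t [0..<d]))"
  proof (rule set_eqI)
    fix v
    show "v \<in> V \<longleftrightarrow> v \<in> verts (Node (map t [0..<d]))"
    proof (cases v)
      case (Cons i u)
      have "i < d" if "i # u \<in> V"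
        using plane_tree_prefix[OF less.prems that, of "[i]"] d by auto
      moreover have "i # u \<in> V \<longleftrightarrow> u \<in> U i" by (simp add: U_def)
      moreover have "i # u \<in> verts (Node (map t [0..<d])) \<longleftrightarrow> i < d \<and> u \<in> verts (t i)" by auto
      ultimately show ?thesis using Cons t[of i] by blast
    qed (use NV in auto)
  qed
  then show ?case by blast
qed

lemma prod_verts:
  "(\<Prod>v\<in>verts (Node ts). g v) = (g [] :: 'a :: comm_monoid_mult) * (\<Prod>i<length ts. \<Prod>v\<in>verts (ts ! i). g (i # v))"
proof -
  have "(\<Prod>v\<in>verts (Node ts). g v) = g [] * (\<Prod>v\<in>(\<Union>i<length ts. (#) i ` verts (ts ! i)). g v)"
    unfolding verts_Node by (subst prod.insert) auto
  also have "(\<Prod>v\<in>(\<Union>i<length ts. (#) i ` verts (ts ! i)). g v) = (\<Prod>i<length ts. \<Prod>v\<in>(#) i ` verts (ts ! i). g v)"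
    by (rule prod.UNION_disjoint) auto
  finally show ?thesis by (simp add: prod.reindex)
qed

lemma prod_list_map_nth: "prod_list (map g xs) = (\<Prod>i<length xs. g (xs ! i))"
  by (induction xs) (simp_all add: prod.lessThan_Suc_shift del: prod.lessThan_Suc)

lemma sum_list_map_nth: "sum_list (map g xs) = (\<Sum>i<length xs. g (xs ! i))"
  by (simp add: sum_list_sum_nth atLeast0LessThan)

lemma prod_outdeg_eq_weight: "(\<Prod>v\<in>verts t. f (outdeg (verts t) v)) = weight f t"
proof (induction t)
  case (Node ts)
  show ?case unfolding prod_verts by (simp add: prod_list_map_nth Node)
qed

lemma leaves_verts_Node:
  "leaves (verts (Node ts)) =
     (if ts = [] then {[]} else (\<Union>i<length ts. (#) i ` leaves (verts (ts ! i))))"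
proof (rule set_eqI)
  fix v
  show "v \<in> leaves (verts (Node ts)) \<longleftrightarrow>
      v \<in> (if ts = [] then {[]} else (\<Union>i<length ts. (#) i ` leaves (verts (ts ! i))))"
    by (cases v) (auto simp: leaves_def)
qed

lemma finite_leaves [simp]: "finite (leaves (verts t))"
  by (simp add: leaves_def)

lemma card_leaves_verts: "card (leaves (verts t)) = num_leaves t"
proof (induction t)
  case (Node ts)
  show ?case
  proof (cases "ts = []")
    case False
    have "card (leaves (verts (Node ts))) = (\<Sum>i<length ts. card ((#) i ` leaves (verts (ts ! i))))"
      using False unfolding leaves_verts_Node by (simp, subst card_UN_disjoint) auto
    then show ?thesis using False by (simp add: card_image sum_list_map_nth Node)
  qed (simp add: leaves_verts_Node)
qed

lemma ball_verts:
  "(\<forall>v\<in>verts (Node ts). Q v) \<longleftrightarrow> Q [] \<and> (\<forall>i<length ts. \<forall>v\<in>verts (ts ! i). Q (i # v))"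
  unfolding verts_Node by blast

lemma nounary_iff: "nounary t \<longleftrightarrow> (\<forall>v\<in>verts t. outdeg (verts t) v \<noteq> 1)"
proof (induction t)
  case (Node ts)
  have "(\<forall>t\<in>set ts. nounary t) \<longleftrightarrow> (\<forall>i<length ts. \<forall>v\<in>verts (ts ! i). outdeg (verts (ts ! i)) v \<noteq> 1)"
    using Node by (simp add: all_set_conv_all_nth del: One_nat_def)
  then show ?case unfolding ball_verts nounary_Node by simp
qed

lemma num_leaves_pos: "num_leaves t > 0"
proof (induction t)
  case (Node ts)
  then show ?case by (cases ts) auto
qed

lemma num_leaves_le_num_verts: "num_leaves t \<le> num_verts t"
proof (induction t)
  case (Node ts)
  then have "sum_list (map num_leaves ts) \<le> sum_list (map num_verts ts)" by (intro sum_list_mono) auto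
  then show ?case by auto
qed

text \<open>
  Every internal vertex has at least two children, so there are fewer of them than leaves.  Later
  this bounds the number of factors that a pattern with \<open>a\<close> leaves contributes by \<open>2 * a\<close>.
\<close>

lemma num_verts_less_twice_num_leaves: "nounary t \<Longrightarrow> num_verts t < 2 * num_leaves t"
proof (induction t)
  case (Node ts)
  show ?case
  proof (cases "ts = []")
    case False
    have "sum_list (map (\<lambda>t. num_verts t + 1) ts) \<le> sum_list (map (\<lambda>t. 2 * num_leaves t) ts)"
      using Node by (intro sum_list_mono) force
    moreover have "sum_list (map (\<lambda>t. num_verts t + 1) ts) = sum_list (map num_verts ts) + length ts"
      by (induction ts) auto
    ultimately have "sum_list (map num_verts ts) + length ts \<le> 2 * sum_list (map num_leaves ts)"
      by (simp only: sum_list_const_mult)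
    moreover have "length ts \<ge> 2" using False Node.prems by (cases ts) (auto simp: Suc_le_eq)
    ultimately show ?thesis using False by simp
  qed simp
qed

text \<open>
  An exhaustion of all trees by finite sets that follows the recursion at the root.  It allows
  generating functions to be estimated through finite sums only, by induction on \<open>h\<close>.
\<close>

primrec trunc :: "nat \<Rightarrow> ptree set" where
  "trunc 0 = {}"
| "trunc (Suc h) = Node ` {ts. set ts \<subseteq> trunc h \<and> length ts \<le> Suc h}"

lemma finite_trunc [simp]: "finite (trunc h)"
  by (induction h) (auto intro: finite_lists_length_le)

lemma trunc_mono_Suc: "trunc h \<subseteq> trunc (Suc h)"
  by (induction h) (auto intro!: image_mono)

lemma trunc_mono: "h \<le> k \<Longrightarrow> trunc h \<subseteq> trunc k"
  by (rule lift_Suc_mono_le[where f = trunc]) (rule trunc_mono_Suc)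

text \<open>
  Without unary vertices, each subtree of the root has strictly fewer leaves than the whole tree;
  hence the number of leaves bounds the height and all out-degrees.
\<close>

lemma nounary_in_trunc: "nounary t \<Longrightarrow> t \<in> trunc (num_leaves t)"
proof (induction t)
  case (Node ts)
  show ?case
  proof (cases "ts = []")
    case False
    have len: "length ts \<ge> 2" using False Node.prems by (cases ts) (auto simp: Suc_le_eq)
    have tot: "num_leaves (Node ts) = (\<Sum>i<length ts. num_leaves (ts ! i))" using False by (simp add: sum_list_map_nth)
    have sub: "num_leaves t < num_leaves (Node ts)" if "t \<in> set ts" for t
    proof -
      obtain i where i: "i < length ts" "ts ! i = t" using \<open>t \<in> set ts\<close> unfolding in_set_conv_nth by blast
      define k where "k = (if i = 0 then 1 else 0 :: nat)"
      have k: "k < length ts" "k \<noteq> i" using len unfolding k_def by (auto split: if_split)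
      have "(\<Sum>j\<in>{i,k}. num_leaves (ts ! j)) \<le> num_leaves (Node ts)" unfolding tot
        using i k by (intro sum_mono2) auto
      then show ?thesis using i k num_leaves_pos[of "ts ! k"] by simp
    qed
    obtain h where h: "num_leaves (Node ts) = Suc h" using gr0_implies_Suc[OF num_leaves_pos] by metis
    have "set ts \<subseteq> trunc h"
    proof
      fix t assume t: "t \<in> set ts"
      have "t \<in> trunc (num_leaves t)" using Node t by auto
      then show "t \<in> trunc h" using trunc_mono[of "num_leaves t" h] sub[OF t] h by auto
    qed
    moreover have "length ts \<le> Suc h"
    proof -
      have "(\<Sum>i<length ts. 1) \<le> (\<Sum>i<length ts. num_leaves (ts ! i))"
        by (intro sum_mono) (simp add: Suc_le_eq num_leaves_pos)
      then show ?thesis using h tot by simp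
    qed
    ultimately show ?thesis unfolding h by auto
  qed simp
qed

definition trees :: "nat \<Rightarrow> ptree set" where
  "trees n = {t. nounary t \<and> num_leaves t = n}"

lemma trees_subset_trunc: "trees n \<subseteq> trunc n"
  using nounary_in_trunc by (auto simp: trees_def)

lemma finite_trees [simp]: "finite (trees n)"
  using trees_subset_trunc finite_subset finite_trunc by blast

lemma weight_nonneg: "(\<And>j. f j \<ge> 0) \<Longrightarrow> weight f t \<ge> 0"
proof (induction t)
  case (Node ts)
  then show ?case by (auto intro!: mult_nonneg_nonneg prod_list_nonneg)
qed

text \<open>
  If \<open>p\<^sub>1 = 0\<close>, the infinitely many trees with unary vertices carry no mass, and for
  each number of leaves only the finite set \<open>trees n\<close> remains.
\<close>

lemma weight_unary_0:
  assumes "f 1 = 0" "\<not> nounary t" shows "weight f t = 0"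
  using assms(2)
proof (induction t)
  case (Node ts)
  show ?case
  proof (cases "length ts = 1")
    case False
    then obtain t where t: "t \<in> set ts" "\<not> nounary t" using Node.prems by auto
    then have "weight f t = 0" using Node.IH by blast
    then have "0 \<in> set (map (weight f) ts)" using t(1) by force
    then have "prod_list (map (weight f) ts) = 0" by (simp add: prod_list_zero_iff)
    then show ?thesis by simp
  qed (use assms in simp)
qed

section \<open>Sums of weights over trees\<close>

definition lists_of :: "'a set \<Rightarrow> nat \<Rightarrow> 'a list set" where
  "lists_of A j = {ts. set ts \<subseteq> A \<and> length ts = j}"

lemma lists_of_0 [simp]: "lists_of A 0 = {[]}"
  by (auto simp: lists_of_def)

lemma lists_of_Suc: "lists_of A (Suc j) = (\<lambda>(t, ts). t # ts) ` (A \<times> lists_of A j)"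
  by (auto simp: lists_of_def length_Suc_conv image_iff)

lemma finite_lists_of [simp]: "finite A \<Longrightarrow> finite (lists_of A j)"
  by (simp add: lists_of_def finite_lists_length_eq)

lemma sum_lists_prod:
  fixes g :: "nat \<Rightarrow> 'a \<Rightarrow> real"
  shows "(\<Sum>ts\<in>lists_of A j. \<Prod>i<j. g i (ts ! i)) = (\<Prod>i<j. \<Sum>t\<in>A. g i t)"
proof (induction j arbitrary: g)
  case (Suc j)
  have "(\<Sum>ts\<in>lists_of A (Suc j). \<Prod>i<Suc j. g i (ts ! i))
      = (\<Sum>(t, ts)\<in>A \<times> lists_of A j. g 0 t * (\<Prod>i<j. g (Suc i) (ts ! i)))"
    unfolding lists_of_Suc
    by (subst sum.reindex) (auto simp: inj_on_def prod.lessThan_Suc_shift o_def case_prod_beta simp del: prod.lessThan_Suc)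
  also have "\<dots> = (\<Sum>t\<in>A. g 0 t) * (\<Sum>ts\<in>lists_of A j. \<Prod>i<j. g (Suc i) (ts ! i))"
    by (simp add: sum.cartesian_product[symmetric] sum_product)
  finally show ?case
    using Suc[of "\<lambda>i. g (Suc i)"] by (simp add: prod.lessThan_Suc_shift del: prod.lessThan_Suc)
qed simp

text \<open>
  The derivative of the \<open>j\<close>-th power: one of the \<open>j\<close> entries is marked by \<open>N\<close>, the others range
  freely.
\<close>

lemma sum_lists_marked:
  fixes w N :: "'a \<Rightarrow> real"
  shows "(\<Sum>ts\<in>lists_of A j. (\<Prod>i<j. w (ts ! i)) * (\<Sum>i<j. N (ts ! i)))
       = real j * (\<Sum>t\<in>A. w t * N t) * (\<Sum>t\<in>A. w t) ^ (j - 1)"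
proof -
  have one: "(\<Sum>ts\<in>lists_of A j. (\<Prod>k<j. w (ts ! k)) * N (ts ! i))
      = (\<Sum>t\<in>A. w t * N t) * (\<Sum>t\<in>A. w t) ^ (j - 1)" if "i < j" for i
  proof -
    define g where "g k t = (if k = i then w t * N t else w t)" for k t
    have "(\<Prod>k<j. g k (ts ! k)) = (\<Prod>k<j. w (ts ! k)) * N (ts ! i)" for ts
    proof -
      have "(\<Prod>k\<in>{..<j} - {i}. g k (ts ! k)) = (\<Prod>k\<in>{..<j} - {i}. w (ts ! k))"
        by (intro prod.cong) (auto simp: g_def)
      then show ?thesis using that
        by (simp add: prod.remove[of "{..<j}" i] g_def)
    qed
    then have "(\<Sum>ts\<in>lists_of A j. (\<Prod>k<j. w (ts ! k)) * N (ts ! i)) = (\<Prod>k<j. \<Sum>t\<in>A. g k t)"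
      by (simp flip: sum_lists_prod)
    also have "\<dots> = (\<Sum>t\<in>A. g i t) * (\<Prod>k\<in>{..<j} - {i}. \<Sum>t\<in>A. g k t)"
      using that by (simp add: prod.remove[of "{..<j}" i])
    also have "(\<Prod>k\<in>{..<j} - {i}. \<Sum>t\<in>A. g k t) = (\<Prod>k\<in>{..<j} - {i}. \<Sum>t\<in>A. w t)"
      by (intro prod.cong) (auto simp: g_def)
    finally show ?thesis using that by (simp add: g_def)
  qed
  have "(\<Sum>ts\<in>lists_of A j. (\<Prod>i<j. w (ts ! i)) * (\<Sum>i<j. N (ts ! i)))
      = (\<Sum>i<j. \<Sum>ts\<in>lists_of A j. (\<Prod>k<j. w (ts ! k)) * N (ts ! i))"
    by (simp add: sum_distrib_left) (rule sum.swap)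
  also have "\<dots> = (\<Sum>i<j. (\<Sum>t\<in>A. w t * N t) * (\<Sum>t\<in>A. w t) ^ (j - 1))"
    using one by (intro sum.cong) auto
  finally show ?thesis by simp
qed

lemma sum_trunc_Suc:
  fixes F :: "ptree \<Rightarrow> real"
  shows "(\<Sum>t\<in>trunc (Suc h). F t) = (\<Sum>j\<le>Suc h. \<Sum>ts\<in>lists_of (trunc h) j. F (Node ts))"
proof -
  have eq: "{ts. set ts \<subseteq> trunc h \<and> length ts \<le> Suc h} = (\<Union>j\<le>Suc h. lists_of (trunc h) j)"
    by (auto simp: lists_of_def)
  have "(\<Sum>t\<in>trunc (Suc h). F t) = (\<Sum>ts\<in>{ts. set ts \<subseteq> trunc h \<and> length ts \<le> Suc h}. F (Node ts))"
    unfolding trunc.simps by (subst sum.reindex) (auto simp: inj_on_def)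
  also have "\<dots> = (\<Sum>j\<le>Suc h. \<Sum>ts\<in>lists_of (trunc h) j. F (Node ts))"
    unfolding eq by (rule sum.UNION_disjoint) (auto simp: lists_of_def finite_lists_length_eq)
  finally show ?thesis .
qed

lemma weight_Node_nth: "length ts = j \<Longrightarrow> weight f (Node ts) = f j * (\<Prod>i<j. weight f (ts ! i))"
  by (auto simp: prod_list_map_nth)

lemma sum_weight_trunc_Suc:
  "(\<Sum>t\<in>trunc (Suc h). weight f t) = (\<Sum>j\<le>Suc h. f j * (\<Sum>t\<in>trunc h. weight f t) ^ j)"
proof -
  have "(\<Sum>ts\<in>lists_of (trunc h) j. weight f (Node ts)) = f j * (\<Sum>t\<in>trunc h. weight f t) ^ j" for j
  proof -
    have "(\<Sum>ts\<in>lists_of (trunc h) j. weight f (Node ts))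
        = (\<Sum>ts\<in>lists_of (trunc h) j. f j * (\<Prod>i<j. weight f (ts ! i)))"
      by (intro sum.cong refl weight_Node_nth) (simp add: lists_of_def)
    then show ?thesis using sum_lists_prod[where g = "\<lambda>_. weight f" and A = "trunc h" and j = j]
      by (simp only: sum_distrib_left[symmetric] prod_constant card_lessThan)
  qed
  then show ?thesis unfolding sum_trunc_Suc by (simp only:)
qed

text \<open>
  With \<open>\<Phi>(u) = \<Sum>j. f j * u ^ j\<close>, the sums \<open>F h\<close> over \<open>trunc h\<close> satisfy
  \<open>F (Suc h) \<le> \<Phi> (F h)\<close>.  As \<open>\<Phi>\<close> is increasing, any \<open>u\<close> with \<open>\<Phi>(u) \<le> u\<close> stays above all of them;
  no convergence has to be discussed.
\<close>

lemma sum_weight_trunc_le: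
  assumes f: "\<And>j. f j \<ge> 0" and u: "u \<ge> 0" and sub: "\<And>m. (\<Sum>j\<le>m. f j * u ^ j) \<le> u"
  shows "(\<Sum>t\<in>trunc h. weight f t) \<le> u"
proof (induction h)
  case (Suc h)
  have "(\<Sum>t\<in>trunc (Suc h). weight f t) \<le> (\<Sum>j\<le>Suc h. f j * u ^ j)"
    unfolding sum_weight_trunc_Suc using Suc
    by (intro sum_mono mult_left_mono power_mono) (auto intro: f sum_nonneg weight_nonneg)
  then show ?case using sub[of "Suc h"] by linarith
qed (use u in simp)

section \<open>Embeddings of a tree into a larger tree\<close>

text \<open>
  What remains of the isomorphism in \<open>induces\<close> when the labels are forgotten.  The order of the
  children together with equality of out-degrees forces the path to the image of the \<open>i\<close>-th child
  to start with the \<open>i\<close>-th edge, which is the first condition.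
\<close>

definition embeddings :: "vertex set \<Rightarrow> vertex set \<Rightarrow> (vertex \<Rightarrow> vertex) set" where
  "embeddings W V = {\<phi> \<in> W \<rightarrow>\<^sub>E V.
     (\<forall>x i. x @ [i] \<in> W \<longrightarrow> prefix (\<phi> x @ [i]) (\<phi> (x @ [i]))) \<and>
     (\<forall>x\<in>W. outdeg V (\<phi> x) = outdeg W x)}"

lemma finite_embeddings [simp]: "finite W \<Longrightarrow> finite V \<Longrightarrow> finite (embeddings W V)"
  by (simp add: embeddings_def finite_PiE)

lemma embeddingsD:
  assumes "\<phi> \<in> embeddings W V"
  shows "x \<in> W \<Longrightarrow> \<phi> x \<in> V" "x \<notin> W \<Longrightarrow> \<phi> x = undefined"
    "x \<in> W \<Longrightarrow> outdeg V (\<phi> x) = outdeg W x"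
    "x @ [i] \<in> W \<Longrightarrow> prefix (\<phi> x @ [i]) (\<phi> (x @ [i]))"
  using assms unfolding embeddings_def by blast+

lemma embeddingsI:
  assumes "\<And>x. x \<in> W \<Longrightarrow> \<phi> x \<in> V" "\<And>x. x \<notin> W \<Longrightarrow> \<phi> x = undefined"
    "\<And>x. x \<in> W \<Longrightarrow> outdeg V (\<phi> x) = outdeg W x"
    "\<And>x i. x @ [i] \<in> W \<Longrightarrow> prefix (\<phi> x @ [i]) (\<phi> (x @ [i]))"
  shows "\<phi> \<in> embeddings W V"
  using assms unfolding embeddings_def by (blast intro: PiE_I)

lemma embedding_mono:
  assumes "\<phi> \<in> embeddings W V" "plane_tree W" "x @ y \<in> W"
  shows "prefix (\<phi> x) (\<phi> (x @ y))"
  using assms(3)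
proof (induction y rule: rev_induct)
  case (snoc i y)
  have "x @ y \<in> W" using plane_tree_prefix[OF assms(2) snoc.prems] by simp
  then have "prefix (\<phi> x) (\<phi> (x @ y))" using snoc.IH by blast
  moreover have "prefix (\<phi> (x @ y) @ [i]) (\<phi> (x @ y @ [i]))"
    using embeddingsD(4)[OF assms(1), of "x @ y" i] snoc.prems by simp
  ultimately show ?case by (meson append_prefixD prefix_order.trans)
qed simp

text \<open>
  If the root of \<open>W\<close> goes to the root of \<open>V\<close>, the out-degrees agree and the embedding splits into
  embeddings of the \<open>i\<close>-th subtree into the \<open>i\<close>-th subtree.  Otherwise the image of the root starts
  with some letter \<open>i\<close>, and so do all other images.
\<close>

lemma card_embeddings_Node_le:
  fixes ws vs :: "ptree list"
  defines "W \<equiv> verts (Node ws)" and "V \<equiv> verts (Node vs)"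
  shows "card (embeddings W V) \<le>
    (if length ws = length vs
     then \<Prod>i<length ws. card (embeddings (verts (ws ! i)) (verts (vs ! i))) else 0)
    + (\<Sum>i<length vs. card (embeddings W (verts (vs ! i))))"
proof -
  define E where "E = embeddings W V"
  define E0 where "E0 = {\<phi> \<in> E. \<phi> [] = []}"
  define E1 where "E1 i = {\<phi> \<in> E. \<exists>v. \<phi> [] = i # v}" for i
  have pW: "plane_tree W" and pV: "plane_tree V" by (simp_all add: W_def V_def plane_tree_verts)
  have mem: "\<phi> x \<in> V" if "\<phi> \<in> E" "x \<in> W" for \<phi> x
    using that embeddingsD(1) unfolding E_def by blast
  have arb: "\<phi> x = undefined" if "\<phi> \<in> E" "x \<notin> W" for \<phi> x
    using that embeddingsD(2) unfolding E_def by blast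
  have odg: "outdeg V (\<phi> x) = outdeg W x" if "\<phi> \<in> E" "x \<in> W" for \<phi> x
    using that embeddingsD(3) unfolding E_def by blast
  have pre: "prefix (\<phi> x @ [i]) (\<phi> (x @ [i]))" if "\<phi> \<in> E" "x @ [i] \<in> W" for \<phi> x i
    using that embeddingsD(4) unfolding E_def by blast
  have NW: "[] \<in> W" by (simp add: W_def)
  have fE: "finite E" by (simp add: E_def W_def V_def)
  have cover: "E \<subseteq> E0 \<union> (\<Union>i<length vs. E1 i)"
  proof
    fix \<phi> assume \<phi>: "\<phi> \<in> E"
    show "\<phi> \<in> E0 \<union> (\<Union>i<length vs. E1 i)"
    proof (cases "\<phi> []")
      case Nil then show ?thesis using \<phi> by (simp add: E0_def)
    next
      case (Cons i v)
      then have "i # v \<in> V" using mem[OF \<phi> NW] by simp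
      then have "i < length vs" by (simp add: V_def)
      then show ?thesis using \<phi> Cons by (auto simp: E1_def)
    qed
  qed
  have c1: "card (E1 i) \<le> card (embeddings W (verts (vs ! i)))" if i: "i < length vs" for i
  proof (rule card_inj_on_le)
    have hd: "\<exists>w. \<phi> x = i # w" if "\<phi> \<in> E1 i" "x \<in> W" for \<phi> x
      using embedding_mono[of \<phi> W V "[]" x] that pW by (auto simp: E1_def E_def prefix_def)
    then have Cons: "\<phi> x = i # tl (\<phi> x)" if "\<phi> \<in> E1 i" "x \<in> W" for \<phi> x
      using that by fastforce
    show "inj_on (\<lambda>\<phi>. restrict (\<lambda>x. tl (\<phi> x)) W) (E1 i)"
    proof (rule inj_onI, rule ext)
      fix \<phi> \<phi>' x
      assume a: "\<phi> \<in> E1 i" "\<phi>' \<in> E1 i"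
        "restrict (\<lambda>x. tl (\<phi> x)) W = restrict (\<lambda>x. tl (\<phi>' x)) W"
      show "\<phi> x = \<phi>' x"
      proof (cases "x \<in> W")
        case True
        then have "tl (\<phi> x) = tl (\<phi>' x)" using fun_cong[OF a(3), of x] by simp
        then show ?thesis using Cons[OF a(1) True] Cons[OF a(2) True] by metis
      next
        case False then show ?thesis using a(1,2) False arb[of \<phi> x] arb[of \<phi>' x] by (simp add: E1_def)
      qed
    qed
    show "(\<lambda>\<phi>. restrict (\<lambda>x. tl (\<phi> x)) W) ` E1 i \<subseteq> embeddings W (verts (vs ! i))"
    proof (rule image_subsetI)
      fix \<phi> assume \<phi>: "\<phi> \<in> E1 i"
      then have \<phi>E: "\<phi> \<in> E" by (simp add: E1_def)
      have "tl (\<phi> x) \<in> verts (vs ! i)" if "x \<in> W" for x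
        using mem[OF \<phi>E that] Cons[OF \<phi> that] unfolding V_def by (metis Cons_in_verts)
      moreover have "prefix (tl (\<phi> x) @ [k]) (tl (\<phi> (x @ [k])))" if "x @ [k] \<in> W" for x k
      proof -
        have xW: "x \<in> W" using plane_tree_prefix[OF pW that] by simp
        have "prefix (i # tl (\<phi> x) @ [k]) (i # tl (\<phi> (x @ [k])))"
          using pre[OF \<phi>E that] Cons[OF \<phi> xW] Cons[OF \<phi> that] by (metis append_Cons)
        then show ?thesis by simp
      qed
      moreover have "outdeg (verts (vs ! i)) (tl (\<phi> x)) = outdeg W x" if "x \<in> W" for x
        using odg[OF \<phi>E that] Cons[OF \<phi> that] i unfolding V_def by (metis outdeg_Cons)
      moreover have "x \<in> W" if "x @ [k] \<in> W" for x k
        using plane_tree_prefix[OF pW that] by simp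
      ultimately show "restrict (\<lambda>x. tl (\<phi> x)) W \<in> embeddings W (verts (vs ! i))"
        by (intro embeddingsI) simp_all
    qed
  qed (simp add: W_def)
  have c0: "card E0 \<le> (if length ws = length vs
     then \<Prod>i<length ws. card (embeddings (verts (ws ! i)) (verts (vs ! i))) else 0)"
  proof (cases "length ws = length vs")
    case False
    have "\<phi> \<notin> E0" for \<phi>
      using odg[OF _ NW, of \<phi>] False by (auto simp: E0_def W_def V_def)
    then have "E0 = {}" by blast
    then show ?thesis by simp
  next
    case True
    let ?d = "length ws"
    let ?P = "PiE {..<?d} (\<lambda>i. embeddings (verts (ws ! i)) (verts (vs ! i)))"
    let ?r = "\<lambda>\<phi>. \<lambda>i\<in>{..<?d}. \<lambda>x\<in>verts (ws ! i). tl (\<phi> (i # x))"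
    have hd_i: "\<phi> (i # x) = i # tl (\<phi> (i # x))"
      if "\<phi> \<in> E0" "i < ?d" "x \<in> verts (ws ! i)" for \<phi> i x
    proof -
      have \<phi>: "\<phi> \<in> E" "\<phi> [] = []" using that by (auto simp: E0_def)
      have "[i] \<in> W" "[i] @ x \<in> W" using that by (auto simp: W_def)
      then have "prefix [i] (\<phi> [i])" "prefix (\<phi> [i]) (\<phi> ([i] @ x))"
        using pre[OF \<phi>(1), of "[]" i] \<phi> embedding_mono[of \<phi> W V "[i]" x] pW by (auto simp: E_def)
      then have "prefix [i] (\<phi> (i # x))" using prefix_order.trans by auto
      then show ?thesis by (auto simp: prefix_def)
    qed
    have "card E0 \<le> card ?P"
    proof (rule card_inj_on_le)
      show "inj_on ?r E0"
      proof (rule inj_onI, rule ext)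
        fix \<phi> \<phi>' x
        assume a: "\<phi> \<in> E0" "\<phi>' \<in> E0" "?r \<phi> = ?r \<phi>'"
        show "\<phi> x = \<phi>' x"
        proof (cases "x \<in> W")
          case False then show ?thesis using a(1,2) False arb[of \<phi> x] arb[of \<phi>' x] by (simp add: E0_def)
        next
          case True
          show ?thesis
          proof (cases x)
            case Nil then show ?thesis using a(1,2) by (simp add: E0_def)
          next
            case (Cons i y)
            then have iy: "i < ?d" "y \<in> verts (ws ! i)" using True by (auto simp: W_def)
            have "tl (\<phi> (i # y)) = tl (\<phi>' (i # y))"
              using fun_cong[OF fun_cong[OF a(3), of i], of y] iy by simp
            then show ?thesis using Cons hd_i[OF a(1) iy] hd_i[OF a(2) iy] by metis
          qed
        qed
      qed
      show "?r ` E0 \<subseteq> ?P"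
      proof (rule image_subsetI, rule PiE_I)
        fix \<phi> i assume \<phi>: "\<phi> \<in> E0" and "i \<in> {..<?d}"
        then have i: "i < ?d" "i < length vs" and \<phi>E: "\<phi> \<in> E" using True by (auto simp: E0_def)
        have inW: "i # x \<in> W" if "x \<in> verts (ws ! i)" for x using that i by (simp add: W_def)
        have sub: "x \<in> verts (ws ! i)" if "x @ [k] \<in> verts (ws ! i)" for x k
          using plane_tree_prefix[OF plane_tree_verts that] by simp
        have "tl (\<phi> (i # x)) \<in> verts (vs ! i)" if "x \<in> verts (ws ! i)" for x
          using mem[OF \<phi>E inW[OF that]] hd_i[OF \<phi> i(1) that] unfolding V_def by (metis Cons_in_verts)
        moreover have "prefix (tl (\<phi> (i # x)) @ [k]) (tl (\<phi> (i # x @ [k])))"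
          if "x @ [k] \<in> verts (ws ! i)" for x k
        proof -
          have "prefix (\<phi> (i # x) @ [k]) (\<phi> (i # x @ [k]))"
            using pre[OF \<phi>E, of "i # x" k] inW[OF that] by simp
          then have "prefix (i # tl (\<phi> (i # x)) @ [k]) (i # tl (\<phi> (i # x @ [k])))"
            using hd_i[OF \<phi> i(1) sub[OF that]] hd_i[OF \<phi> i(1) that] by (metis append_Cons)
          then show ?thesis by simp
        qed
        moreover have "outdeg (verts (vs ! i)) (tl (\<phi> (i # x))) = outdeg (verts (ws ! i)) x"
          if "x \<in> verts (ws ! i)" for x
        proof -
          have "outdeg V (\<phi> (i # x)) = outdeg (verts (ws ! i)) x"
            using odg[OF \<phi>E inW[OF that]] i by (simp add: W_def)
          then show ?thesis using hd_i[OF \<phi> i(1) that] i unfolding V_def by (metis outdeg_Cons)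
        qed
        ultimately show "?r \<phi> i \<in> embeddings (verts (ws ! i)) (verts (vs ! i))"
          using i sub by (intro embeddingsI) simp_all
      qed auto
    qed (simp add: finite_PiE)
    then show ?thesis using True by (simp add: card_PiE)
  qed
  have "card E \<le> card (E0 \<union> (\<Union>i<length vs. E1 i))"
    using cover fE by (intro card_mono) (auto simp: E0_def E1_def)
  also have "\<dots> \<le> card E0 + card (\<Union>i<length vs. E1 i)" by (rule card_Un_le)
  also have "card (\<Union>i<length vs. E1 i) \<le> (\<Sum>i<length vs. card (E1 i))" by (rule card_UN_le) simp
  also have "\<dots> \<le> (\<Sum>i<length vs. card (embeddings W (verts (vs ! i))))"
    using c1 by (intro sum_mono) auto
  finally show ?thesis using c0 unfolding E_def by linarith
qed

text \<open>
  This is the generating function of trees with a marked copy of \<open>W\<close>.  Let \<open>S\<close> be the sum for \<open>W\<close>.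
  By the preceding case distinction, a root of degree \<open>d\<close> contributes \<open>f d\<close> times the product of the
  sums for the subtrees of \<open>W\<close>, and a vertex above the copy (a suppressed vertex, with one
  distinguished child and otherwise arbitrary subtrees) contributes at most \<open>\<Phi>'(u) * S\<close>.  So
  \<open>S \<le> f d * (product) + c * S\<close>: each of the \<open>num_verts W\<close> edges, counting one above the root, costs a
  factor \<open>1 / (1 - c)\<close>.
\<close>

lemma sum_weight_embeddings_le:
  fixes f :: "nat \<Rightarrow> real"
  assumes f: "\<And>j. f j \<ge> 0" and u: "u \<ge> 0" and sub: "\<And>m. (\<Sum>j\<le>m. f j * u ^ j) \<le> u"
    and c: "\<And>m. (\<Sum>j\<le>m. f j * (real j * u ^ (j - 1))) \<le> c" and c1: "c < 1"
  shows "(\<Sum>V\<in>trunc h. weight f V * real (card (embeddings (verts W) (verts V))))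
    \<le> weight f W * (1 / (1 - c)) ^ num_verts W"
proof -
  define e where "e W V = real (card (embeddings (verts W) (verts V)))" for W V
  define S where "S h W = (\<Sum>V\<in>trunc h. weight f V * e W V)" for h W
  define G where "G = 1 / (1 - c)"
  have G: "(1 - c) * G = 1" "G > 0" using c1 by (auto simp: G_def)
  have w0: "weight f t \<ge> 0" for t using f by (rule weight_nonneg)
  have e0: "e W V \<ge> 0" for W V by (simp add: e_def)
  have S0: "S h W \<ge> 0" for h W unfolding S_def by (intro sum_nonneg mult_nonneg_nonneg w0 e0)
  have "S h W \<le> weight f W * G ^ num_verts W"
  proof (induction W arbitrary: h)
    case (Node ws)
    let ?d = "length ws"
    define M where "M = weight f (Node ws) * G ^ num_verts (Node ws)"
    have M0: "M \<ge> 0" unfolding M_def by (intro mult_nonneg_nonneg zero_le_power w0 less_imp_le G(2))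
    have Mprod: "(1 - c) * M = f ?d * (\<Prod>i<?d. weight f (ws ! i) * G ^ num_verts (ws ! i))"
    proof -
      have "(1 - c) * M = weight f (Node ws) * G ^ sum_list (map num_verts ws) * ((1 - c) * G)"
        by (simp add: M_def)
      also have "\<dots> = weight f (Node ws) * G ^ sum_list (map num_verts ws)" by (simp add: G)
      also have "G ^ sum_list (map num_verts ws) = (\<Prod>i<?d. G ^ num_verts (ws ! i))"
        by (simp add: sum_list_map_nth power_sum)
      finally show ?thesis by (simp add: prod_list_map_nth prod.distrib)
    qed
    have "S h (Node ws) \<le> M"
    proof (induction h)
      case 0 then show ?case using M0 by (simp add: S_def)
    next
      case (Suc h)
      define F where "F = (\<Sum>t\<in>trunc h. weight f t)"
      have F: "0 \<le> F" "F \<le> u"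
        using sum_weight_trunc_le[OF f u sub, of h] by (auto simp: F_def intro!: sum_nonneg w0)
      define A where "A j ts = (if ?d = j then \<Prod>i<?d. e (ws ! i) (ts ! i) else 0)" for j ts
      have "S (Suc h) (Node ws) = (\<Sum>j\<le>Suc h. \<Sum>ts\<in>lists_of (trunc h) j. weight f (Node ts) * e (Node ws) (Node ts))"
        unfolding S_def by (rule sum_trunc_Suc)
      also have "\<dots> \<le> (\<Sum>j\<le>Suc h. \<Sum>ts\<in>lists_of (trunc h) j.
          f j * ((\<Prod>i<j. weight f (ts ! i)) * A j ts) + f j * ((\<Prod>i<j. weight f (ts ! i)) * (\<Sum>i<j. e (Node ws) (ts ! i))))"
      proof (intro sum_mono)
        fix j ts assume "ts \<in> lists_of (trunc h) j"
        then have l: "length ts = j" by (simp add: lists_of_def)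
        have "e (Node ws) (Node ts) \<le> A j ts + (\<Sum>i<j. e (Node ws) (ts ! i))"
          using of_nat_mono[OF card_embeddings_Node_le[of ws ts], where 'a = real] l
          by (simp add: e_def A_def split: if_splits)
        then have "weight f (Node ts) * e (Node ws) (Node ts) \<le> weight f (Node ts) * (A j ts + (\<Sum>i<j. e (Node ws) (ts ! i)))"
          by (intro mult_left_mono w0)
        then show "weight f (Node ts) * e (Node ws) (Node ts) \<le>
          f j * ((\<Prod>i<j. weight f (ts ! i)) * A j ts) + f j * ((\<Prod>i<j. weight f (ts ! i)) * (\<Sum>i<j. e (Node ws) (ts ! i)))"
          unfolding weight_Node_nth[OF l] by (simp add: algebra_simps)
      qed
      also have "\<dots> = (\<Sum>j\<le>Suc h. f j * (\<Sum>ts\<in>lists_of (trunc h) j. (\<Prod>i<j. weight f (ts ! i)) * A j ts))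
          + (\<Sum>j\<le>Suc h. f j * (\<Sum>ts\<in>lists_of (trunc h) j. (\<Prod>i<j. weight f (ts ! i)) * (\<Sum>i<j. e (Node ws) (ts ! i))))"
        by (simp only: sum.distrib sum_distrib_left)
      also have "(\<Sum>j\<le>Suc h. f j * (\<Sum>ts\<in>lists_of (trunc h) j. (\<Prod>i<j. weight f (ts ! i)) * A j ts))
        = (\<Sum>j\<le>Suc h. if j = ?d then f ?d * (\<Prod>i<?d. S h (ws ! i)) else 0)"
      proof (intro sum.cong refl)
        fix j
        show "f j * (\<Sum>ts\<in>lists_of (trunc h) j. (\<Prod>i<j. weight f (ts ! i)) * A j ts)
          = (if j = ?d then f ?d * (\<Prod>i<?d. S h (ws ! i)) else 0)"
        proof (cases "j = ?d")
          case True
          have "(\<Sum>ts\<in>lists_of (trunc h) j. (\<Prod>i<j. weight f (ts ! i)) * A j ts)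
            = (\<Sum>ts\<in>lists_of (trunc h) j. \<Prod>i<j. weight f (ts ! i) * e (ws ! i) (ts ! i))"
            by (simp add: A_def True prod.distrib)
          also have "\<dots> = (\<Prod>i<j. S h (ws ! i))"
            using sum_lists_prod[where g = "\<lambda>i t. weight f t * e (ws ! i) t" and A = "trunc h" and j = j] by (simp add: S_def)
          finally show ?thesis using True by simp
        qed (simp add: A_def)
      qed
      also have "\<dots> \<le> f ?d * (\<Prod>i<?d. S h (ws ! i))"
        using S0 f by (auto simp: sum.delta intro!: mult_nonneg_nonneg prod_nonneg)
      also have "\<dots> \<le> f ?d * (\<Prod>i<?d. weight f (ws ! i) * G ^ num_verts (ws ! i))"
        using Node S0 by (intro mult_left_mono prod_mono f) auto
      also have "\<dots> = (1 - c) * M" by (simp add: Mprod)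
      also have "(\<Sum>j\<le>Suc h. f j * (\<Sum>ts\<in>lists_of (trunc h) j. (\<Prod>i<j. weight f (ts ! i)) * (\<Sum>i<j. e (Node ws) (ts ! i))))
        = (\<Sum>j\<le>Suc h. f j * (real j * F ^ (j - 1))) * S h (Node ws)"
        unfolding sum_distrib_right by (intro sum.cong refl) (simp add: sum_lists_marked S_def F_def)
      also have "\<dots> \<le> c * M"
      proof (rule mult_mono)
        have "(\<Sum>j\<le>Suc h. f j * (real j * F ^ (j - 1))) \<le> (\<Sum>j\<le>Suc h. f j * (real j * u ^ (j - 1)))"
          using F by (intro sum_mono mult_left_mono power_mono f) auto
        also have "\<dots> \<le> c" by (rule c)
        finally show "(\<Sum>j\<le>Suc h. f j * (real j * F ^ (j - 1))) \<le> c" .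
        show "0 \<le> c" using c[of 0] by simp
      qed (use Suc S0 in auto)
      finally show ?case by (simp add: algebra_simps)
    qed
    then show ?case by (simp add: M_def)
  qed
  then show ?thesis by (simp add: S_def e_def G_def)
qed

lemma weight_scale_leaf: "weight (f(0 := f 0 * x)) t = weight f t * x ^ num_leaves t"
proof -
  define g where "g = f(0 := f 0 * x)"
  have "weight g t = weight f t * x ^ num_leaves t"
  proof (induction t)
    case (Node ts)
    show ?case
    proof (cases "ts = []")
      case False
      have "(\<Prod>i<length ts. weight g (ts ! i)) = (\<Prod>i<length ts. weight f (ts ! i) * x ^ num_leaves (ts ! i))"
        by (intro prod.cong refl Node) simp
      moreover have "g (length ts) = f (length ts)" using False by (simp add: g_def)
      ultimately show ?thesis using False
        by (simp add: prod.distrib power_sum prod_list_map_nth sum_list_map_nth)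
    qed (simp add: g_def)
  qed
  then show ?thesis by (simp add: g_def)
qed

lemma weight_square: "weight (\<lambda>j. (f j)\<^sup>2) t = (weight f t)\<^sup>2"
  by (induction t) (simp add: prod_list_map_nth power_mult_distrib prod_power_distrib)

section \<open>Labellings\<close>

text \<open>
  Extensional functions, so that different labellings differ at some leaf.
\<close>

definition bijections :: "'a set \<Rightarrow> 'b set \<Rightarrow> ('a \<Rightarrow> 'b) set" where
  "bijections A B = {f \<in> A \<rightarrow>\<^sub>E B. bij_betw f A B}"

lemma finite_bijections [simp]: "finite A \<Longrightarrow> finite B \<Longrightarrow> finite (bijections A B)"
  by (simp add: bijections_def finite_PiE)

lemma card_bijections:
  assumes "finite A" "finite B" "card A = card B"
  shows "card (bijections A B) = fact (card A)"
proof -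
  obtain h where h: "bij_betw h A B"
    using finite_same_card_bij assms by blast
  let ?F = "\<lambda>\<pi>. restrict (h \<circ> \<pi>) A"
  have inj: "inj_on ?F {\<pi>. \<pi> permutes A}"
  proof (rule inj_onI, rule ext)
    fix \<pi> \<pi>' x assume a: "\<pi> \<in> {\<pi>. \<pi> permutes A}" "\<pi>' \<in> {\<pi>. \<pi> permutes A}" "?F \<pi> = ?F \<pi>'"
    show "\<pi> x = \<pi>' x"
    proof (cases "x \<in> A")
      case True
      have "h (\<pi> x) = h (\<pi>' x)" using fun_cong[OF a(3), of x] True by simp
      moreover have "\<pi> x \<in> A" "\<pi>' x \<in> A" using a True by (simp_all add: permutes_in_image)
      ultimately show ?thesis using h by (auto simp: bij_betw_def inj_on_def)
    next
      case False then show ?thesis using a by (simp add: permutes_not_in)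
    qed
  qed
  have "?F ` {\<pi>. \<pi> permutes A} = bijections A B"
  proof (intro equalityI subsetI)
    fix f assume "f \<in> ?F ` {\<pi>. \<pi> permutes A}"
    then obtain \<pi> where \<pi>: "\<pi> permutes A" "f = ?F \<pi>" by blast
    have "bij_betw (h \<circ> \<pi>) A B" using permutes_imp_bij[OF \<pi>(1)] h by (rule bij_betw_trans)
    then have "bij_betw f A B" unfolding \<pi>(2) by (simp cong: bij_betw_cong)
    then show "f \<in> bijections A B" using \<pi>(2) by (auto simp: bijections_def bij_betw_def)
  next
    fix f assume f: "f \<in> bijections A B"
    then have bf: "bij_betw f A B" and ext: "\<And>x. x \<notin> A \<Longrightarrow> f x = undefined"
      by (auto simp: bijections_def)
    define g where "g = inv_into A h"
    define \<pi> where "\<pi> x = (if x \<in> A then g (f x) else x)" for x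
    have bg: "bij_betw g B A" unfolding g_def by (rule bij_betw_inv_into[OF h])
    have "bij_betw (g \<circ> f) A A" using bf bg by (rule bij_betw_trans)
    then have "bij_betw \<pi> A A" by (rule bij_betw_cong[THEN iffD1, rotated]) (simp add: \<pi>_def)
    then have "\<pi> permutes A" by (rule bij_imp_permutes) (simp add: \<pi>_def)
    moreover have "h (\<pi> x) = f x" if "x \<in> A" for x
    proof -
      have "f x \<in> B" using bf that by (auto simp: bij_betw_def)
      then show ?thesis using that h by (simp add: \<pi>_def g_def bij_betw_def f_inv_into_f)
    qed
    then have "f = ?F \<pi>" using ext by (auto simp: fun_eq_iff)
    ultimately show "f \<in> ?F ` {\<pi>. \<pi> permutes A}" by blast
  qed
  then have "card (bijections A B) = card {\<pi>. \<pi> permutes A}" using inj by (metis card_image)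
  then show ?thesis using card_permutations[OF refl assms(1)] by simp
qed

text \<open>
  Such a bijection is determined by its restriction to the complement of \<open>A'\<close>, whose image is
  forced to be the complement of the image of \<open>A'\<close>.
\<close>

lemma card_bijections_extending_le:
  assumes "finite A" "finite B" "card A = card B" "A' \<subseteq> A"
  shows "card {l \<in> bijections A B. \<forall>x\<in>A'. l x = g x} \<le> fact (card A - card A')" (is "card ?L \<le> _")
proof (cases "?L = {}")
  case False
  then obtain l0 where l0: "bij_betw l0 A B" "\<forall>x\<in>A'. l0 x = g x" by (auto simp: bijections_def)
  have gl: "g ` A' = l0 ` A'" using l0(2) by (intro image_cong) auto
  have "inj_on l0 A'" using l0(1) assms(4) by (auto simp: bij_betw_def intro: inj_on_subset)
  then have "inj_on g A'" using l0(2) by (simp cong: inj_on_cong)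
  moreover have "g ` A' \<subseteq> B" unfolding gl using l0(1) assms(4) by (auto simp: bij_betw_def)
  ultimately have ig: "inj_on g A'" "g ` A' \<subseteq> B" by auto
  have fA': "finite A'" using assms by (blast intro: finite_subset)
  have cc: "card (A - A') = card A - card A'" "card (B - g ` A') = card B - card A'"
    using assms ig fA' by (simp_all add: card_Diff_subset card_image)
  have "card ?L \<le> card (bijections (A - A') (B - g ` A'))"
  proof (rule card_inj_on_le)
    show "inj_on (\<lambda>l. restrict l (A - A')) ?L"
    proof (rule inj_onI, rule ext)
      fix l l' x assume a: "l \<in> ?L" "l' \<in> ?L" "restrict l (A - A') = restrict l' (A - A')"
      show "l x = l' x"
      proof (cases "x \<in> A - A'")
        case True then show ?thesis using fun_cong[OF a(3), of x] by simp
      next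
        case False
        then show ?thesis
          using a(1,2) PiE_arb[of l A "\<lambda>_. B" x] PiE_arb[of l' A "\<lambda>_. B" x]
          by (cases "x \<in> A'") (auto simp: bijections_def)
      qed
    qed
    show "(\<lambda>l. restrict l (A - A')) ` ?L \<subseteq> bijections (A - A') (B - g ` A')"
    proof (rule image_subsetI)
      fix l assume "l \<in> ?L"
      then have l: "bij_betw l A B" "\<And>x. x \<in> A' \<Longrightarrow> l x = g x" by (auto simp: bijections_def)
      have im: "l ` A' = g ` A'" using l(2) by (intro image_cong) auto
      have "inj_on l A" "l ` A = B" using l(1) by (auto simp: bij_betw_def)
      then have "l ` (A - A') = B - g ` A'"
        using inj_on_image_set_diff[of l A A A'] assms(4) im by auto
      moreover have "inj_on l (A - A')" using \<open>inj_on l A\<close> by (rule inj_on_subset) auto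
      ultimately have "bij_betw l (A - A') (B - g ` A')" by (simp add: bij_betw_def)
      then show "restrict l (A - A') \<in> bijections (A - A') (B - g ` A')"
        by (auto simp: bijections_def bij_betw_def)
    qed
  qed (use assms in simp)
  then show ?thesis using card_bijections[of "A - A'" "B - g ` A'"] cc assms by simp
next
  case True then show ?thesis by (simp only: card.empty le0)
qed

lemma labellings_eq: "labellings n V = bijections (leaves V) {1..n}"
  by (simp add: labellings_def bijections_def)

lemma card_labellings: "num_leaves t = n \<Longrightarrow> card (labellings n (verts t)) = fact n"
  unfolding labellings_eq by (subst card_bijections) (auto simp: card_leaves_verts)

section \<open>The conditioned Galton--Watson tree\<close>

lemma Nil_in_gw_tree [simp]: "[] \<in> gw_tree \<omega>"
  by (simp add: gw_tree_def)

lemma snoc_in_gw_tree: "v @ [i] \<in> gw_tree \<omega> \<longleftrightarrow> v \<in> gw_tree \<omega> \<and> i < \<omega> v"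
  by (auto simp: gw_tree_def less_Suc_eq nth_append)

lemma gw_tree_eq_iff:
  assumes "plane_tree V"
  shows "gw_tree \<omega> = V \<longleftrightarrow> (\<forall>v\<in>V. \<omega> v = outdeg V v)"
proof
  assume eq: "gw_tree \<omega> = V"
  show "\<forall>v\<in>V. \<omega> v = outdeg V v"
  proof
    fix v assume "v \<in> V"
    then have "{i. v @ [i] \<in> V} = {..<\<omega> v}" using snoc_in_gw_tree[of v _ \<omega>] eq by auto
    then show "\<omega> v = outdeg V v" by (simp add: outdeg_def)
  qed
next
  assume od: "\<forall>v\<in>V. \<omega> v = outdeg V v"
  have "v \<in> gw_tree \<omega> \<longleftrightarrow> v \<in> V" for v
  proof (induction v rule: rev_induct)
    case Nil then show ?case using assms by (simp add: plane_tree_def)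
  next
    case (snoc i v)
    have "v @ [i] \<in> V \<longleftrightarrow> v \<in> V \<and> i < outdeg V v"
      using plane_tree_append_iff[OF assms, of v i] assms unfolding plane_tree_def by blast
    then show ?case using snoc od by (auto simp: snoc_in_gw_tree)
  qed
  then show "gw_tree \<omega> = V" by blast
qed

lemma plane_tree_gw_tree: "finite (gw_tree \<omega>) \<Longrightarrow> plane_tree (gw_tree \<omega>)"
  unfolding plane_tree_def by (auto simp: snoc_in_gw_tree)

lemma prob_space_gw_space: "prob_space (gw_space p)"
proof -
  interpret product_prob_space "\<lambda>_. measure_pmf p" UNIV ..
  show ?thesis unfolding gw_space_def by unfold_locales
qed

lemma space_gw_space [simp]: "space (gw_space p) = UNIV"
  by (simp add: gw_space_def space_PiM)

text \<open>
  The Galton--Watson tree is \<open>verts t\<close> iff the offspring numbers at finitely many addresses are the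
  out-degrees of \<open>t\<close>: a cylinder event.
\<close>

lemma gw_tree_event:
  fixes p :: "nat pmf"
  shows "{\<omega>. gw_tree \<omega> = verts t} \<in> sets (gw_space p)" (is ?thesis1)
    and "measure (gw_space p) {\<omega>. gw_tree \<omega> = verts t} = weight (pmf p) t" (is ?thesis2)
proof -
  interpret product_prob_space "\<lambda>_. measure_pmf p" "UNIV :: vertex set" ..
  let ?V = "verts t"
  have eq: "{\<omega>. gw_tree \<omega> = ?V} = prod_emb UNIV (\<lambda>_. measure_pmf p) ?V (Pi\<^sub>E ?V (\<lambda>v. {outdeg ?V v}))"
    by (auto simp: gw_tree_eq_iff[OF plane_tree_verts] prod_emb_def PiE_iff)
  show ?thesis1 unfolding eq gw_space_def by (rule sets_PiM_I) auto
  show ?thesis2 unfolding eq gw_space_def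
    by (subst measure_PiM_emb) (auto simp: prod_outdeg_eq_weight measure_pmf_single)
qed

lemma has_n_leaves_iff: "has_n_leaves n (gw_tree \<omega>) \<longleftrightarrow> (\<exists>t. num_leaves t = n \<and> gw_tree \<omega> = verts t)"
proof
  assume h: "has_n_leaves n (gw_tree \<omega>)"
  then obtain t where "gw_tree \<omega> = verts t"
    using plane_tree_is_verts plane_tree_gw_tree unfolding has_n_leaves_def by metis
  then show "\<exists>t. num_leaves t = n \<and> gw_tree \<omega> = verts t" 
    using h card_leaves_verts[of t] by (auto simp: has_n_leaves_def)
qed (auto simp: has_n_leaves_def card_leaves_verts)

definition leafprob :: "nat pmf \<Rightarrow> nat \<Rightarrow> real" where
  "leafprob p n = (\<Sum>t\<in>trees n. weight (pmf p) t)"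

lemma countable_ptree: "countable (A :: ptree set)"
proof -
  have "countable {V :: vertex set. finite V}" by (rule countable_Collect_finite)
  then have "countable (verts ` A)" by (rule countable_subset[rotated]) auto
  then show ?thesis by (rule countable_image_inj_on) (auto intro: inj_onI inj_verts)
qed

text \<open>
  Trees with unary vertices form a countable union of null events; the remaining trees with \<open>n\<close>
  leaves are finite in number.
\<close>

lemma prob_n_leaves_eq:
  assumes p1: "pmf p 1 = 0"
  shows "prob_n_leaves p n = leafprob p n"
proof -
  interpret prob_space "gw_space p" by (rule prob_space_gw_space)
  define E where "E t = {\<omega>. gw_tree \<omega> = verts t}" for t
  have E: "E t \<in> sets (gw_space p)" "prob (E t) = weight (pmf p) t" for t
    by (simp_all add: E_def gw_tree_event)
  define N where "N = (\<Union>t\<in>{t. \<not> nounary t \<and> num_leaves t = n}. E t)"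
  have "E t \<in> null_sets (gw_space p)" if "\<not> nounary t" for t
    using E weight_unary_0[of "pmf p" t, OF p1 that] by (simp add: null_sets_def emeasure_eq_measure)
  then have N: "N \<in> null_sets (gw_space p)"
    unfolding N_def by (intro null_sets_UN' countable_ptree) auto
  have "{\<omega>. has_n_leaves n (gw_tree \<omega>)} = (\<Union>t\<in>trees n. E t) \<union> N"
    by (auto simp: has_n_leaves_iff E_def N_def trees_def)
  then have "prob_n_leaves p n = prob ((\<Union>t\<in>trees n. E t) \<union> N)"
    by (simp add: prob_n_leaves_def)
  also have "\<dots> = prob (\<Union>t\<in>trees n. E t)"
    using E N by (intro measure_Un_null_set) auto
  also have "\<dots> = (\<Sum>t\<in>trees n. prob (E t))"
    using E(1) by (intro finite_measure_finite_Union) (auto simp: disjoint_family_on_def E_def dest: inj_verts)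
  finally show ?thesis by (simp add: E leafprob_def)
qed

lemma leafprob_nonneg: "leafprob p n \<ge> 0"
  unfolding leafprob_def by (intro sum_nonneg weight_nonneg) simp

text \<open>
  The conditional probabilities are supported by finitely many trees and sum to 1, so that
  \<open>embed_pmf\<close> really yields a distribution with these values.
\<close>

lemma conditioned_gw_tree_pmf:
  assumes p1: "pmf p 1 = 0" and q: "leafprob p n > 0"
  shows "pmf (conditioned_gw_tree p n) V =
    (if V \<in> verts ` trees n then (\<Prod>v\<in>V. pmf p (outdeg V v)) / leafprob p n else 0)"
proof -
  interpret prob_space "gw_space p" by (rule prob_space_gw_space)
  define f where "f V = \<P>(\<omega> in gw_space p. gw_tree \<omega> = V \<bar> has_n_leaves n (gw_tree \<omega>))" for V
  have f: "f V = prob {\<omega>. gw_tree \<omega> = V \<and> has_n_leaves n (gw_tree \<omega>)} / leafprob p n" for V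
    using prob_n_leaves_eq[OF p1, of n] by (simp add: f_def cond_prob_def prob_n_leaves_def)
  have f1: "f (verts t) = weight (pmf p) t / leafprob p n" if "t \<in> trees n" for t
  proof -
    have "{\<omega>. gw_tree \<omega> = verts t \<and> has_n_leaves n (gw_tree \<omega>)} = {\<omega>. gw_tree \<omega> = verts t}"
      using that by (auto simp: has_n_leaves_iff trees_def)
    then show ?thesis by (simp add: f gw_tree_event)
  qed
  have f0: "f V = 0" if V: "V \<notin> verts ` trees n" for V
  proof (cases "{\<omega>. gw_tree \<omega> = V \<and> has_n_leaves n (gw_tree \<omega>)} = {}")
    case True then show ?thesis by (simp only: f) simp
  next
    case False
    then obtain t where t: "num_leaves t = n" "V = verts t" by (auto simp: has_n_leaves_iff)
    then have "\<not> nounary t" using V by (auto simp: trees_def)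
    then have "weight (pmf p) t = 0" by (rule weight_unary_0[where f = "pmf p", OF p1])
    moreover have "{\<omega>. gw_tree \<omega> = V \<and> has_n_leaves n (gw_tree \<omega>)} = {\<omega>. gw_tree \<omega> = V}"
      using t by (auto simp: has_n_leaves_iff)
    ultimately show ?thesis using t by (simp add: f gw_tree_event)
  qed
  have inj: "inj_on verts (trees n)" by (auto intro: inj_onI inj_verts)
  have "(\<integral>\<^sup>+V. ennreal (f V) \<partial>count_space UNIV) = (\<Sum>V\<in>verts ` trees n. ennreal (f V))"
    by (rule nn_integral_count_space') (auto simp: f0)
  also have "\<dots> = ennreal (\<Sum>V\<in>verts ` trees n. f V)"
    by (rule sum_ennreal) (auto simp: f leafprob_nonneg intro!: divide_nonneg_nonneg)
  also have "(\<Sum>V\<in>verts ` trees n. f V) = (\<Sum>t\<in>trees n. f (verts t))"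
    using inj by (simp add: sum.reindex)
  also have "\<dots> = 1" using q f1 by (simp add: leafprob_def flip: sum_divide_distrib)
  finally have one: "(\<integral>\<^sup>+V. ennreal (f V) \<partial>count_space UNIV) = 1" by simp
  have "pmf (conditioned_gw_tree p n) V = f V"
    unfolding conditioned_gw_tree_def f_def[symmetric]
    by (rule pmf_embed_pmf) (use one in \<open>auto simp: f leafprob_nonneg intro!: divide_nonneg_nonneg\<close>)
  then show ?thesis using f0 f1 by (auto simp: prod_outdeg_eq_weight)
qed

lemma prob_random_tree:
  assumes p1: "pmf p 1 = 0" and q: "leafprob p n > 0"
  shows "measure_pmf.prob (random_tree p n) E =
    (\<Sum>t\<in>trees n. weight (pmf p) t / leafprob p n *
       (real (card {l \<in> labellings n (verts t). (verts t, l) \<in> E}) / fact n))"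
proof -
  note cp = conditioned_gw_tree_pmf[OF p1 q]
  let ?N = "\<lambda>V. map_pmf (Pair V) (pmf_of_set (labellings n V))"
  have inj: "inj_on verts (trees n)" by (auto intro: inj_onI inj_verts)
  have "emeasure (random_tree p n) E = (\<integral>\<^sup>+V. emeasure (?N V) E \<partial>conditioned_gw_tree p n)"
    unfolding random_tree_def by (rule emeasure_bind_pmf)
  also have "\<dots> = (\<Sum>V\<in>verts ` trees n. emeasure (?N V) E * pmf (conditioned_gw_tree p n) V)"
  proof (rule nn_integral_measure_pmf_support)
    fix V assume "V \<in> set_pmf (conditioned_gw_tree p n)" "V \<notin> verts ` trees n"
    then show "emeasure (?N V) E = 0" by (simp add: set_pmf_iff cp)
  qed auto
  also have "\<dots> = (\<Sum>t\<in>trees n. emeasure (?N (verts t)) E * pmf (conditioned_gw_tree p n) (verts t))"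
    by (simp add: sum.reindex[OF inj])
  also have "\<dots> = ennreal (\<Sum>t\<in>trees n. measure (?N (verts t)) E * pmf (conditioned_gw_tree p n) (verts t))"
    by (subst sum_ennreal[symmetric]) (auto simp: measure_pmf.emeasure_eq_measure ennreal_mult')
  finally have "measure (random_tree p n) E
      = (\<Sum>t\<in>trees n. measure (?N (verts t)) E * pmf (conditioned_gw_tree p n) (verts t))"
    by (simp add: measure_pmf.emeasure_eq_measure sum_nonneg)
  also have "\<dots> = (\<Sum>t\<in>trees n. weight (pmf p) t / leafprob p n *
       (real (card {l \<in> labellings n (verts t). (verts t, l) \<in> E}) / fact n))"
  proof (intro sum.cong refl)
    fix t assume t: "t \<in> trees n"
    let ?L = "labellings n (verts t)"
    have c: "card ?L = fact n" using t card_labellings[of t n] by (simp add: trees_def)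
    have fin: "finite ?L" unfolding labellings_eq by simp
    have ne: "?L \<noteq> {}" using c by (metis card.empty fact_nonzero)
    have "measure (?N (verts t)) E = measure (pmf_of_set ?L) (Pair (verts t) -` E)" by simp
    also have "\<dots> = real (card (?L \<inter> Pair (verts t) -` E)) / real (card ?L)"
      using measure_pmf_of_set[OF ne fin] by simp
    also have "?L \<inter> Pair (verts t) -` E = {l \<in> ?L. (verts t, l) \<in> E}" by auto
    finally show "measure (?N (verts t)) E * pmf (conditioned_gw_tree p n) (verts t) =
      weight (pmf p) t / leafprob p n * (real (card {l \<in> ?L. (verts t, l) \<in> E}) / fact n)"
      using t c by (simp add: cp prod_outdeg_eq_weight mult_ac)
  qed
  finally show ?thesis .
qed

lemma set_random_tree:
  assumes p1: "pmf p 1 = 0" and q: "leafprob p n > 0"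
  shows "set_pmf (random_tree p n) \<subseteq> (SIGMA V:verts ` trees n. labellings n V)"
proof -
  have "set_pmf (conditioned_gw_tree p n) \<subseteq> verts ` trees n"
    using conditioned_gw_tree_pmf[OF p1 q] by (auto simp: set_pmf_iff split: if_splits)
  moreover have "set_pmf (pmf_of_set (labellings n (verts t))) = labellings n (verts t)" if "t \<in> trees n" for t
  proof (rule set_pmf_of_set)
    show "labellings n (verts t) \<noteq> {}" using that card_labellings[of t n] 
      by (metis (mono_tags, lifting) card.empty fact_nonzero mem_Collect_eq trees_def)
    show "finite (labellings n (verts t))" unfolding labellings_eq by simp
  qed
  ultimately show ?thesis unfolding random_tree_def by fastforce
qed

section \<open>Induced subtrees and the first moment\<close>

lemma lca_subtree_subset: "plane_tree V \<Longrightarrow> lca_subtree S (V, l) \<subseteq> V"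
  by (auto simp: lca_subtree_def leaves_with_label_def leaves_def intro: plane_tree_prefix)

lemma strict_mono_self_map_id:
  fixes e :: "nat \<Rightarrow> nat"
  assumes "\<And>i j. i < j \<Longrightarrow> j < d \<Longrightarrow> e i < e j" "\<And>i. i < d \<Longrightarrow> e i < d" "i < d"
  shows "e i = i"
proof -
  have ge: "i < d \<Longrightarrow> i \<le> e i" for i
  proof (induction i)
    case (Suc i)
    then show ?case using assms(1)[of i "Suc i"] by auto
  qed simp
  have "k < d \<Longrightarrow> e (d - 1 - k) \<le> d - 1 - k" for k
  proof (induction k)
    case 0 then show ?case using assms(2)[of "d - 1"] by auto
  next
    case (Suc k)
    have "e (d - 1 - Suc k) < e (d - 1 - k)" using Suc.prems by (intro assms(1)) auto
    then show ?case using Suc by auto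
  qed
  from this[of "d - 1 - i"] ge[of i] assms(3) show ?thesis by auto
qed

text \<open>
  The children of \<open>x\<close> are mapped below children of \<open>\<phi> x\<close> with strictly increasing numbers.  Since \<open>x\<close>
  and \<open>\<phi> x\<close> have equally many children, these numbers leave no room: the \<open>i\<close>-th child lies below the
  \<open>i\<close>-th.
\<close>

lemma induces_imp_embedding:
  assumes pV: "plane_tree V" and ind: "induces S (V, l) (W, m)"
  shows "\<exists>\<phi>\<in>embeddings W V. \<forall>x\<in>leaves W. l (\<phi> x) = m x"
proof -
  let ?K = "kept_vertices S (V, l)"
  have pW: "plane_tree W" using ind by (auto simp: induces_def leaf_labelled_def)
  obtain \<phi> where bij: "bij_betw \<phi> W ?K"
    and ch: "\<And>x y. x \<in> W \<Longrightarrow> y \<in> W \<Longrightarrow> is_child W x y \<longleftrightarrow> is_child ?K (\<phi> x) (\<phi> y)"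
    and sib: "\<And>x y z. x \<in> W \<Longrightarrow> is_child W x y \<Longrightarrow> is_child W x z \<Longrightarrow>
      sibling_less x y z \<longleftrightarrow> sibling_less (\<phi> x) (\<phi> y) (\<phi> z)"
    and lab: "\<And>x. x \<in> leaves W \<Longrightarrow> l (\<phi> x) = m x"
    and od: "\<And>x. x \<in> W \<Longrightarrow> outdeg V (\<phi> x) = outdeg W x"
    using ind unfolding induces_def by auto
  have KV: "?K \<subseteq> V" using lca_subtree_subset[OF pV, of S l] by (auto simp: kept_vertices_def)
  have inV: "\<phi> x \<in> V" if "x \<in> W" for x using bij that KV by (auto simp: bij_betw_def)
  have parent: "x \<in> W" if "x @ [i] \<in> W" for x i
    using plane_tree_prefix[OF pW that] by simp
  have child: "is_child W x (x @ [i])" if "x @ [i] \<in> W" for x i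
    using that parent[OF that] by (auto simp: is_child_def strict_prefix_def prefix_order.antisym)
  have step: "prefix (\<phi> x @ [i]) (\<phi> (x @ [i]))" if xi: "x @ [i] \<in> W" for x i
  proof -
    have x: "x \<in> W" by (rule parent[OF xi])
    let ?d = "outdeg W x"
    define e where "e j = \<phi> (x @ [j]) ! length (\<phi> x)" for j
    have xj: "x @ [j] \<in> W \<longleftrightarrow> j < ?d" for j by (rule plane_tree_append_iff[OF pW])
    have pre: "prefix (\<phi> x @ [e j]) (\<phi> (x @ [j]))" if "j < ?d" for j
    proof -
      have "is_child ?K (\<phi> x) (\<phi> (x @ [j]))" using ch[OF x, of "x @ [j]"] child[of x j] xj that by auto
      then have "strict_prefix (\<phi> x) (\<phi> (x @ [j]))" by (simp add: is_child_def)
      then obtain k w where "\<phi> (x @ [j]) = \<phi> x @ k # w" by (elim strict_prefixE')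
      then show ?thesis by (simp add: e_def)
    qed
    have "e i = i"
    proof (rule strict_mono_self_map_id[of ?d])
      fix j k assume jk: "j < k" "k < ?d"
      have "sibling_less x (x @ [j]) (x @ [k])" using jk by (simp add: sibling_less_def)
      then have "sibling_less (\<phi> x) (\<phi> (x @ [j])) (\<phi> (x @ [k]))"
        using sib[OF x child[of x j] child[of x k]] xj jk by auto
      then show "e j < e k" by (simp add: sibling_less_def e_def)
    next
      fix j assume j: "j < ?d"
      have "\<phi> x @ [e j] \<in> V" using plane_tree_prefix[OF pV _ pre[OF j]] inV xj j by blast
      then show "e j < ?d" using plane_tree_append_iff[OF pV] od[OF x] by simp
    next
      show "i < ?d" using xi xj by simp
    qed
    then show ?thesis using pre[of i] xi xj by simp
  qed
  have "restrict \<phi> W \<in> embeddings W V"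
    using inV od step parent by (intro embeddingsI) simp_all
  moreover have "l (restrict \<phi> W x) = m x" if "x \<in> leaves W" for x
    using lab[OF that] that by (simp add: leaves_def)
  ultimately show ?thesis by blast
qed

text \<open>
  Up to the factor \<open>1 / leafprob p n\<close>, the expected number of embeddings of \<open>W\<close> into the
  conditioned tree.
\<close>

definition embedding_weight :: "nat pmf \<Rightarrow> nat \<Rightarrow> ptree \<Rightarrow> real" where
  "embedding_weight p n W = (\<Sum>t\<in>trees n. weight (pmf p) t * real (card (embeddings (verts W) (verts t))))"

text \<open>
  An embedding prescribes the labels of \<open>a\<close> leaves; the other \<open>n - a\<close> labels can be permuted.
\<close>

lemma card_inducing_labellings_le:
  assumes t: "num_leaves t = n" and W: "num_leaves W = a" and m: "inj_on m (leaves (verts W))"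
  shows "card {l \<in> labellings n (verts t). induces S (verts t, l) (verts W, m)}
    \<le> card (embeddings (verts W) (verts t)) * fact (n - a)"
proof -
  let ?V = "verts t" let ?W = "verts W" let ?L = "labellings n (verts t)"
  let ?B = "\<lambda>\<phi>. {l \<in> ?L. \<forall>x\<in>leaves ?W. l (\<phi> x) = m x}"
  have finL: "finite ?L" unfolding labellings_eq by simp
  have one: "card (?B \<phi>) \<le> fact (n - a)" if \<phi>: "\<phi> \<in> embeddings ?W ?V" for \<phi>
  proof (cases "?B \<phi> = {}")
    case False
    then obtain l0 where "\<forall>x\<in>leaves ?W. l0 (\<phi> x) = m x" by blast
    then have inj: "inj_on \<phi> (leaves ?W)" using m unfolding inj_on_def by metis
    have leaf: "\<phi> x \<in> leaves ?V" if "x \<in> leaves ?W" for x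
    proof -
      have x: "x \<in> ?W" and nx: "\<And>i. x @ [i] \<notin> ?W" using that by (auto simp: leaves_def)
      have "outdeg ?W x = 0" using nx by (simp add: outdeg_def)
      then have "outdeg ?V (\<phi> x) = 0" using embeddingsD(3)[OF \<phi> x] by simp
      then show ?thesis using embeddingsD(1)[OF \<phi> x] plane_tree_append_iff[OF plane_tree_verts, of "\<phi> x"]
        by (simp add: leaves_def)
    qed
    define g where "g y = m (inv_into (leaves ?W) \<phi> y)" for y
    have "?B \<phi> = {l \<in> bijections (leaves ?V) {1..n}. \<forall>y\<in>\<phi> ` leaves ?W. l y = g y}"
      using inj by (auto simp: labellings_eq g_def)
    also have "card \<dots> \<le> fact (card (leaves ?V) - card (\<phi> ` leaves ?W))"
      using leaf by (intro card_bijections_extending_le) (auto simp: card_leaves_verts t)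
    also have "card (\<phi> ` leaves ?W) = a" using inj by (simp add: card_image card_leaves_verts W)
    finally show ?thesis by (simp add: card_leaves_verts t)
  next
    case True then show ?thesis by (simp only: card.empty le0)
  qed
  have "card {l \<in> ?L. induces S (?V, l) (?W, m)} \<le> card (\<Union>\<phi>\<in>embeddings ?W ?V. ?B \<phi>)"
    using induces_imp_embedding[OF plane_tree_verts] finL by (intro card_mono) auto
  also have "\<dots> \<le> (\<Sum>\<phi>\<in>embeddings ?W ?V. card (?B \<phi>))" by (rule card_UN_le) simp
  also have "\<dots> \<le> (\<Sum>\<phi>\<in>embeddings ?W ?V. fact (n - a))" using one by (intro sum_mono) auto
  finally show ?thesis by simp
qed

lemma prob_induces_le:
  assumes p1: "pmf p 1 = 0" and q: "leafprob p n > 0"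
    and W: "num_leaves W = a" and m: "inj_on m (leaves (verts W))"
  shows "measure_pmf.prob (random_tree p n) {T. induces S T (verts W, m)}
    \<le> embedding_weight p n W / leafprob p n * (fact (n - a) / fact n)"
proof -
  have "measure_pmf.prob (random_tree p n) {T. induces S T (verts W, m)}
    \<le> (\<Sum>t\<in>trees n. weight (pmf p) t / leafprob p n *
        (real (card (embeddings (verts W) (verts t)) * fact (n - a)) / fact n))"
    unfolding prob_random_tree[OF p1 q]
  proof (intro sum_mono mult_left_mono divide_right_mono)
    fix t assume "t \<in> trees n"
    then have "num_leaves t = n" by (simp add: trees_def)
    then show "real (card {l \<in> labellings n (verts t). (verts t, l) \<in> {T. induces S T (verts W, m)}})
      \<le> real (card (embeddings (verts W) (verts t)) * fact (n - a))"
      using card_inducing_labellings_le[OF _ W m, of t n S] by (simp only: of_nat_le_iff mem_Collect_eq)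
  qed (use q in \<open>auto intro!: divide_nonneg_pos weight_nonneg\<close>)
  also have "\<dots> = embedding_weight p n W / leafprob p n * (fact (n - a) / fact n)"
    unfolding embedding_weight_def sum_divide_distrib sum_distrib_right by (intro sum.cong) simp_all
  finally show ?thesis .
qed

text \<open>
  Only finitely many labelled trees have to be considered as common subtrees once the values of
  the labelling off the leaves are discarded.
\<close>

lemma induces_shape:
  assumes "induces S T (W, m)"
  shows "\<exists>t\<in>trees (card S). W = verts t \<and> restrict m (leaves W) \<in> bijections (leaves W) S"
    and "induces S T (W, restrict m (leaves W))"
proof -
  have pW: "plane_tree W" and b: "bij_betw m (leaves W) S"
    and od: "\<forall>x\<in>W - leaves W. 2 \<le> outdeg W x"
    using assms by (auto simp: induces_def leaf_labelled_def)
  obtain t where t: "W = verts t" using plane_tree_is_verts[OF pW] by blast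
  have "outdeg W x \<noteq> 1" if "x \<in> W" for x
  proof (cases "x \<in> leaves W")
    case True then show ?thesis by (simp add: leaves_def outdeg_def)
  next
    case False then show ?thesis using od that by force
  qed
  then have "nounary t" by (simp add: nounary_iff t)
  moreover have "num_leaves t = card S" using bij_betw_same_card[OF b] by (simp add: t card_leaves_verts)
  ultimately have "t \<in> trees (card S)" by (simp add: trees_def)
  moreover have b': "bij_betw (restrict m (leaves W)) (leaves W) S"
    using b by (simp cong: bij_betw_cong)
  then have "restrict m (leaves W) \<in> bijections (leaves W) S"
    by (auto simp: bijections_def bij_betw_def)
  ultimately show "\<exists>t\<in>trees (card S). W = verts t \<and> restrict m (leaves W) \<in> bijections (leaves W) S"
    using t by blast
  show "induces S T (W, restrict m (leaves W))"
    using assms b' unfolding induces_def leaf_labelled_def by simp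
qed

lemma prob_pair_Times:
  "measure_pmf.prob (pair_pmf M N) (A \<times> B) = measure_pmf.prob M A * measure_pmf.prob N B"
proof -
  have "measure_pmf.prob (pair_pmf M N) (A \<times> B)
      = measure_pmf.prob (pair_pmf M N) ((A \<times> B) \<inter> set_pmf (pair_pmf M N))"
    by (simp only: measure_Int_set_pmf)
  also have "(A \<times> B) \<inter> set_pmf (pair_pmf M N) = (A \<inter> set_pmf M) \<times> (B \<inter> set_pmf N)" by auto
  also have "measure_pmf.prob (pair_pmf M N) \<dots>
      = measure_pmf.prob M (A \<inter> set_pmf M) * measure_pmf.prob N (B \<inter> set_pmf N)"
    by (rule measure_pmf_prob_product) (auto intro: countable_subset[OF _ countable_set_pmf])
  finally show ?thesis by (simp add: measure_Int_set_pmf)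
qed

text \<open>
  A union bound over the shapes \<open>W\<close> and the \<open>a!\<close> labellings of each.  Independence of the two copies
  squares the probability of each labelled shape.
\<close>

lemma prob_same_induced_le:
  assumes p1: "pmf p 1 = 0" and q: "leafprob p n > 0" and S: "finite S" "card S = a"
  shows "measure_pmf.prob (two_copies p n) {(T, T'). same_induced S T T'}
    \<le> fact a * (\<Sum>W\<in>trees a. (embedding_weight p n W / leafprob p n * (fact (n - a) / fact n))\<^sup>2)"
proof -
  let ?B = "\<lambda>W. bijections (leaves (verts W)) S"
  let ?I = "\<lambda>W m. {T. induces S T (verts W, m)}"
  let ?P = "measure_pmf.prob (random_tree p n)"
  have "{(T, T'). same_induced S T T'} \<subseteq> (\<Union>W\<in>trees a. \<Union>m\<in>?B W. ?I W m \<times> ?I W m)"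
  proof clarify
    fix T T' assume "same_induced S T T'"
    then obtain W m where ind: "induces S T (W, m)" "induces S T' (W, m)"
      by (auto simp: same_induced_def)
    obtain t where t: "t \<in> trees a" "W = verts t" "restrict m (leaves W) \<in> bijections (leaves W) S"
      using induces_shape(1)[OF ind(1)] S by blast
    then show "(T, T') \<in> (\<Union>W\<in>trees a. \<Union>m\<in>?B W. ?I W m \<times> ?I W m)"
      using ind[THEN induces_shape(2)] by auto
  qed
  then have "measure_pmf.prob (two_copies p n) {(T, T'). same_induced S T T'}
    \<le> measure_pmf.prob (two_copies p n) (\<Union>W\<in>trees a. \<Union>m\<in>?B W. ?I W m \<times> ?I W m)"
    by (intro measure_pmf.finite_measure_mono) auto
  also have "\<dots> \<le> (\<Sum>W\<in>trees a. measure_pmf.prob (two_copies p n) (\<Union>m\<in>?B W. ?I W m \<times> ?I W m))"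
    by (intro measure_UNION_le) auto
  also have "\<dots> \<le> (\<Sum>W\<in>trees a. \<Sum>m\<in>?B W. measure_pmf.prob (two_copies p n) (?I W m \<times> ?I W m))"
    using S by (intro sum_mono measure_UNION_le) auto
  also have "\<dots> = (\<Sum>W\<in>trees a. \<Sum>m\<in>?B W. (?P (?I W m))\<^sup>2)"
    by (simp only: two_copies_def prob_pair_Times power2_eq_square)
  also have "\<dots> \<le> (\<Sum>W\<in>trees a. \<Sum>m\<in>?B W. (embedding_weight p n W / leafprob p n * (fact (n - a) / fact n))\<^sup>2)"
  proof (intro sum_mono power_mono prob_induces_le[OF p1 q])
    fix W m assume "W \<in> trees a" "m \<in> ?B W"
    then show "num_leaves W = a" "inj_on m (leaves (verts W))"
      by (auto simp: trees_def bijections_def bij_betw_def)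
  qed simp
  also have "\<dots> = (\<Sum>W\<in>trees a. fact a * (embedding_weight p n W / leafprob p n * (fact (n - a) / fact n))\<^sup>2)"
  proof (intro sum.cong refl)
    fix W assume "W \<in> trees a"
    then have "card (?B W) = fact a" using S by (subst card_bijections) (auto simp: trees_def card_leaves_verts)
    then show "(\<Sum>m\<in>?B W. (embedding_weight p n W / leafprob p n * (fact (n - a) / fact n))\<^sup>2)
      = fact a * (embedding_weight p n W / leafprob p n * (fact (n - a) / fact n))\<^sup>2" by simp
  qed
  finally show ?thesis by (simp add: sum_distrib_left)
qed

lemma expectation_X_eq:
  "measure_pmf.expectation (two_copies p n) (\<lambda>TT. real (X n a TT))
    = (\<Sum>S\<in>{S. S \<subseteq> {1..n} \<and> card S = a}. measure_pmf.prob (two_copies p n) {(T, T'). same_induced S T T'})"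
proof -
  let ?A = "{S. S \<subseteq> {1..n} \<and> card S = a}"
  have fin: "finite ?A" by (rule finite_subset[of _ "Pow {1..n}"]) auto
  have "real (X n a TT) = (\<Sum>S\<in>?A. indicator {(T, T'). same_induced S T T'} TT)" for TT
  proof -
    obtain T T' where TT: "TT = (T, T')" by (cases TT)
    have "(\<Sum>S\<in>?A. indicator {(T, T'). same_induced S T T'} TT)
        = (\<Sum>S\<in>?A. if same_induced S T T' then 1 else (0 :: real))"
      by (intro sum.cong) (auto simp: TT indicator_def)
    also have "\<dots> = real (card {S\<in>?A. same_induced S T T'})"
      using fin by (simp add: sum.If_cases Int_def)
    also have "{S\<in>?A. same_induced S T T'} = {S. S \<subseteq> {1..n} \<and> card S = a \<and> same_induced S T T'}" by auto
    finally show ?thesis by (simp add: X_def TT)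
  qed
  then have "measure_pmf.expectation (two_copies p n) (\<lambda>TT. real (X n a TT))
    = measure_pmf.expectation (two_copies p n) (\<lambda>TT. \<Sum>S\<in>?A. indicator {(T, T'). same_induced S T T'} TT)"
    by simp
  also have "\<dots> = (\<Sum>S\<in>?A. measure_pmf.expectation (two_copies p n) (indicator {(T, T'). same_induced S T T'}))"
    by (intro Bochner_Integration.integral_sum measure_pmf.integrable_const_bound[where B = 1])
       (auto simp: indicator_def)
  finally show ?thesis by simp
qed

text \<open>
  There are \<open>n choose a\<close> sets, and
  \<open>(n choose a) * a! * ((n - a)! / n!)\<^sup>2 = (n - a)! / n!\<close>.
\<close>

lemma expectation_X_le:
  assumes p1: "pmf p 1 = 0" and q: "leafprob p n > 0" and a: "a \<le> n"
  shows "measure_pmf.expectation (two_copies p n) (\<lambda>TT. real (X n a TT))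
    \<le> fact (n - a) / fact n * (\<Sum>W\<in>trees a. (embedding_weight p n W)\<^sup>2) / (leafprob p n)\<^sup>2"
proof -
  let ?A = "{S. S \<subseteq> {1..n} \<and> card S = a}"
  define r :: real where "r = fact (n - a) / fact n"
  have "measure_pmf.expectation (two_copies p n) (\<lambda>TT. real (X n a TT))
    \<le> (\<Sum>S\<in>?A. fact a * (\<Sum>W\<in>trees a. (embedding_weight p n W / leafprob p n * r)\<^sup>2))"
    unfolding expectation_X_eq r_def
    by (intro sum_mono prob_same_induced_le[OF p1 q]) (auto intro: finite_subset)
  also have "\<dots> = real (n choose a) * fact a * (\<Sum>W\<in>trees a. (embedding_weight p n W / leafprob p n * r)\<^sup>2)"
    by (simp add: n_subsets)
  also have "real (n choose a) * fact a = 1 / r"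
    using a by (simp add: binomial_fact r_def)
  also have "(\<Sum>W\<in>trees a. (embedding_weight p n W / leafprob p n * r)\<^sup>2)
      = r\<^sup>2 * (\<Sum>W\<in>trees a. (embedding_weight p n W)\<^sup>2) / (leafprob p n)\<^sup>2"
    by (simp add: power_mult_distrib power_divide sum_distrib_left sum_divide_distrib mult_ac)
  also have "1 / r * (r\<^sup>2 * (\<Sum>W\<in>trees a. (embedding_weight p n W)\<^sup>2) / (leafprob p n)\<^sup>2)
      = r * (\<Sum>W\<in>trees a. (embedding_weight p n W)\<^sup>2) / (leafprob p n)\<^sup>2"
    by (simp add: power2_eq_square r_def)
  finally show ?thesis by (simp only: r_def)
qed

lemma expectation_X_0:
  assumes "a > n" shows "measure_pmf.expectation (two_copies p n) (\<lambda>TT. real (X n a TT)) = 0"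
proof -
  have "\<not> (S \<subseteq> {1..n} \<and> card S = a)" for S
    using card_mono[of "{1..n}" S] assms by auto
  then have "{S. S \<subseteq> {1..n} \<and> card S = a} = {}" by blast
  then show ?thesis unfolding expectation_X_eq by (simp only: sum.empty)
qed

text \<open>
  A single leaf is a common subtree of any two trees; this makes the set whose maximum is
  \<open>max_common\<close> nonempty.
\<close>

lemma induces_singleton:
  assumes l: "bij_betw l (leaves (verts t)) {1..n}" and k: "k \<in> {1..n}"
  shows "induces {k} (verts t, l) ({[]}, \<lambda>_. k)"
proof -
  let ?T = "(verts t, l)"
  obtain u where u: "u \<in> leaves (verts t)" "l u = k"
    using l k by (metis bij_betw_imp_surj_on imageE)
  have ll: "leaves_with_label {k} ?T = {u}"
    using u l by (auto simp: leaves_with_label_def bij_betw_def inj_on_def)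
  have lca: "lca {k} ?T = u" unfolding lca_def ll
    by (rule Longest_common_prefix_eq) (auto dest: prefix_length_le)
  have sub: "lca_subtree {k} ?T = {u}"
    unfolding lca_subtree_def lca ll by (auto dest: prefix_order.antisym)
  have kept: "kept_vertices {k} ?T = {u}" by (auto simp: kept_vertices_def sub lca)
  have lv1: "leaves {[] :: vertex} = {[]}" by (auto simp: leaves_def)
  have od: "outdeg {[] :: vertex} [] = 0" "outdeg (verts t) u = 0"
    using u by (simp_all add: outdeg_def leaves_def)
  have pl: "plane_tree {[]}" by (simp add: plane_tree_def)
  have nc: "\<not> is_child {v} x y" for v x y by (auto simp: is_child_def)
  show ?thesis unfolding induces_def leaf_labelled_def
    using u nc od by (auto simp: pl lv1 kept lca bij_betw_def intro!: exI[of _ "\<lambda>_. u"])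
qed

text \<open>
  The maximum is attained by some \<open>S\<close>, which is counted by \<open>X n (card S)\<close>; so a union bound and
  Markov's inequality apply.
\<close>

lemma prob_max_common_gt_le:
  assumes p1: "pmf p 1 = 0" and q: "leafprob p n > 0" and n: "n \<ge> 1"
  shows "measure_pmf.prob (two_copies p n) {TT. real (max_common n TT) > x}
    \<le> (\<Sum>a\<in>{a. a \<le> n \<and> real a > x}. measure_pmf.expectation (two_copies p n) (\<lambda>TT. real (X n a TT)))"
proof -
  let ?M = "two_copies p n" let ?A = "{a. a \<le> n \<and> real a > x}"
  let ?C = "{TT. real (max_common n TT) > x}"
  have "?C \<inter> set_pmf ?M \<subseteq> (\<Union>a\<in>?A. {TT. X n a TT \<ge> 1})"
  proof clarify
    fix T T' assume mx: "real (max_common n (T, T')) > x" and supp: "(T, T') \<in> set_pmf ?M"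
    have "T \<in> set_pmf (random_tree p n)" "T' \<in> set_pmf (random_tree p n)"
      using supp by (auto simp: two_copies_def)
    then obtain t l t' l' where T: "T = (verts t, l)" "T' = (verts t', l')"
      and l: "l \<in> labellings n (verts t)" "l' \<in> labellings n (verts t')"
      using set_random_tree[OF p1 q] by (cases T; cases T') blast
    let ?K = "{card S | S. S \<subseteq> {1..n} \<and> S \<noteq> {} \<and> same_induced S T T'}"
    have "same_induced {1} T T'" unfolding same_induced_def T
      using l n by (intro exI[of _ "({[]}, \<lambda>_. 1)"] conjI induces_singleton) (auto simp: labellings_def)
    then have ne: "?K \<noteq> {}" using n by (auto intro!: exI[of _ "{1}"])
    have "?K \<subseteq> card ` Pow {1..n}" by auto
    then have fin: "finite ?K" by (rule finite_subset) simp
    have "max_common n (T, T') \<in> ?K" using Max_in[OF fin ne] by (simp add: max_common_def)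
    then obtain S where S: "max_common n (T, T') = card S" "S \<subseteq> {1..n}" "same_induced S T T'"
      unfolding mem_Collect_eq by metis
    let ?F = "{S'. S' \<subseteq> {1..n} \<and> card S' = card S \<and> same_induced S' T T'}"
    have "?F \<subseteq> Pow {1..n}" by blast
    then have "finite ?F" by (rule finite_subset) simp
    moreover have "S \<in> ?F" using S(2,3) by blast
    ultimately have "card ?F > 0" unfolding card_gt_0_iff by blast
    then have "card ?F \<ge> 1" by simp
    then have "X n (card S) (T, T') \<ge> 1" by (simp add: X_def)
    moreover have "card S \<le> n" using card_mono[OF _ S(2)] by simp
    ultimately show "(T, T') \<in> (\<Union>a\<in>?A. {TT. X n a TT \<ge> 1})" using mx S(1) by auto
  qed
  then have "measure_pmf.prob ?M (?C \<inter> set_pmf ?M) \<le> measure_pmf.prob ?M (\<Union>a\<in>?A. {TT. X n a TT \<ge> 1})"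
    by (intro measure_pmf.finite_measure_mono) auto
  also have "\<dots> \<le> (\<Sum>a\<in>?A. measure_pmf.prob ?M {TT. X n a TT \<ge> 1})"
  proof (rule measure_UNION_le)
    show "finite ?A" by (rule finite_subset[of _ "{..n}"]) auto
  qed simp
  also have "\<dots> \<le> (\<Sum>a\<in>?A. measure_pmf.expectation ?M (\<lambda>TT. real (X n a TT)))"
  proof (intro sum_mono)
    fix a
    have bnd: "X n a TT \<le> 2 ^ n" for TT
    proof -
      obtain T T' where TT: "TT = (T, T')" by (cases TT)
      have "card {S. S \<subseteq> {1..n} \<and> card S = a \<and> same_induced S T T'} \<le> card (Pow {1..n})"
        by (intro card_mono) auto
      then show ?thesis by (simp add: X_def TT card_Pow)
    qed
    have "measure_pmf.expectation ?M (indicator {TT. X n a TT \<ge> 1}) \<le> measure_pmf.expectation ?M (\<lambda>TT. real (X n a TT))"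
    proof (rule integral_mono)
      show "integrable ?M (indicator {TT. X n a TT \<ge> 1} :: _ \<Rightarrow> real)"
        by (rule measure_pmf.integrable_const_bound[where B = 1]) (auto simp: indicator_def)
      show "integrable ?M (\<lambda>TT. real (X n a TT))"
        by (rule measure_pmf.integrable_const_bound[where B = "2 ^ n"]) (auto simp: bnd)
    qed (auto simp: indicator_def)
    then show "measure_pmf.prob ?M {TT. X n a TT \<ge> 1} \<le> measure_pmf.expectation ?M (\<lambda>TT. real (X n a TT))"
      by simp
  qed
  finally show ?thesis by (simp only: measure_Int_set_pmf)
qed

section \<open>The generating function of the number of leaves\<close>

text \<open>
  The Bonferroni inequalities for \<open>(1 - s) ^ j\<close>.  Summed against \<open>p\<close> they give the Taylor polynomials
  of the offspring generating function at 1 with one-sided errors.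
\<close>

lemma one_minus_power_le:
  fixes s :: real assumes "0 \<le> s" "s \<le> 1"
  shows "(1 - s) ^ j \<le> 1 - real j * s + real j * (real j - 1) / 2 * s\<^sup>2"
proof (induction j)
  case (Suc j)
  have "(1 - s) ^ Suc j \<le> (1 - s) * (1 - real j * s + real j * (real j - 1) / 2 * s\<^sup>2)"
    using mult_left_mono[OF Suc, of "1 - s"] assms by simp
  also have "\<dots> = 1 - real (Suc j) * s + real (Suc j) * (real (Suc j) - 1) / 2 * s\<^sup>2
      - real j * (real j - 1) / 2 * s ^ 3"
    by (simp add: field_simps power2_eq_square power3_eq_cube)
  also have "\<dots> \<le> 1 - real (Suc j) * s + real (Suc j) * (real (Suc j) - 1) / 2 * s\<^sup>2"
    using assms by (cases j) auto
  finally show ?case .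
qed simp

lemma one_minus_power_ge:
  fixes s :: real assumes "0 \<le> s" "s \<le> 1"
  shows "(1 - s) ^ j \<ge> 1 - real j * s + real j * (real j - 1) / 2 * s\<^sup>2
    - real j * (real j - 1) * (real j - 2) / 6 * s ^ 3"
proof (induction j)
  case (Suc j)
  have nn: "0 \<le> real j * (real j - 1) * (real j - 2)"
  proof (cases "j \<le> 1")
    case True then show ?thesis by (cases j) auto
  next
    case False then show ?thesis by (intro mult_nonneg_nonneg) auto
  qed
  have "1 - real (Suc j) * s + real (Suc j) * (real (Suc j) - 1) / 2 * s\<^sup>2
      - real (Suc j) * (real (Suc j) - 1) * (real (Suc j) - 2) / 6 * s ^ 3
    \<le> 1 - real (Suc j) * s + real (Suc j) * (real (Suc j) - 1) / 2 * s\<^sup>2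
      - real (Suc j) * (real (Suc j) - 1) * (real (Suc j) - 2) / 6 * s ^ 3
      + real j * (real j - 1) * (real j - 2) / 6 * s ^ 4"
    using nn assms by simp
  also have "\<dots> = (1 - s) * (1 - real j * s + real j * (real j - 1) / 2 * s\<^sup>2
    - real j * (real j - 1) * (real j - 2) / 6 * s ^ 3)"
    by (simp add: field_simps power2_eq_square power3_eq_cube power4_eq_xxxx)
  also have "\<dots> \<le> (1 - s) ^ Suc j"
    using mult_left_mono[OF Suc, of "1 - s"] assms by simp
  finally show ?case .
qed simp

lemma pmf_nat_sums_1: "(\<lambda>j. pmf p j) sums (1 :: real)" for p :: "nat pmf"
proof -
  have "(\<lambda>j. measure_pmf.prob p {j}) sums measure_pmf.prob p (\<Union>j. {j})"
    by (rule measure_pmf.finite_measure_UNION) (auto simp: disjoint_family_on_def)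
  then show ?thesis by (simp add: measure_pmf_single)
qed

locale critical_offspring =
  fixes p :: "nat pmf"
  assumes mean: "(\<lambda>j. real j * pmf p j) sums 1"
    and radius: "conv_radius (\<lambda>j. pmf p j) > 1"
    and p0: "pmf p 0 > 0"
    and p1: "pmf p 1 = 0"
begin

abbreviation q :: "nat \<Rightarrow> real" where "q \<equiv> leafprob p"

text \<open>
  The convergence radius exceeds 1, so the probabilities decay exponentially.
\<close>

lemma summable_third_moment: "summable (\<lambda>j. real j ^ 3 * pmf p j)"
proof -
  obtain r where r: "1 < r" "ereal r < conv_radius (\<lambda>j. pmf p j)"
    using radius ereal_dense2[of 1 "conv_radius (\<lambda>j. pmf p j)"] by (metis one_ereal_def less_ereal.simps(1))
  have sr: "summable (\<lambda>j. pmf p j * r ^ j)"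
    using r by (intro summable_in_conv_radius) auto
  have "eventually (\<lambda>j. real j ^ 3 \<le> r ^ j) sequentially" using r(1) by real_asymp
  then have "eventually (\<lambda>j. norm (real j ^ 3 * pmf p j) \<le> pmf p j * r ^ j) sequentially"
  proof eventually_elim
    case (elim j)
    then show ?case using mult_left_mono[OF elim pmf_nonneg[of p j]] by (simp add: mult.commute)
  qed
  then show ?thesis using sr by (rule summable_comparison_test_ev)
qed

lemma summable_moment:
  assumes "\<And>j. \<bar>g j\<bar> \<le> real j ^ 3"
  shows "summable (\<lambda>j. g j * pmf p j)"
proof (rule summable_comparison_test[OF _ summable_third_moment], intro exI allI impI)
  fix j
  show "norm (g j * pmf p j) \<le> real j ^ 3 * pmf p j"
    using assms[of j] by (simp add: abs_mult mult_right_mono)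
qed

text \<open>
  The second and third factorial moments; \<open>mu2\<close> is the variance \<open>\<sigma>\<^sup>2\<close>.
\<close>

definition mu2 :: real where "mu2 = (\<Sum>j. real j * (real j - 1) * pmf p j)"
definition mu3 :: real where "mu3 = (\<Sum>j. real j * (real j - 1) * (real j - 2) * pmf p j)"

lemma falling_factorial_bounds:
  "\<bar>real j * (real j - 1)\<bar> \<le> real j ^ 3" "\<bar>real j * (real j - 1) * (real j - 2)\<bar> \<le> real j ^ 3"
  "0 \<le> real j * (real j - 1)" "0 \<le> real j * (real j - 1) * (real j - 2)"
proof -
  consider "j = 0" | "j = 1" | "j \<ge> 2" by linarith
  then have "\<bar>real j * (real j - 1)\<bar> \<le> real j ^ 3 \<and> \<bar>real j * (real j - 1) * (real j - 2)\<bar> \<le> real j ^ 3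
    \<and> 0 \<le> real j * (real j - 1) \<and> 0 \<le> real j * (real j - 1) * (real j - 2)"
  proof cases
    case 3
    have a: "0 \<le> real j * (real j - 1)" "0 \<le> real j * (real j - 1) * (real j - 2)"
      using 3 by (auto intro!: mult_nonneg_nonneg)
    have "real j * (real j - 1) * 1 \<le> real j * real j * real j"
      using 3 by (intro mult_mono) auto
    moreover have "real j * (real j - 1) * (real j - 2) \<le> real j * real j * real j"
      using 3 by (intro mult_mono) auto
    ultimately show ?thesis using a by (simp add: power3_eq_cube)
  qed auto
  then show "\<bar>real j * (real j - 1)\<bar> \<le> real j ^ 3" "\<bar>real j * (real j - 1) * (real j - 2)\<bar> \<le> real j ^ 3"
  "0 \<le> real j * (real j - 1)" "0 \<le> real j * (real j - 1) * (real j - 2)" by blast+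
qed

lemma mu2_sums: "(\<lambda>j. real j * (real j - 1) * pmf p j) sums mu2"
  unfolding mu2_def by (rule summable_sums, rule summable_moment, rule falling_factorial_bounds)

lemma mu3_sums: "(\<lambda>j. real j * (real j - 1) * (real j - 2) * pmf p j) sums mu3"
  unfolding mu3_def by (rule summable_sums, rule summable_moment, rule falling_factorial_bounds)

lemma mu3_nonneg: "mu3 \<ge> 0"
  using mu3_sums by (rule sums_le[OF _ sums_zero, rotated]) (simp add: falling_factorial_bounds)

text \<open>
  Otherwise the mean would be \<open>p\<^sub>1 = 0\<close>.
\<close>

lemma ex_branching: "\<exists>d\<ge>2. pmf p d > 0"
proof (rule ccontr)
  assume "\<not> ?thesis"
  then have "pmf p j = 0" if "j \<ge> 2" for j using that pmf_nonneg[of p j] by (metis not_less order.antisym)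
  then have "real j * pmf p j = 0" for j using p1 by (cases "j \<ge> 2") (auto simp: not_le less_2_cases_iff)
  then have "(\<lambda>j. real j * pmf p j) = (\<lambda>_. 0)" by (rule ext)
  then have "(\<lambda>j. real j * pmf p j) sums 0" by (simp only: sums_zero)
  then have "(1 :: real) = 0" by (rule sums_unique2[OF mean])
  then show False by simp
qed

lemma mu2_pos: "mu2 > 0"
proof -
  obtain d where d: "d \<ge> 2" "pmf p d > 0" using ex_branching by blast
  have "(\<Sum>j\<in>{d}. real j * (real j - 1) * pmf p j) \<le> mu2"
    unfolding mu2_def using mu2_sums
    by (intro sum_le_suminf) (auto simp: falling_factorial_bounds sums_iff)
  moreover have "real d * (real d - 1) * pmf p d > 0" using d by auto
  ultimately show ?thesis by simp
qed

definition pgf :: "real \<Rightarrow> real" where "pgf u = (\<Sum>j. pmf p j * u ^ j)"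
definition dpgf :: "real \<Rightarrow> real" where "dpgf u = (\<Sum>j. pmf p j * (real j * u ^ (j - 1)))"

lemma pgf_sums: "0 \<le> u \<Longrightarrow> u \<le> 1 \<Longrightarrow> (\<lambda>j. pmf p j * u ^ j) sums pgf u"
  unfolding pgf_def
  by (rule summable_sums, rule summable_comparison_test'[OF sums_summable[OF pmf_nat_sums_1[of p]], of 0])
     (auto simp: power_le_one mult_left_le)

lemma dpgf_sums: "0 \<le> u \<Longrightarrow> u \<le> 1 \<Longrightarrow> (\<lambda>j. pmf p j * (real j * u ^ (j - 1))) sums dpgf u"
  unfolding dpgf_def
  by (rule summable_sums, rule summable_comparison_test'[OF sums_summable[OF mean], of 0])
     (auto simp: power_le_one mult_left_le mult.commute[of "pmf p _"] mult_right_mono)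

lemma pgf_taylor_le:
  assumes "0 \<le> s" "s \<le> 1"
  shows "pgf (1 - s) \<le> 1 - s + mu2 / 2 * s\<^sup>2"
proof (rule sums_le)
  show "(\<lambda>j. pmf p j * (1 - s) ^ j) sums pgf (1 - s)" using assms by (intro pgf_sums) auto
  show "(\<lambda>j. pmf p j - s * (real j * pmf p j) + s\<^sup>2 / 2 * (real j * (real j - 1) * pmf p j))
    sums (1 - s + mu2 / 2 * s\<^sup>2)"
    using sums_add[OF sums_diff[OF pmf_nat_sums_1[of p] sums_mult[OF mean, of s]] sums_mult[OF mu2_sums, of "s\<^sup>2 / 2"]]
    by (simp add: mult_ac)
  show "pmf p j * (1 - s) ^ j \<le> pmf p j - s * (real j * pmf p j) + s\<^sup>2 / 2 * (real j * (real j - 1) * pmf p j)" for j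
    using mult_left_mono[OF one_minus_power_le[OF assms, of j], of "pmf p j"] by (simp add: field_simps)
qed

lemma pgf_taylor_ge:
  assumes "0 \<le> s" "s \<le> 1"
  shows "pgf (1 - s) \<ge> 1 - s + mu2 / 2 * s\<^sup>2 - mu3 / 6 * s ^ 3"
proof (rule sums_le)
  show "(\<lambda>j. pmf p j * (1 - s) ^ j) sums pgf (1 - s)" using assms by (intro pgf_sums) auto
  show "(\<lambda>j. pmf p j - s * (real j * pmf p j) + s\<^sup>2 / 2 * (real j * (real j - 1) * pmf p j)
      - s ^ 3 / 6 * (real j * (real j - 1) * (real j - 2) * pmf p j))
    sums (1 - s + mu2 / 2 * s\<^sup>2 - mu3 / 6 * s ^ 3)"
    using sums_diff[OF sums_add[OF sums_diff[OF pmf_nat_sums_1[of p] sums_mult[OF mean, of s]] 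
        sums_mult[OF mu2_sums, of "s\<^sup>2 / 2"]] sums_mult[OF mu3_sums, of "s ^ 3 / 6"]]
    by (simp add: mult_ac)
  show "pmf p j - s * (real j * pmf p j) + s\<^sup>2 / 2 * (real j * (real j - 1) * pmf p j)
      - s ^ 3 / 6 * (real j * (real j - 1) * (real j - 2) * pmf p j) \<le> pmf p j * (1 - s) ^ j" for j
    using mult_left_mono[OF one_minus_power_ge[OF assms, of j], of "pmf p j"] by (simp add: field_simps)
qed

lemma dpgf_taylor_le:
  assumes "0 \<le> s" "s \<le> 1"
  shows "dpgf (1 - s) \<le> 1 - mu2 * s + mu3 / 2 * s\<^sup>2"
proof (rule sums_le)
  show "(\<lambda>j. pmf p j * (real j * (1 - s) ^ (j - 1))) sums dpgf (1 - s)" using assms by (intro dpgf_sums) auto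
  show "(\<lambda>j. real j * pmf p j - s * (real j * (real j - 1) * pmf p j)
      + s\<^sup>2 / 2 * (real j * (real j - 1) * (real j - 2) * pmf p j))
    sums (1 - mu2 * s + mu3 / 2 * s\<^sup>2)"
    using sums_add[OF sums_diff[OF mean sums_mult[OF mu2_sums, of s]] sums_mult[OF mu3_sums, of "s\<^sup>2 / 2"]]
    by (simp add: mult_ac)
  show "pmf p j * (real j * (1 - s) ^ (j - 1)) \<le> real j * pmf p j - s * (real j * (real j - 1) * pmf p j)
      + s\<^sup>2 / 2 * (real j * (real j - 1) * (real j - 2) * pmf p j)" for j
  proof (cases j)
    case (Suc i)
    show ?thesis
      using mult_left_mono[OF one_minus_power_le[OF assms, of i], of "pmf p j * real j"] Suc
      by (simp add: field_simps)
  qed simp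
qed

text \<open>
  Every term has \<open>j \<ge> 2\<close>, because \<open>p\<^sub>1 = 0\<close>, and the mean is 1.
\<close>

lemma dpgf_le_self: assumes "0 \<le> u" "u \<le> 1" shows "dpgf u \<le> u"
proof (rule sums_le)
  show "(\<lambda>j. pmf p j * (real j * u ^ (j - 1))) sums dpgf u" using assms by (rule dpgf_sums)
  show "(\<lambda>j. u * (real j * pmf p j)) sums u" using sums_mult[OF mean, of u] by simp
  show "pmf p j * (real j * u ^ (j - 1)) \<le> u * (real j * pmf p j)" for j
  proof -
    consider "j = 0" | "j = 1" | i where "j = Suc (Suc i)" by (metis One_nat_def not0_implies_Suc)
    then show ?thesis
    proof cases
      case 3
      have "u * u ^ i \<le> u * 1" using assms by (intro mult_left_mono) (auto simp: power_le_one)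
      then have "(pmf p j * real j) * (u * u ^ i) \<le> (pmf p j * real j) * u"
        by (intro mult_left_mono) auto
      then show ?thesis using 3 by (simp add: mult_ac)
    qed (use p1 in auto)
  qed
qed

lemma pgf_diff_le:
  assumes "0 \<le> v" "v \<le> u" "u \<le> 1"
  shows "pgf u - pgf v \<le> dpgf u * (u - v)"
proof (rule sums_le)
  show "(\<lambda>j. pmf p j * u ^ j - pmf p j * v ^ j) sums (pgf u - pgf v)"
    using assms by (intro sums_diff pgf_sums) auto
  show "(\<lambda>j. pmf p j * (real j * u ^ (j - 1)) * (u - v)) sums (dpgf u * (u - v))"
    using assms by (intro sums_mult2 dpgf_sums) auto
  have pw: "u ^ j - v ^ j \<le> real j * u ^ (j - 1) * (u - v)" for j
  proof (induction j)
    case (Suc j)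
    have "u ^ Suc j - v ^ Suc j = u * (u ^ j - v ^ j) + v ^ j * (u - v)" by (simp add: algebra_simps)
    also have "\<dots> \<le> u * (real j * u ^ (j - 1) * (u - v)) + u ^ j * (u - v)"
      using assms Suc by (intro add_mono mult_left_mono mult_right_mono power_mono) auto
    also have "\<dots> = real (Suc j) * u ^ (Suc j - 1) * (u - v)"
      by (cases j) (auto simp: algebra_simps)
    finally show ?case .
  qed simp
  show "pmf p j * u ^ j - pmf p j * v ^ j \<le> pmf p j * (real j * u ^ (j - 1)) * (u - v)" for j
    using mult_left_mono[OF pw[of j], of "pmf p j"] by (simp add: algebra_simps)
qed

text \<open>
  The generating function \<open>F(x)\<close> of \<open>leafprob\<close> satisfies \<open>F = p\<^sub>0 x + (pgf F - p\<^sub>0)\<close>.  Solved for \<open>x\<close>, this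
  is \<open>x = xi (F x)\<close>.  Using \<open>u = F(x)\<close> as the free parameter makes everything explicit; the singularity
  \<open>x = 1\<close> corresponds to \<open>u = 1\<close>, and \<open>1 - x\<close> is of order \<open>(1 - u)\<^sup>2\<close> there.
\<close>

definition xi :: "real \<Rightarrow> real" where "xi u = (u - pgf u + pmf p 0) / pmf p 0"

lemma pgf_le_quadratic: assumes "0 \<le> u" "u \<le> 1" shows "pgf u \<le> pmf p 0 + (1 - pmf p 0) * u\<^sup>2"
proof (rule sums_le)
  show "(\<lambda>j. pmf p j * u ^ j) sums pgf u" using assms by (rule pgf_sums)
  have "(\<lambda>j. (pmf p j - (if j = 0 then pmf p 0 else 0)) * u\<^sup>2 + (if j = 0 then pmf p 0 else 0)) sums
      ((1 - pmf p 0) * u\<^sup>2 + pmf p 0)"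
    by (intro sums_add sums_mult2 sums_diff pmf_nat_sums_1 sums_single[of 0 "\<lambda>_. pmf p 0"])
  then show "(\<lambda>j. (pmf p j - (if j = 0 then pmf p 0 else 0)) * u\<^sup>2 + (if j = 0 then pmf p 0 else 0)) sums
      (pmf p 0 + (1 - pmf p 0) * u\<^sup>2)" by (simp add: add.commute)
  show "pmf p j * u ^ j \<le> (pmf p j - (if j = 0 then pmf p 0 else 0)) * u\<^sup>2 + (if j = 0 then pmf p 0 else 0)" for j
  proof (cases "j \<ge> 2")
    case True
    then show ?thesis using power_decreasing[OF True assms] by (auto intro: mult_left_mono)
  next
    case False
    then show ?thesis using p1 by (auto simp: not_le less_2_cases_iff)
  qed
qed

lemma xi_pos: assumes "0 < u" "u \<le> 1" shows "xi u > 0"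
proof -
  have "pgf u - pmf p 0 \<le> (1 - pmf p 0) * u\<^sup>2" using pgf_le_quadratic[of u] assms by simp
  also have "\<dots> \<le> (1 - pmf p 0) * u"
    using assms pmf_le_1[of p 0] by (intro mult_left_mono) (auto simp: power2_eq_square mult_left_le)
  also have "\<dots> < u" using assms p0 by simp
  finally show ?thesis using p0 by (simp add: xi_def)
qed

lemma one_minus_xi: "1 - xi (1 - s) = (pgf (1 - s) - (1 - s)) / pmf p 0"
  using p0 by (simp add: xi_def field_simps)

lemma one_minus_xi_le:
  assumes "0 \<le> s" "s \<le> 1" shows "1 - xi (1 - s) \<le> mu2 / (2 * pmf p 0) * s\<^sup>2"
proof -
  have "(pgf (1 - s) - (1 - s)) / pmf p 0 \<le> (mu2 / 2 * s\<^sup>2) / pmf p 0"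
    using pgf_taylor_le[OF assms] p0 by (intro divide_right_mono) auto
  then show ?thesis unfolding one_minus_xi by simp
qed

lemma one_minus_xi_ge:
  assumes "0 \<le> s" "s \<le> 1"
  shows "1 - xi (1 - s) \<ge> mu2 / (2 * pmf p 0) * s\<^sup>2 - mu3 / (6 * pmf p 0) * s ^ 3"
proof -
  have "(mu2 / 2 * s\<^sup>2 - mu3 / 6 * s ^ 3) / pmf p 0 \<le> (pgf (1 - s) - (1 - s)) / pmf p 0"
    using pgf_taylor_ge[OF assms] p0 by (intro divide_right_mono) auto
  then show ?thesis unfolding one_minus_xi by (simp add: diff_divide_distrib)
qed

text \<open>
  The offspring weights when every leaf carries the variable \<open>x = xi u\<close>.  By the choice of \<open>x\<close>, the
  number \<open>u\<close> is a fixed point of their generating function.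
\<close>

definition tilted :: "real \<Rightarrow> nat \<Rightarrow> real" where "tilted u = (pmf p)(0 := pmf p 0 * xi u)"

lemma tilted_nonneg: "0 < u \<Longrightarrow> u \<le> 1 \<Longrightarrow> tilted u j \<ge> 0"
  using xi_pos[of u] by (simp add: tilted_def)

lemma weight_tilted: "weight (tilted u) t = weight (pmf p) t * xi u ^ num_leaves t"
  unfolding tilted_def by (rule weight_scale_leaf)

lemma tilted_sums:
  assumes v: "0 \<le> v" "v \<le> 1" shows "(\<lambda>j. tilted u j * v ^ j) sums (u + (pgf v - pgf u))"
proof -
  have "(\<lambda>j. pmf p j * v ^ j + (if j = 0 then pmf p 0 * (xi u - 1) else 0)) sums (pgf v + pmf p 0 * (xi u - 1))"
    using v by (intro sums_add pgf_sums sums_single[of 0 "\<lambda>_. pmf p 0 * (xi u - 1)"])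
  moreover have "(\<lambda>j. pmf p j * v ^ j + (if j = 0 then pmf p 0 * (xi u - 1) else 0)) = (\<lambda>j. tilted u j * v ^ j)"
    by (auto simp: tilted_def algebra_simps)
  moreover have "pgf v + pmf p 0 * (xi u - 1) = u + (pgf v - pgf u)"
    using p0 by (simp add: xi_def field_simps)
  ultimately show ?thesis by simp
qed

lemma tilted_sum_le:
  assumes "0 < u" "u \<le> 1" shows "(\<Sum>j\<le>m. tilted u j * u ^ j) \<le> u"
proof -
  have "(\<lambda>j. tilted u j * u ^ j) sums u" using tilted_sums[of u u] assms by simp
  then show ?thesis
    using assms by (auto simp: sums_iff intro!: sum_le_suminf[of _ "{..m}", THEN order_trans] mult_nonneg_nonneg tilted_nonneg)
qed

lemma tilted_deriv_sum_le:
  assumes "0 < u" "u \<le> 1" shows "(\<Sum>j\<le>m. tilted u j * (real j * u ^ (j - 1))) \<le> dpgf u"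
proof -
  have "(\<Sum>j\<le>m. tilted u j * (real j * u ^ (j - 1))) = (\<Sum>j\<le>m. pmf p j * (real j * u ^ (j - 1)))"
    by (intro sum.cong) (auto simp: tilted_def)
  also have "\<dots> \<le> dpgf u"
    using dpgf_sums[of u] assms by (auto simp: sums_iff intro!: sum_le_suminf[of _ "{..m}", THEN order_trans])
  finally show ?thesis .
qed

lemma embedding_weight_le:
  assumes u: "0 < u" "u < 1"
  shows "embedding_weight p n W * xi u ^ n \<le> weight (pmf p) W * xi u ^ num_leaves W * (1 / (1 - dpgf u)) ^ num_verts W"
proof -
  have x: "xi u > 0" using u by (intro xi_pos) auto
  have d: "dpgf u < 1" using dpgf_le_self[of u] u by auto
  have "embedding_weight p n W * xi u ^ n = (\<Sum>t\<in>trees n. weight (tilted u) t * real (card (embeddings (verts W) (verts t))))"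
    unfolding embedding_weight_def sum_distrib_right by (intro sum.cong) (auto simp: weight_tilted trees_def)
  also have "\<dots> \<le> (\<Sum>t\<in>trunc n. weight (tilted u) t * real (card (embeddings (verts W) (verts t))))"
    using u trees_subset_trunc by (intro sum_mono2) (auto intro!: mult_nonneg_nonneg weight_nonneg tilted_nonneg)
  also have "\<dots> \<le> weight (tilted u) W * (1 / (1 - dpgf u)) ^ num_verts W"
    using u d by (intro sum_weight_embeddings_le[where u = u] tilted_nonneg tilted_sum_le tilted_deriv_sum_le) auto
  finally show ?thesis by (simp add: weight_tilted)
qed

lemma sum_trees_vs_trunc:
  assumes "\<And>j. f j \<ge> 0" "f 1 = 0" 
  shows "(\<Sum>m\<le>N. \<Sum>t\<in>trees m. weight f t) \<le> (\<Sum>t\<in>trunc N. weight f t)"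
    and "\<exists>N. (\<Sum>t\<in>trunc h. weight f t) \<le> (\<Sum>m\<le>N. \<Sum>t\<in>trees m. weight f t)"
proof -
  have U: "(\<Sum>m\<le>N. \<Sum>t\<in>trees m. weight f t) = (\<Sum>t\<in>(\<Union>m\<le>N. trees m). weight f t)" for N
  proof (rule sum.UNION_disjoint[symmetric])
    show "\<forall>i\<in>{..N}. \<forall>j\<in>{..N}. i \<noteq> j \<longrightarrow> trees i \<inter> trees j = {}" by (auto simp: trees_def)
  qed auto
  show "(\<Sum>m\<le>N. \<Sum>t\<in>trees m. weight f t) \<le> (\<Sum>t\<in>trunc N. weight f t)"
    unfolding U using trees_subset_trunc trunc_mono
    by (intro sum_mono2) (auto intro!: weight_nonneg assms, blast)
  define N where "N = Max (insert 0 (num_leaves ` trunc h))"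
  have "(\<Sum>t\<in>trunc h. weight f t) = (\<Sum>t\<in>{t\<in>trunc h. nounary t}. weight f t)"
    using weight_unary_0[of f, OF assms(2)] by (intro sum.mono_neutral_right) auto
  also have "\<dots> \<le> (\<Sum>t\<in>(\<Union>m\<le>N. trees m). weight f t)"
  proof (rule sum_mono2)
    show "finite (\<Union>m\<le>N. trees m)" by (intro finite_UN_I finite_atMost finite_trees)
    show "{t \<in> trunc h. nounary t} \<subseteq> (\<Union>m\<le>N. trees m)"
      by (auto intro!: Max_ge simp: trees_def N_def)
  qed (auto intro: weight_nonneg assms)
  finally show "\<exists>N. (\<Sum>t\<in>trunc h. weight f t) \<le> (\<Sum>m\<le>N. \<Sum>t\<in>trees m. weight f t)"
    unfolding U by blast
qed

text \<open>
  The sums increase to some \<open>v \<le> u\<close>, and \<open>v\<close> satisfies \<open>\<Phi>(v) \<le> v\<close> where \<open>\<Phi>(u) = u\<close>.  The slope of \<open>\<Phi>\<close> on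
  \<open>[v, u]\<close> is at most \<open>dpgf u < 1\<close>, which leaves only \<open>v = u\<close>.
\<close>

lemma trunc_sum_tendsto:
  assumes u: "0 < u" "u < 1"
  shows "(\<lambda>h. \<Sum>t\<in>trunc h. weight (tilted u) t) \<longlonglongrightarrow> u"
proof -
  define F where "F h = (\<Sum>t\<in>trunc h. weight (tilted u) t)" for h
  have f0: "tilted u j \<ge> 0" for j using u by (intro tilted_nonneg) auto
  have w0: "weight (tilted u) t \<ge> 0" for t by (rule weight_nonneg[OF f0])
  have F0: "F h \<ge> 0" for h unfolding F_def by (intro sum_nonneg w0)
  have Fu: "F h \<le> u" for h unfolding F_def using u by (intro sum_weight_trunc_le f0 tilted_sum_le) auto
  have inc: "incseq F" unfolding F_def
    by (intro incseq_SucI sum_mono2 trunc_mono_Suc finite_trunc w0)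
  obtain v where v: "F \<longlonglongrightarrow> v" "\<And>h. F h \<le> v"
    using incseq_convergent[OF inc] Fu by blast
  have v01: "0 \<le> v" "v \<le> u" using F0 Fu v by (auto intro: LIMSEQ_le_const LIMSEQ_le_const2)
  have le: "(\<Sum>j<J. tilted u j * v ^ j) \<le> v" for J
  proof (rule LIMSEQ_le)
    show "(\<lambda>h. \<Sum>j<J. tilted u j * F h ^ j) \<longlonglongrightarrow> (\<Sum>j<J. tilted u j * v ^ j)"
      by (intro tendsto_intros v)
    show "(\<lambda>h. F (Suc h)) \<longlonglongrightarrow> v" using v(1) by (rule LIMSEQ_Suc)
    have "(\<Sum>j<J. tilted u j * F h ^ j) \<le> F (Suc h)" if "h \<ge> J" for h
      unfolding F_def sum_weight_trunc_Suc
      using that f0 F0 by (intro sum_mono2) (auto simp: F_def[symmetric])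
    then show "\<exists>N. \<forall>n\<ge>N. (\<Sum>j<J. tilted u j * F n ^ j) \<le> F (Suc n)" by blast
  qed
  have "u + (pgf v - pgf u) \<le> v"
    using tilted_sums[of v u] v01 u le unfolding sums_def by (intro LIMSEQ_le_const2) auto
  moreover have "pgf u - pgf v \<le> dpgf u * (u - v)" using v01 u by (intro pgf_diff_le) auto
  ultimately have "(1 - dpgf u) * (u - v) \<le> 0" by (simp add: algebra_simps)
  moreover have "dpgf u < 1" using dpgf_le_self[of u] u by auto
  ultimately have "u = v" using v01 by (simp add: mult_le_0_iff)
  then show ?thesis using v(1) unfolding F_def by simp
qed

lemma leafprob_scaled: "q m * xi u ^ m = (\<Sum>t\<in>trees m. weight (tilted u) t)"
  unfolding leafprob_def sum_distrib_right by (intro sum.cong) (auto simp: weight_tilted trees_def)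

text \<open>
  Each \<open>trunc N\<close> contains all relevant trees with at most \<open>N\<close> leaves, and each \<open>trunc h\<close> involves only
  finitely many numbers of leaves; so both ways of exhausting the trees have the same limit.
\<close>

lemma leafprob_pgf_sums:
  assumes u: "0 < u" "u < 1"
  shows "(\<lambda>m. q m * xi u ^ m) sums u"
proof -
  have f: "tilted u j \<ge> 0" "tilted u 1 = 0" for j using u p1 by (auto simp: tilted_nonneg) (simp add: tilted_def)
  define G where "G N = (\<Sum>m\<le>N. q m * xi u ^ m)" for N
  have t0: "q m * xi u ^ m \<ge> 0" for m using leafprob_nonneg xi_pos[of u] u by simp
  have up: "G N \<le> u" for N
    unfolding G_def leafprob_scaled using sum_trees_vs_trunc(1)[of "tilted u" N, OF f]
      sum_weight_trunc_le[OF f(1) _ tilted_sum_le, of N] u by force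
  have "incseq G" unfolding G_def by (intro incseq_SucI) (simp add: t0 del: power_Suc)
  then obtain w where w: "G \<longlonglongrightarrow> w" "\<And>N. G N \<le> w" using incseq_convergent[of G u] up by blast
  have "w \<le> u" using w(1) up by (auto intro: LIMSEQ_le_const2)
  moreover have "u \<le> w"
  proof (rule LIMSEQ_le_const2[OF trunc_sum_tendsto[OF u]], intro exI allI impI)
    fix h
    obtain N where "(\<Sum>t\<in>trunc h. weight (tilted u) t) \<le> G N"
      using sum_trees_vs_trunc(2)[of "tilted u" h, OF f] unfolding G_def leafprob_scaled by blast
    then show "(\<Sum>t\<in>trunc h. weight (tilted u) t) \<le> w" using w(2)[of N] by linarith
  qed
  ultimately have "w = u" by simp
  then show ?thesis using w(1) unfolding G_def sums_def' by (simp add: atMost_atLeast0)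
qed

lemma sum_leafprob_le_1: "(\<Sum>m\<le>N. q m) \<le> 1"
proof -
  have "(\<Sum>m\<le>N. q m) \<le> (\<Sum>t\<in>trunc N. weight (pmf p) t)"
    using sum_trees_vs_trunc(1)[of "pmf p" N] p1 by (simp add: leafprob_def)
  also have "\<dots> \<le> 1"
  proof (rule sum_weight_trunc_le)
    show "(\<Sum>j\<le>m. pmf p j * 1 ^ j) \<le> 1" for m
      using pmf_nat_sums_1[of p] by (auto simp: sums_iff intro!: sum_le_suminf[of _ "{..m}", THEN order_trans])
  qed auto
  finally show ?thesis .
qed

end

context critical_offspring begin

section \<open>Lower bounds for the probability of having a given number of leaves\<close>

lemma leafprob_1: "q 1 \<ge> pmf p 0"
proof -
  have "Node [] \<in> trees 1" by (simp add: trees_def)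
  then have "(\<Sum>t\<in>{Node []}. weight (pmf p) t) \<le> q 1"
    unfolding leafprob_def by (intro sum_mono2) (auto intro: weight_nonneg)
  then show ?thesis by simp
qed

text \<open>
  Two trees and \<open>d - 2\<close> single leaves become the subtrees of a new root; the map is injective.
\<close>

lemma leafprob_join:
  assumes d: "d \<ge> 2"
  shows "pmf p d * pmf p 0 ^ (d - 2) * q m * q k \<le> q (m + k + (d - 2))"
proof -
  let ?J = "\<lambda>(s, t). Node (s # t # replicate (d - 2) (Node []))"
  have len: "Suc (Suc (d - 2)) = d" using d by simp
  have w: "weight (pmf p) (?J st) = pmf p d * pmf p 0 ^ (d - 2) * (weight (pmf p) (fst st) * weight (pmf p) (snd st))" for st
  proof -
    obtain s t where st: "st = (s, t)" by (cases st)
    show ?thesis using len by (simp add: st prod_list_replicate mult_ac)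
  qed
  have sub: "?J ` (trees m \<times> trees k) \<subseteq> trees (m + k + (d - 2))"
    by (auto simp: trees_def sum_list_replicate)
  have "pmf p d * pmf p 0 ^ (d - 2) * q m * q k
      = (\<Sum>st\<in>trees m \<times> trees k. pmf p d * pmf p 0 ^ (d - 2) * (weight (pmf p) (fst st) * weight (pmf p) (snd st)))"
  proof -
    have "q m * q k = (\<Sum>st\<in>trees m \<times> trees k. weight (pmf p) (fst st) * weight (pmf p) (snd st))"
      by (simp add: leafprob_def sum_product sum.cartesian_product case_prod_beta)
    then show ?thesis by (simp only: sum_distrib_left[symmetric] mult.assoc)
  qed
  also have "\<dots> = (\<Sum>st\<in>trees m \<times> trees k. weight (pmf p) (?J st))"
    by (intro sum.cong refl w[symmetric])
  also have "\<dots> = (\<Sum>t\<in>?J ` (trees m \<times> trees k). weight (pmf p) t)"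
    by (subst sum.reindex) (auto simp: inj_on_def o_def)
  also have "\<dots> \<le> q (m + k + (d - 2))"
    unfolding leafprob_def using sub by (intro sum_mono2) (auto intro: weight_nonneg)
  finally show ?thesis .
qed

lemma leafprob_pos_extend:
  assumes "q n > 0" "d \<ge> 2" "pmf p d > 0"
  shows "q (n + (d - 1)) > 0"
proof -
  have "0 < pmf p d * pmf p 0 ^ (d - 2) * q n * q 1" using assms p0 leafprob_1 by auto
  also have "\<dots> \<le> q (n + 1 + (d - 2))" by (rule leafprob_join[OF assms(2)])
  also have "n + 1 + (d - 2) = n + (d - 1)" using assms by simp
  finally show ?thesis .
qed

lemma leafprob_pos_binary:
  assumes "pmf p 2 > 0" "n \<ge> 1" shows "q n > 0"
  using assms(2)
proof (induction n rule: dec_induct)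
  case base then show ?case using leafprob_1 p0 by simp
next
  case (step n) then show ?case using leafprob_pos_extend[of n 2] assms(1) by simp
qed

end

text \<open>
  The least positive difference \<open>g\<close> of two elements divides all elements: otherwise, for \<open>b\<close> and
  \<open>b + g\<close> in \<open>A\<close> and \<open>a\<close> not divisible by \<open>g\<close>, the elements \<open>k * (b + g)\<close> and \<open>k * b + a\<close> with
  \<open>k = a div g\<close> would differ by the smaller number \<open>a mod g\<close>.  So \<open>g = 1\<close>, and then every \<open>n \<ge> b\<^sup>2\<close> is a
  sum of copies of \<open>b\<close> and \<open>b + 1\<close>.
\<close>

lemma eventually_in_additive_set:
  fixes A :: "nat set"
  assumes zero: "0 \<in> A" and add: "\<And>a b. a \<in> A \<Longrightarrow> b \<in> A \<Longrightarrow> a + b \<in> A"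
    and gcd: "Gcd A = 1"
  shows "eventually (\<lambda>n. n \<in> A) sequentially"
proof -
  define D where "D = {n. n > 0 \<and> (\<exists>b\<in>A. b + n \<in> A)}"
  have mult: "k * a \<in> A" if "a \<in> A" for a k
    by (induction k) (use that zero add in auto)
  have "\<exists>a\<in>A. a \<noteq> 0"
  proof (rule ccontr)
    assume "\<not> ?thesis"
    then have "A = {0}" using zero by blast
    then show False using gcd by simp
  qed
  then have "\<exists>n. n \<in> D" unfolding D_def using zero by (metis (mono_tags, lifting) add_0 mem_Collect_eq neq0_conv)
  define g where "g = (LEAST n. n \<in> D)"
  have gD: "g \<in> D" using \<open>\<exists>n. n \<in> D\<close> unfolding g_def by (rule LeastI_ex)
  have gmin: "g \<le> n" if "n \<in> D" for n using that unfolding g_def by (rule Least_le)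
  obtain b where b: "b \<in> A" "b + g \<in> A" "g > 0" using gD by (auto simp: D_def)
  have "g dvd a" if a: "a \<in> A" for a
  proof (rule ccontr)
    assume nd: "\<not> g dvd a"
    define k where "k = a div g"
    have ar: "a = g * k + a mod g" by (simp add: k_def)
    have "a mod g > 0" using nd by (simp add: dvd_eq_mod_eq_0)
    moreover have "k * (b + g) + a mod g \<in> A"
    proof -
      have "k * (b + g) + a mod g = k * b + a" using ar by (simp add: algebra_simps)
      then show ?thesis using add[OF mult[OF b(1)] a] by simp
    qed
    ultimately have "a mod g \<in> D" using mult[OF b(2), of k] by (auto simp: D_def)
    then show False using gmin[of "a mod g"] b(3) by (metis mod_less_divisor not_le)
  qed
  then have "g dvd Gcd A" by (rule Gcd_greatest)
  then have g1: "g = 1" using gcd by simp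
  show ?thesis unfolding eventually_sequentially
  proof (intro exI[of _ "b * b"] allI impI)
    fix n assume n: "b * b \<le> n"
    show "n \<in> A"
    proof (cases "b = 0")
      case True
      then have "1 \<in> A" using b g1 by simp
      then show ?thesis using mult[of 1 n] by simp
    next
      case False
      let ?r = "n mod b" and ?k = "n div b"
      have "?r < b" using False by simp
      moreover have "b \<le> ?k" using n False by (simp add: less_eq_div_iff_mult_less_eq)
      ultimately have rk: "?r \<le> ?k" by simp
      have "n = (?k - ?r) * b + ?r * (b + g)"
      proof -
        have "(?k - ?r) * b + ?r * (b + g) = (?k - ?r + ?r) * b + ?r" unfolding g1 by (simp only: algebra_simps)
        then show ?thesis using rk by simp
      qed
      then show ?thesis using add[OF mult[OF b(1)] mult[OF b(2)]] by metis
    qed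
  qed
qed

context critical_offspring begin

text \<open>
  Putting a tree and \<open>j\<close> single leaves under a new root of degree \<open>j + 1\<close> adds \<open>j\<close> leaves.  The set of numbers that may always be added is closed under addition and contains all
  these \<open>j\<close>.
\<close>

lemma leafprob_eventually_pos:
  assumes gcd: "Gcd {j :: nat. j \<ge> 1 \<and> pmf p (j + 1) > 0} = 1"
  shows "eventually (\<lambda>n. q n > 0) sequentially"
proof -
  \<comment> \<open>Indices are shifted by 1, so that \<open>0\<close> stands for trees with one leaf.\<close>
  define A where "A = {n. \<forall>m. q (m + 1) > 0 \<longrightarrow> q (m + n + 1) > 0}"
  have "eventually (\<lambda>n. n \<in> A) sequentially"
  proof (rule eventually_in_additive_set)
    show "0 \<in> A" by (simp add: A_def)
    show "a + b \<in> A" if "a \<in> A" "b \<in> A" for a b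
    proof -
      have "q (m + (a + b) + 1) > 0" if "q (m + 1) > 0" for m
        using \<open>a \<in> A\<close> \<open>b \<in> A\<close> that unfolding A_def mem_Collect_eq by (metis add.assoc)
      then show ?thesis by (simp add: A_def)
    qed
    have "{j. j \<ge> 1 \<and> pmf p (j + 1) > 0} \<subseteq> A"
    proof clarify
      fix j assume j: "1 \<le> j" "0 < pmf p (j + 1)"
      have "q (m + j + 1) > 0" if "q (m + 1) > 0" for m
        using leafprob_pos_extend[OF that, of "j + 1"] j by (simp add: add.commute add.left_commute)
      then show "j \<in> A" by (simp add: A_def)
    qed
    then have "Gcd A dvd Gcd {j. j \<ge> 1 \<and> pmf p (j + 1) > 0}"
      by (intro Gcd_greatest Gcd_dvd) blast
    then show "Gcd A = 1" unfolding gcd by simp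
  qed
  then obtain N where N: "\<And>n. n \<ge> N \<Longrightarrow> n \<in> A" by (auto simp: eventually_sequentially)
  have "q n > 0" if "n \<ge> N + 1" for n
  proof -
    have "n - 1 \<in> A" using that by (intro N) simp
    then show ?thesis using leafprob_1 p0 that by (auto simp: A_def dest: spec[of _ 0])
  qed
  then show ?thesis by (auto simp: eventually_sequentially)
qed

definition tail :: "nat \<Rightarrow> real" where "tail N = 1 - (\<Sum>m\<le>N. q m)"

lemma tail_nonneg: "tail N \<ge> 0"
  using sum_leafprob_le_1[of N] by (simp add: tail_def)

lemma xi_le_1: assumes "0 < u" "u < 1" shows "xi u \<le> 1"
proof -
  have "pgf 1 = 1" unfolding pgf_def using pmf_nat_sums_1[of p] by (simp add: sums_iff)
  moreover have "dpgf 1 \<le> 1" using dpgf_le_self[of 1] by simp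
  moreover have "pgf 1 - pgf u \<le> dpgf 1 * (1 - u)" using pgf_diff_le[of u 1] assms by simp
  moreover have "dpgf 1 * (1 - u) \<le> 1 * (1 - u)"
    using \<open>dpgf 1 \<le> 1\<close> assms by (intro mult_right_mono) auto
  ultimately have "1 - pgf u \<le> 1 - u" by simp
  then show ?thesis using p0 by (simp add: xi_def)
qed

lemma partial_sum_le:
  assumes u: "0 < u" "u < 1" shows "(\<Sum>m\<le>N. q m * xi u ^ m) \<le> u"
  using leafprob_pgf_sums[OF u] xi_pos[of u] u
  by (auto simp: sums_iff leafprob_nonneg intro!: sum_le_suminf[of _ "{..N}", THEN order_trans] mult_nonneg_nonneg)

text \<open>
  The next lemmas extract information on \<open>leafprob\<close> from \<open>F(xi u) = u\<close> in the manner of an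
  elementary Tauberian argument.  Here the terms beyond \<open>L\<close> are bounded by \<open>xi u ^ L\<close> times their total
  mass.
\<close>

lemma le_partial_sum_plus_tail:
  assumes u: "0 < u" "u < 1"
  shows "u \<le> (\<Sum>m\<le>L. q m * xi u ^ m) + xi u ^ L * tail L"
proof -
  have x: "0 < xi u" "xi u \<le> 1" using xi_pos[of u] xi_le_1[of u] u by auto
  have "(\<Sum>m<N. q m * xi u ^ m) \<le> (\<Sum>m\<le>L. q m * xi u ^ m) + xi u ^ L * tail L" if N: "N > L" for N
  proof -
    have dec: "{..<N} = {..L} \<union> {L<..<N}" "{..L} \<inter> {L<..<N} = {}" using N by auto
    have "(\<Sum>m<N. q m * xi u ^ m) = (\<Sum>m\<le>L. q m * xi u ^ m) + (\<Sum>m\<in>{L<..<N}. q m * xi u ^ m)"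
      unfolding dec(1) using dec(2) by (intro sum.union_disjoint) auto
    also have "\<dots> \<le> (\<Sum>m\<le>L. q m * xi u ^ m) + (\<Sum>m\<in>{L<..<N}. q m * xi u ^ L)"
      using x leafprob_nonneg[of p]
      by (intro add_mono sum_mono order_refl) (auto intro!: mult_left_mono power_decreasing)
    also have "(\<Sum>m\<in>{L<..<N}. q m * xi u ^ L) = xi u ^ L * (\<Sum>m\<in>{L<..<N}. q m)"
      by (simp add: sum_distrib_left mult.commute)
    also have "(\<Sum>m\<in>{L<..<N}. q m) \<le> tail L"
    proof -
      have "(\<Sum>m\<in>{L<..<N}. q m) + (\<Sum>m\<le>L. q m) = (\<Sum>m<N. q m)"
        unfolding dec(1) using dec(2) by (subst sum.union_disjoint) auto
      also have "\<dots> \<le> (\<Sum>m\<le>N. q m)" by (intro sum_mono2) (auto simp: leafprob_nonneg)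
      also have "\<dots> \<le> 1" by (rule sum_leafprob_le_1)
      finally show ?thesis by (simp add: tail_def)
    qed
    finally show ?thesis using x by (simp add: mult_left_mono)
  qed
  then show ?thesis
    using leafprob_pgf_sums[OF u] unfolding sums_def
    by (intro LIMSEQ_le_const2) (auto intro!: exI[of _ "Suc L"])
qed

lemma tail_upper:
  assumes u: "0 < u" "u < 1"
  shows "(1 - xi u ^ L) * tail L \<le> 1 - u"
proof -
  have x: "0 < xi u" "xi u \<le> 1" using xi_pos[of u] xi_le_1[of u] u by auto
  have "(\<Sum>m\<le>L. q m * xi u ^ m) \<le> (\<Sum>m\<le>L. q m)"
    using x leafprob_nonneg[of p] by (intro sum_mono) (auto intro!: mult_left_le power_le_one)
  then show ?thesis using le_partial_sum_plus_tail[OF u, of L] by (simp add: tail_def algebra_simps)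
qed

text \<open>
  \<open>1 - x ^ m \<le> m * (1 - x)\<close> for \<open>m \<le> M\<close>; beyond \<open>M\<close> only the total mass is used.
\<close>

lemma tail_lower:
  assumes u: "0 < u" "u < 1"
  shows "1 - u \<le> tail M + (1 - xi u) * (\<Sum>m\<le>M. real m * q m)"
proof -
  have x: "0 < xi u" "xi u \<le> 1" using xi_pos[of u] xi_le_1[of u] u by auto
  have "1 - real m * (1 - xi u) \<le> xi u ^ m" for m
    using Bernoulli_inequality[of "xi u - 1" m] x by (simp add: algebra_simps)
  then have "(\<Sum>m\<le>M. q m * (1 - real m * (1 - xi u))) \<le> (\<Sum>m\<le>M. q m * xi u ^ m)"
    by (intro sum_mono mult_left_mono leafprob_nonneg)
  also have "\<dots> \<le> u" by (rule partial_sum_le[OF u])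
  also have "(\<Sum>m\<le>M. q m * (1 - real m * (1 - xi u))) = (\<Sum>m\<le>M. q m) - (1 - xi u) * (\<Sum>m\<le>M. real m * q m)"
    by (simp add: sum_distrib_left right_diff_distrib sum_subtractf mult_ac)
  finally show ?thesis by (simp add: tail_def)
qed

text \<open>
  The assumption keeps \<open>x ^ m\<close> above \<open>1 / 2\<close> for \<open>m \<le> M\<close>, so that \<open>1 - x ^ m\<close> is at least
  \<open>m * (1 - x) / 2\<close>.
\<close>

lemma truncated_mean_upper:
  assumes u: "0 < u" "u < 1" and M: "real M * (1 - xi u) \<le> 1 / 2"
  shows "(1 - xi u) * (\<Sum>m\<le>M. real m * q m) \<le> 2 * (1 - u)"
proof -
  have x: "0 < xi u" "xi u \<le> 1" using xi_pos[of u] xi_le_1[of u] u by auto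
  have xM: "xi u ^ M \<ge> 1 / 2"
    using Bernoulli_inequality[of "xi u - 1" M] x M by (simp add: algebra_simps)
  have one: "(1 - xi u) * (real m / 2) \<le> 1 - xi u ^ m" if "m \<le> M" for m
  proof -
    have "real m / 2 = (\<Sum>i<m. 1 / 2)" by simp
    also have "\<dots> \<le> (\<Sum>i<m. xi u ^ i)"
      using xM x that by (intro sum_mono order_trans[OF xM] power_decreasing) auto
    finally have "(1 - xi u) * (real m / 2) \<le> (1 - xi u) * (\<Sum>i<m. xi u ^ i)"
      using x by (intro mult_left_mono) auto
    then show ?thesis by (simp add: one_diff_power_eq)
  qed
  have "u \<le> (\<Sum>m\<le>M. q m * xi u ^ m) + xi u ^ M * tail M" by (rule le_partial_sum_plus_tail[OF u])
  also have "xi u ^ M * tail M \<le> tail M"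
    using x tail_nonneg[of M] by (intro mult_left_le_one_le) (auto intro: power_le_one)
  finally have "u \<le> (\<Sum>m\<le>M. q m * xi u ^ m) + tail M" by simp
  then have le: "(\<Sum>m\<le>M. q m * (1 - xi u ^ m)) \<le> 1 - u"
    by (simp add: tail_def right_diff_distrib sum_subtractf)
  have "(1 - xi u) * (\<Sum>m\<le>M. real m * q m) / 2 = (\<Sum>m\<le>M. q m * ((1 - xi u) * (real m / 2)))"
    by (simp add: sum_distrib_left sum_divide_distrib mult_ac)
  also have "\<dots> \<le> (\<Sum>m\<le>M. q m * (1 - xi u ^ m))"
    using one leafprob_nonneg[of p] by (intro sum_mono mult_left_mono) auto
  also note le
  finally show ?thesis by simp
qed

lemma xi_two_sided:
  "\<exists>k1>0. \<exists>k2>0. \<exists>s1>0. s1 < 1 \<and> (\<forall>s. 0 < s \<and> s \<le> s1 \<longrightarrow> k1 * s\<^sup>2 \<le> 1 - xi (1 - s) \<and> 1 - xi (1 - s) \<le> k2 * s\<^sup>2)"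
proof -
  define k2 where "k2 = mu2 / (2 * pmf p 0)"
  have k2: "k2 > 0" using mu2_pos p0 by (simp add: k2_def)
  define k3 where "k3 = mu3 / (6 * pmf p 0)"
  have k3: "k3 \<ge> 0" using mu3_nonneg p0 by (simp add: k3_def)
  define s1 where "s1 = min (1 / 2) (k2 / (2 * (k3 + 1)))"
  have s1: "s1 > 0" "s1 < 1" "s1 \<le> k2 / (2 * (k3 + 1))" using k2 k3 by (auto simp: s1_def)
  have "k2 / 2 * s\<^sup>2 \<le> 1 - xi (1 - s) \<and> 1 - xi (1 - s) \<le> k2 * s\<^sup>2" if s: "0 < s" "s \<le> s1" for s
  proof
    have s01: "0 \<le> s" "s \<le> 1" using s s1 by auto
    have "k3 * s \<le> (k3 + 1) * s1" using s k3 by (intro mult_mono) auto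
    also have "\<dots> \<le> k2 / 2" using s1(3) k3 by (simp add: field_simps)
    finally have "k3 * s * s\<^sup>2 \<le> k2 / 2 * s\<^sup>2" by (intro mult_right_mono) auto
    then have "k2 / 2 * s\<^sup>2 \<le> k2 * s\<^sup>2 - k3 * s ^ 3" by (simp add: power2_eq_square power3_eq_cube algebra_simps)
    also have "\<dots> \<le> 1 - xi (1 - s)" using one_minus_xi_ge[OF s01] by (simp add: k2_def k3_def)
    finally show "k2 / 2 * s\<^sup>2 \<le> 1 - xi (1 - s)" .
    show "1 - xi (1 - s) \<le> k2 * s\<^sup>2" using one_minus_xi_le[OF s01] by (simp add: k2_def)
  qed
  then show ?thesis using k2 s1 by (intro exI[of _ "k2 / 2"] conjI exI[of _ k2] exI[of _ s1]) auto
qed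

text \<open>
  Taking \<open>1 - u\<close> of order \<open>M ^ (-1/2)\<close> in the three preceding bounds shows that \<open>tail M\<close> lies between two
  multiples of \<open>M ^ (-1/2)\<close>.  For a large constant \<open>K\<close> the upper bound at \<open>K * M\<close> is below the lower bound
  at \<open>M\<close>; so the window between \<open>M\<close> and \<open>K * M\<close> has mass of order \<open>M ^ (-1/2)\<close>, and one of its fewer
  than \<open>K * M\<close> elements has at least the average mass.
\<close>

lemma leafprob_window:
  "\<exists>K\<ge>1. \<exists>b>0. \<exists>M0. \<forall>M\<ge>M0. \<exists>m. M < m \<and> m \<le> K * M \<and> q m \<ge> b / (real M)\<^sup>2"
proof -
  obtain k1 k2 s1 where k: "k1 > 0" "k2 > 0" and s1: "0 < s1" "s1 < 1"
    and xl: "\<And>s. 0 < s \<Longrightarrow> s \<le> s1 \<Longrightarrow> k1 * s\<^sup>2 \<le> 1 - xi (1 - s)"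
    and xu: "\<And>s. 0 < s \<Longrightarrow> s \<le> s1 \<Longrightarrow> 1 - xi (1 - s) \<le> k2 * s\<^sup>2"
    using xi_two_sided by blast
  \<comment> \<open>\<open>A\<close>, \<open>r\<close> and \<open>\<beta>\<close> are the constants in front of \<open>M ^ (-1/2)\<close>: for the upper bound of the tail, for
    the value of \<open>1 - u\<close> in the truncated mean, and for the value of \<open>1 - u\<close> in the lower bound.  \<open>\<beta>\<close> is
    so small that the truncated mean takes away only half of \<open>1 - u\<close>.\<close>
  define A where "A = 2 / sqrt k1"
  define r where "r = 1 / sqrt (2 * k2)"
  define \<beta> where "\<beta> = k1 * r / (4 * k2)"
  have pos: "A > 0" "r > 0" "\<beta> > 0" using k by (auto simp: A_def r_def \<beta>_def)
  have small: "eventually (\<lambda>M. c / sqrt (real M) \<le> s1) sequentially" for c :: real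
  proof -
    have "((\<lambda>M. c / sqrt (real M)) \<longlongrightarrow> 0) sequentially" by real_asymp
    then have "eventually (\<lambda>M. c / sqrt (real M) < s1) sequentially" using s1(1) by (rule order_tendstoD(2))
    then show ?thesis by eventually_elim simp
  qed
  have up: "eventually (\<lambda>L. tail L \<le> A / sqrt (real L)) sequentially"
    using small[of "1 / sqrt k1"] eventually_gt_at_top[of 0]
  proof eventually_elim
    case (elim L)
    define s where "s = 1 / sqrt k1 / sqrt (real L)"
    have s: "0 < s" "s \<le> s1" using elim k by (auto simp: s_def)
    have u: "0 < 1 - s" "1 - s < 1" using s s1 by auto
    have s2: "s\<^sup>2 = 1 / (k1 * real L)" using k by (simp add: s_def power_divide power_mult_distrib)
    define y where "y = 1 - xi (1 - s)"
    have y: "real L * y \<ge> 1" "y \<ge> 0" "y \<le> 1"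
    proof -
      have "k1 * s\<^sup>2 \<le> y" using xl[OF s] by (simp add: y_def)
      then have "1 / real L \<le> y" using k s2 by simp
      then show "real L * y \<ge> 1" using elim by (simp add: field_simps)
      show "y \<ge> 0" "y \<le> 1" using xi_pos[of "1 - s"] xi_le_1[of "1 - s"] u by (auto simp: y_def)
    qed
    have "(1 - y) ^ L \<le> (1 / (1 + y)) ^ L"
      using y by (intro power_mono) (auto simp: field_simps)
    also have "\<dots> = 1 / (1 + y) ^ L" by (simp add: power_divide)
    also have "\<dots> \<le> 1 / 2"
    proof -
      have "1 + real L * y \<le> (1 + y) ^ L" using y by (intro Bernoulli_inequality) auto
      then have "2 \<le> (1 + y) ^ L" using y by linarith
      then show ?thesis by (intro divide_left_mono) auto
    qed
    finally have "xi (1 - s) ^ L \<le> 1 / 2" by (simp add: y_def)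
    then have "1 / 2 * tail L \<le> (1 - xi (1 - s) ^ L) * tail L"
      by (intro mult_right_mono tail_nonneg) auto
    also have "\<dots> \<le> s" using tail_upper[OF u, of L] by simp
    finally show ?case by (simp add: s_def A_def)
  qed
  have low: "eventually (\<lambda>M. tail M \<ge> \<beta> / 2 / sqrt (real M)) sequentially"
    using small[of r] small[of \<beta>] eventually_gt_at_top[of 0]
  proof eventually_elim
    case (elim M)
    define s where "s = r / sqrt (real M)"
    define z where "z = \<beta> / sqrt (real M)"
    have s: "0 < s" "s \<le> s1" and z: "0 < z" "z \<le> s1" using elim pos by (auto simp: s_def z_def)
    have us: "0 < 1 - s" "1 - s < 1" and uz: "0 < 1 - z" "1 - z < 1" using s z s1 by auto
    have "real M * (k2 * s\<^sup>2) = 1 / 2"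
      using elim k by (simp add: s_def r_def power_divide power_mult_distrib)
    moreover have "real M * (1 - xi (1 - s)) \<le> real M * (k2 * s\<^sup>2)"
      using xu[OF s] by (intro mult_left_mono) auto
    ultimately have "real M * (1 - xi (1 - s)) \<le> 1 / 2" by simp
    from truncated_mean_upper[OF us this]
    have a: "(1 - xi (1 - s)) * (\<Sum>m\<le>M. real m * q m) \<le> 2 * s" by simp
    define R where "R = (\<Sum>m\<le>M. real m * q m)"
    have R0: "R \<ge> 0" by (auto simp: R_def leafprob_nonneg intro!: sum_nonneg)
    have "(k1 * s\<^sup>2) * R \<le> (1 - xi (1 - s)) * R" using xl[OF s] R0 by (intro mult_right_mono) auto
    also have "\<dots> \<le> 2 * s" using a by (simp add: R_def)
    finally have R: "k1 * s * R \<le> 2" using s by (simp add: power2_eq_square)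
    have "z \<le> tail M + (1 - xi (1 - z)) * R" using tail_lower[OF uz, of M] by (simp add: R_def)
    also have "\<dots> \<le> tail M + (k2 * z\<^sup>2) * R"
      using xu[OF z] R0 by (intro add_left_mono mult_right_mono) auto
    also have "(k2 * z\<^sup>2) * R = z / 4 * (k1 * s * R)"
    proof -
      have "k2 * z = k1 * s / 4" using k by (simp add: z_def \<beta>_def s_def field_simps)
      then show ?thesis by (simp add: power2_eq_square)
    qed
    also have "\<dots> \<le> z / 4 * 2" using R z by (intro mult_left_mono) auto
    finally have "z / 2 \<le> tail M" by simp
    then show ?case by (simp add: z_def)
  qed
  obtain K :: nat where K: "K \<ge> 1" "A / sqrt (real K) \<le> \<beta> / 4"
  proof -
    have "((\<lambda>K. A / sqrt (real K)) \<longlongrightarrow> 0) sequentially" by real_asymp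
    then have "eventually (\<lambda>K. A / sqrt (real K) < \<beta> / 4) sequentially"
      by (rule order_tendstoD(2)) (use pos in simp)
    then have "eventually (\<lambda>K. K \<ge> 1 \<and> A / sqrt (real K) \<le> \<beta> / 4) sequentially"
      using eventually_ge_at_top[of 1] by eventually_elim auto
    then show ?thesis using that by (auto dest: eventually_happens)
  qed
  obtain N1 where N1: "\<And>L. L \<ge> N1 \<Longrightarrow> tail L \<le> A / sqrt (real L)"
    using up by (auto simp: eventually_sequentially)
  obtain N2 where N2: "\<And>M. M \<ge> N2 \<Longrightarrow> tail M \<ge> \<beta> / 2 / sqrt (real M)"
    using low by (auto simp: eventually_sequentially)
  define b where "b = \<beta> / (4 * real K)"
  have "\<exists>m. M < m \<and> m \<le> K * M \<and> q m \<ge> b / (real M)\<^sup>2" if M: "M \<ge> max 1 (max N1 N2)" for M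
  proof (rule ccontr)
    assume neg: "\<not> ?thesis"
    have M1: "M \<ge> 1" "real M > 0" using M by auto
    have KM: "M \<le> K * M" using K by simp
    have "tail (K * M) \<le> A / sqrt (real K) / sqrt (real M)"
    proof -
      have "N1 \<le> M" using M by simp
      then have "N1 \<le> K * M" using KM by (rule order_trans)
      then show ?thesis using N1[of "K * M"] by (simp add: real_sqrt_mult)
    qed
    also have "\<dots> \<le> \<beta> / 4 / sqrt (real M)" using K by (intro divide_right_mono) auto
    finally have tKM: "tail (K * M) \<le> \<beta> / 4 / sqrt (real M)" .
    have "tail M - tail (K * M) \<ge> \<beta> / 4 / sqrt (real M)"
    proof -
      have "\<beta> / 2 / sqrt (real M) = 2 * (\<beta> / 4 / sqrt (real M))" by simp
      moreover have "\<beta> / 2 / sqrt (real M) \<le> tail M" using N2[of M] M by simp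
      ultimately show ?thesis using tKM by linarith
    qed
    moreover have "tail M - tail (K * M) = (\<Sum>m\<in>{M<..K * M}. q m)"
    proof -
      have "{..L} = {..M} \<union> {M<..L}" if "M \<le> L" for L using that by auto
      from this[OF KM] have "{..K * M} = {..M} \<union> {M<..K * M}" .
      then have "(\<Sum>m\<le>K * M. q m) = (\<Sum>m\<le>M. q m) + (\<Sum>m\<in>{M<..K * M}. q m)"
        by (simp only:) (rule sum.union_disjoint, auto)
      then show ?thesis by (simp add: tail_def)
    qed
    moreover have "(\<Sum>m\<in>{M<..K * M}. q m) < \<beta> / 4 / sqrt (real M)"
    proof -
      have "(\<Sum>m\<in>{M<..K * M}. q m) \<le> (\<Sum>m\<in>{M<..K * M}. b / (real M)\<^sup>2)"
        using neg by (intro sum_mono) (auto simp: not_le intro: less_imp_le)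
      also have "\<dots> = real (K * M - M) * (b / (real M)\<^sup>2)" by simp
      also have "\<dots> < real (K * M) * (b / (real M)\<^sup>2)"
        using M1 K pos by (intro mult_strict_right_mono) (auto simp: b_def)
      also have "\<dots> = \<beta> / 4 / real M" using K M1 by (simp add: b_def power2_eq_square)
      also have "\<dots> \<le> \<beta> / 4 / sqrt (real M)"
      proof (rule divide_left_mono)
        show "sqrt (real M) \<le> real M" using M1 by (intro real_le_lsqrt) (auto simp: power2_eq_square)
      qed (use M1 pos in auto)
      finally show ?thesis .
    qed
    ultimately show False by simp
  qed
  moreover have "b > 0" using pos K by (simp add: b_def)
  ultimately show ?thesis using K(1) by blast
qed

text \<open>
  For \<open>n\<close> large, the window lemma provides an \<open>m\<close> between a constant fraction of \<open>n\<close> and \<open>n / 4\<close> with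
  \<open>leafprob m\<close> at least of order \<open>1 / n\<^sup>2\<close>.  Joining costs a constant, hence \<open>leafprob n\<close> is at least of
  order \<open>leafprob k / n\<^sup>2\<close> with \<open>n / 2 \<le> k \<le> \<theta> n\<close> and \<open>\<theta> < 1\<close>.  In the induction the polynomial loss is paid
  for by the decrease of \<open>sqrt n\<close> to \<open>sqrt (\<theta> n)\<close>.  This is far below the true order
  \<open>n ^ (-3/2)\<close>, but the first moment estimate has a factor \<open>exp (const * sqrt n)\<close> to spare.
\<close>

lemma leafprob_subexponential:
  assumes gcd: "Gcd {j :: nat. j \<ge> 1 \<and> pmf p (j + 1) > 0} = 1" and \<delta>: "\<delta> > 0"
  shows "\<exists>c>0. eventually (\<lambda>n. q n \<ge> c * exp (- \<delta> * sqrt (real n))) sequentially"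
proof -
  obtain d where d: "d \<ge> 2" "pmf p d > 0" using ex_branching by blast
  define \<kappa> where "\<kappa> = pmf p d * pmf p 0 ^ (d - 2)"
  have \<kappa>: "\<kappa> > 0" using d p0 by (simp add: \<kappa>_def)
  obtain K b M0 where K: "K \<ge> 1" and b: "b > 0"
    and win: "\<And>M. M \<ge> M0 \<Longrightarrow> \<exists>m. M < m \<and> m \<le> K * M \<and> q m \<ge> b / (real M)\<^sup>2"
    using leafprob_window by blast
  define \<theta> where "\<theta> = 1 - 1 / (4 * real K)"
  have \<theta>: "0 < \<theta>" "\<theta> < 1" using K by (auto simp: \<theta>_def field_simps)
  define e where "e = \<delta> * (1 - sqrt \<theta>)"
  have e: "e > 0" using \<theta> \<delta> by (simp add: e_def)
  define B where "B = \<kappa> * b"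
  have B: "B > 0" using \<kappa> b by (simp add: B_def)
  have "eventually (\<lambda>n. exp (- e * sqrt (real n)) \<le> B / (real n)\<^sup>2) sequentially"
    using e B by real_asymp
  then obtain N3 where N3: "\<And>n. n \<ge> N3 \<Longrightarrow> exp (- e * sqrt (real n)) \<le> B / (real n)\<^sup>2"
    by (auto simp: eventually_sequentially)
  obtain N0 where N0: "\<And>n. n \<ge> N0 \<Longrightarrow> q n > 0"
    using leafprob_eventually_pos[OF gcd] by (auto simp: eventually_sequentially)
  define N where "N = Max {1, N0, N3, 4 * K * (M0 + 1), 4 * d}"
  have N: "N \<ge> 1" "N \<ge> N0" "N \<ge> N3" "N \<ge> 4 * K * (M0 + 1)" "N \<ge> 4 * d" by (auto simp: N_def)
  define c where "c = Min (q ` {N..2 * N})"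
  have c: "c > 0" unfolding c_def using N0 N by (subst Min_gr_iff) auto
  have "q n \<ge> c * exp (- \<delta> * sqrt (real n))" if "n \<ge> N" for n
    using that
  proof (induction n rule: less_induct)
    case (less n)
    show ?case
    proof (cases "n \<le> 2 * N")
      case True
      then have "c \<le> q n" unfolding c_def using less.prems by (intro Min_le) auto
      moreover have "c * exp (- \<delta> * sqrt (real n)) \<le> c * 1" using c \<delta> by (intro mult_left_mono) auto
      ultimately show ?thesis by linarith
    next
      case False
      \<comment> \<open>Then \<open>m \<le> n / 4\<close>, and at most another \<open>n / 4\<close> is lost to the \<open>d - 2\<close> extra leaves.\<close>
      define M where "M = n div (4 * K)"
      have M: "4 * K * M \<le> n" "n < 4 * K * (M + 1)"
        using K dividend_less_times_div[of "4 * K" n] times_div_less_eq_dividend[of "4 * K" n]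
        unfolding M_def by (auto simp only: distrib_left mult_1_right add.commute)
      have "4 * K * (M0 + 1) \<le> n" using N less.prems by linarith
      then have "M0 + 1 \<le> M" unfolding M_def using K by (simp add: less_eq_div_iff_mult_less_eq mult.commute)
      then have MM: "M0 \<le> M" "M \<ge> 1" by auto
      obtain m where m: "M < m" "m \<le> K * M" "q m \<ge> b / (real M)\<^sup>2" using win[OF MM(1)] by blast
      define k where "k = n - m - (d - 2)"
      have "4 * m \<le> n" using m(2) M(1) by linarith
      moreover have "4 * d \<le> n" using N less.prems by linarith
      ultimately have k: "m + k + (d - 2) = n" "n \<le> 2 * k" "k < n" "k + m \<le> n"
        using m(1) by (auto simp: k_def)
      have kN: "k \<ge> N" using k False by linarith
      have k\<theta>: "real k \<le> \<theta> * real n"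
      proof -
        have "real n \<le> 4 * real K * (real M + 1)" 
        proof -
          have "real n \<le> real (4 * K * (M + 1))" using M(2) by (simp only: of_nat_le_iff less_imp_le)
          then show ?thesis by (simp add: algebra_simps)
        qed
        also have "\<dots> \<le> 4 * real K * real m" using m(1) by (intro mult_left_mono) auto
        finally have "real n / (4 * real K) \<le> real m" using K by (simp add: field_simps)
        moreover have "real k + real m \<le> real n" using k(4) by linarith
        ultimately show ?thesis by (simp add: \<theta>_def algebra_simps)
      qed
      have "M \<le> n" using M_def div_le_dividend by blast
      then have bM: "b / (real n)\<^sup>2 \<le> q m"
        using m(3) MM b by (intro order_trans[OF _ m(3)] divide_left_mono power_mono) auto
      have "c * exp (- \<delta> * sqrt (real n)) = exp (- e * sqrt (real n)) * (c * exp (- \<delta> * sqrt (\<theta> * real n)))"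
        by (simp add: e_def real_sqrt_mult mult_exp_exp algebra_simps)
      also have "\<dots> \<le> B / (real n)\<^sup>2 * (c * exp (- \<delta> * sqrt (real k)))"
        using N3[of n] N less.prems B c \<delta> k\<theta> by (intro mult_mono) auto
      also have "\<dots> \<le> B / (real n)\<^sup>2 * q k"
        using less.IH[OF k(3) kN] B by (intro mult_left_mono) auto
      also have "\<dots> = \<kappa> * (b / (real n)\<^sup>2) * q k" by (simp add: B_def)
      also have "\<dots> \<le> \<kappa> * q m * q k"
        using bM \<kappa> by (intro mult_right_mono mult_left_mono leafprob_nonneg) auto
      also have "\<dots> \<le> q n" using leafprob_join[OF d(1), of m k] k(1) by (simp add: \<kappa>_def)
      finally show ?thesis .
    qed
  qed
  then show ?thesis using c by (auto simp: eventually_sequentially)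
qed

end

section \<open>The maximum in the constant\<close>

abbreviation sq_term :: "nat pmf \<Rightarrow> real \<Rightarrow> nat \<Rightarrow> real" where
  "sq_term p r \<equiv> \<lambda>j. (pmf p j)\<^sup>2 * r ^ j"

lemma summable_on_if_bounded:
  fixes f :: "'a \<Rightarrow> real"
  assumes "\<And>x. x \<in> A \<Longrightarrow> f x \<ge> 0" "\<And>F. finite F \<Longrightarrow> F \<subseteq> A \<Longrightarrow> sum f F \<le> b"
  shows "f summable_on A" "infsum f A \<le> b"
proof -
  show s: "f summable_on A"
    by (rule nonneg_bdd_above_summable_on) (use assms in \<open>auto intro!: bdd_aboveI\<close>)
  show "infsum f A \<le> b" using s assms(2) by (rule infsum_le_finite_sums)
qed

lemma sq_term_at_half:
  "sq_term p (1 / 2) summable_on {2..}" "infsum (sq_term p (1 / 2)) {2..} \<le> 1 / 4"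
proof -
  have "sum (sq_term p (1 / 2)) F \<le> 1 / 4" if "finite F" "F \<subseteq> {2..}" for F
  proof -
    have "sum (sq_term p (1 / 2)) F \<le> (\<Sum>j\<in>F. pmf p j * (1 / 4))"
    proof (intro sum_mono mult_mono)
      fix j assume "j \<in> F"
      then have "j \<ge> 2" using that by auto
      then show "(1 / 2 :: real) ^ j \<le> 1 / 4"
        using power_decreasing[of 2 j "1 / 2 :: real"] by (simp add: power2_eq_square)
      show "(pmf p j)\<^sup>2 \<le> pmf p j" by (simp add: power2_eq_square mult_left_le pmf_le_1)
    qed auto
    also have "\<dots> = measure_pmf.prob p F * (1 / 4)"
      using that by (simp add: measure_measure_pmf_finite sum_divide_distrib)
    also have "\<dots> \<le> 1 / 4" by simp
    finally show ?thesis .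
  qed
  then show "sq_term p (1 / 2) summable_on {2..}" "infsum (sq_term p (1 / 2)) {2..} \<le> 1 / 4"
    using summable_on_if_bounded[of "{2..}" "sq_term p (1 / 2)" "1 / 4"] by auto
qed

text \<open>
  A maximizing sequence is bounded, since the term for \<open>d\<close> dominates \<open>r\<close> for large \<open>r\<close>; pass to a
  convergent subsequence.  Each finite part of the series is continuous, so the series converges at
  the limit and cannot jump upwards there.  This covers all cases, in particular a maximum at the
  end of the interval of convergence.
\<close>

lemma max_term_attained:
  assumes d: "d \<ge> 2" "pmf p d > 0"
  shows "\<exists>r\<ge>0. sq_term p r summable_on {2..} \<and> max_term p = r - infsum (sq_term p r) {2..}"
    and "max_term p > 0"
    and "r \<ge> 0 \<Longrightarrow> sq_term p r summable_on {2..} \<Longrightarrow> r - infsum (sq_term p r) {2..} \<le> max_term p"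
proof -
  define Y where "Y = {y. \<exists>r\<ge>0. sq_term p r summable_on {2..} \<and> y = r - infsum (sq_term p r) {2..}}"
  have nn: "sq_term p r j \<ge> 0" if "r \<ge> 0" for r j using that by simp
  define R where "R = 1 / (pmf p d)\<^sup>2"
  have R1: "R \<ge> 1" using d pmf_le_1[of p d] by (simp add: R_def power_le_one)
  have neg: "r - infsum (sq_term p r) {2..} \<le> 0" if r: "r > R" and s: "sq_term p r summable_on {2..}" for r
  proof -
    have "(pmf p d)\<^sup>2 * r ^ d = sum (sq_term p r) {d}" by simp
    also have "\<dots> \<le> infsum (sq_term p r) {2..}"
      using s d r R1 by (intro finite_sum_le_infsum) (auto intro!: nn)
    finally have a: "(pmf p d)\<^sup>2 * r ^ d \<le> infsum (sq_term p r) {2..}" .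
    have "1 \<le> (pmf p d)\<^sup>2 * r" using r d by (simp add: R_def field_simps)
    then have "r * 1 \<le> r * ((pmf p d)\<^sup>2 * r)" using r R1 by (intro mult_left_mono) auto
    also have "\<dots> = (pmf p d)\<^sup>2 * r\<^sup>2" by (simp add: power2_eq_square)
    also have "\<dots> \<le> (pmf p d)\<^sup>2 * r ^ d"
      using r R1 d by (intro mult_left_mono power_increasing) auto
    finally show ?thesis using a by simp
  qed
  have S0: "infsum (sq_term p r) {2..} \<ge> 0" if "r \<ge> 0" for r using that by (intro infsum_nonneg) auto
  have "y \<le> R" if "y \<in> Y" for y
  proof -
    obtain r where r: "r \<ge> 0" "sq_term p r summable_on {2..}" "y = r - infsum (sq_term p r) {2..}"
      using \<open>y \<in> Y\<close> unfolding Y_def by blast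
    show ?thesis
    proof (cases "r > R")
      case True then show ?thesis using neg[OF True r(2)] r(3) R1 by linarith
    next
      case False then show ?thesis using S0[OF r(1)] r(3) by linarith
    qed
  qed
  then have bdd: "bdd_above Y" by (rule bdd_aboveI)
  have half: "1 / 2 - infsum (sq_term p (1 / 2)) {2..} \<in> Y"
    using sq_term_at_half(1) by (auto simp: Y_def intro!: exI[of _ "1 / 2"])
  define M where "M = Sup Y"
  have M4: "M \<ge> 1 / 4"
    using cSup_upper[OF half bdd] sq_term_at_half(2)[of p] unfolding M_def by linarith
  have "\<exists>y\<in>Y. M - 1 / 8 / real (Suc k) < y" for k
    using half bdd less_cSupD[of Y "M - 1 / 8 / real (Suc k)"] unfolding M_def by force
  then have "\<forall>k. \<exists>r. r \<ge> 0 \<and> sq_term p r summable_on {2..} \<and> M - 1 / 8 / real (Suc k) < r - infsum (sq_term p r) {2..}"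
    unfolding Y_def by blast
  then obtain r where r': "\<forall>k. r k \<ge> 0 \<and> sq_term p (r k) summable_on {2..} \<and>
      M - 1 / 8 / real (Suc k) < r k - infsum (sq_term p (r k)) {2..}"
    by (rule choice[THEN exE])
  have r: "\<And>k. r k \<ge> 0" "\<And>k. sq_term p (r k) summable_on {2..}"
    "\<And>k. M - 1 / 8 / real (Suc k) < r k - infsum (sq_term p (r k)) {2..}"
    using r' by blast+
  have "r k \<in> {0..R}" for k
  proof -
    have "1 / 8 / real (Suc k) \<le> 1 / 8" by (simp add: field_simps)
    then have "r k - infsum (sq_term p (r k)) {2..} > 0" using r(3)[of k] M4 by linarith
    then show ?thesis using neg[of "r k", OF _ r(2)] r(1)[of k] by force
  qed
  then obtain r0 \<sigma> where r0: "r0 \<in> {0..R}" and \<sigma>: "strict_mono \<sigma>" "(r \<circ> \<sigma>) \<longlonglongrightarrow> r0"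
    using compact_Icc[of 0 R] unfolding compact_def by metis
  have fin: "sum (sq_term p r0) F \<le> r0 - M" if F: "finite F" "F \<subseteq> {2..}" for F
  proof (rule LIMSEQ_le)
    show "(\<lambda>k. \<Sum>j\<in>F. (pmf p j)\<^sup>2 * (r \<circ> \<sigma>) k ^ j) \<longlonglongrightarrow> sum (sq_term p r0) F"
      by (intro tendsto_intros \<sigma>)
    have "(\<lambda>k. 1 / 8 / real (Suc k)) \<longlonglongrightarrow> 0" by real_asymp
    then have "(\<lambda>k. (r \<circ> \<sigma>) k - M + 1 / 8 / real (Suc k)) \<longlonglongrightarrow> r0 - M + 0"
      by (intro tendsto_intros \<sigma>)
    then show "(\<lambda>k. (r \<circ> \<sigma>) k - M + 1 / 8 / real (Suc k)) \<longlonglongrightarrow> r0 - M" by simp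
    have "(\<Sum>j\<in>F. (pmf p j)\<^sup>2 * (r \<circ> \<sigma>) k ^ j) \<le> (r \<circ> \<sigma>) k - M + 1 / 8 / real (Suc k)" for k
    proof -
      have "(\<Sum>j\<in>F. (pmf p j)\<^sup>2 * r (\<sigma> k) ^ j) \<le> infsum (sq_term p (r (\<sigma> k))) {2..}"
        using F r by (intro finite_sum_le_infsum) (auto intro!: nn)
      also have "\<dots> \<le> r (\<sigma> k) - M + 1 / 8 / real (Suc (\<sigma> k))" using r(3)[of "\<sigma> k"] by linarith
      also have "1 / 8 / real (Suc (\<sigma> k)) \<le> 1 / 8 / real (Suc k)"
        using seq_suble[OF \<sigma>(1), of k] by (intro divide_left_mono) auto
      finally show ?thesis by simp
    qed
    then show "\<exists>N. \<forall>k\<ge>N. (\<Sum>j\<in>F. (pmf p j)\<^sup>2 * (r \<circ> \<sigma>) k ^ j) \<le> (r \<circ> \<sigma>) k - M + 1 / 8 / real (Suc k)" by blast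
  qed
  have s0: "sq_term p r0 summable_on {2..}" "infsum (sq_term p r0) {2..} \<le> r0 - M"
    using summable_on_if_bounded[of "{2..}" "sq_term p r0" "r0 - M"] fin r0 by auto
  have inY: "r0 - infsum (sq_term p r0) {2..} \<in> Y" using s0(1) r0 by (auto simp: Y_def)
  have up: "y \<le> M" if "y \<in> Y" for y unfolding M_def using that bdd by (rule cSup_upper)
  have Mr: "M = r0 - infsum (sq_term p r0) {2..}" using s0(2) up[OF inY] by linarith
  have "max_term p = M" unfolding max_term_def
  proof (rule Greatest_equality)
    show "\<exists>r\<ge>0. sq_term p r summable_on {2..} \<and> M = r - infsum (sq_term p r) {2..}"
      using inY Mr by (simp add: Y_def)
    show "\<And>y. \<exists>r\<ge>0. sq_term p r summable_on {2..} \<and> y = r - infsum (sq_term p r) {2..} \<Longrightarrow> y \<le> M"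
      by (rule up) (simp add: Y_def)
  qed
  then show "\<exists>r\<ge>0. sq_term p r summable_on {2..} \<and> max_term p = r - infsum (sq_term p r) {2..}"
    "max_term p > 0"
    "r \<ge> 0 \<Longrightarrow> sq_term p r summable_on {2..} \<Longrightarrow> r - infsum (sq_term p r) {2..} \<le> max_term p" for r
    using inY Mr M4 up by (auto simp: Y_def)
qed

section \<open>Estimates of the expected number of common subtrees\<close>

lemma power_mult_fact_le: "k ^ a * fact k \<le> (fact (k + a) :: nat)"
proof (induction a)
  case (Suc a)
  have "k ^ Suc a * fact k = k * (k ^ a * fact k)" by simp
  also have "\<dots> \<le> (k + Suc a) * fact (k + a)" using Suc by (intro mult_mono) auto
  finally show ?case by simp
qed simp

context critical_offspring begin

lemma offspring_var_eq: "offspring_var p = mu2"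
proof -
  have "((\<lambda>j. real j * (real j - 1) * pmf p j) has_sum mu2) UNIV"
    by (rule sums_nonneg_imp_has_sum[OF mu2_sums]) (simp add: falling_factorial_bounds)
  moreover have "infsum (\<lambda>j. real j * (real j - 1) * pmf p j) {2..} = infsum (\<lambda>j. real j * (real j - 1) * pmf p j) UNIV"
    by (rule infsum_cong_neutral) (auto simp: not_le less_2_cases_iff)
  ultimately show ?thesis by (simp add: offspring_var_def infsumI)
qed

lemma max_term_pos: "max_term p > 0"
  using ex_branching max_term_attained(2) by blast

lemma chi_pos: "chi p > 0"
  using mu2_pos p0 by (simp add: chi_def offspring_var_eq)

lemma lam_pos: "lam p > 0"
  using chi_pos by (simp add: lam_def less_max_iff_disj)

lemma c_const_pos: "c_const p > 0"
  using lam_pos p0 max_term_pos by (simp add: c_const_def)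

lemma c_const_sq: "(c_const p)\<^sup>2 = (exp 1)\<^sup>2 * (pmf p 0)\<^sup>2 * (lam p)\<^sup>2 / max_term p"
proof -
  have "(max_term p powr (- 1 / 2))\<^sup>2 = 1 / max_term p"
    using max_term_pos by (simp add: powr_minus powr_half_sqrt field_simps)
  then show ?thesis by (simp add: c_const_def power_mult_distrib)
qed

lemma c_const_binary:
  assumes "pmf p 0 = 1 / 2" "pmf p 2 = 1 / 2"
  shows "c_const p = exp 1 / 2"
proof -
  have z: "pmf p j = 0" if "j \<noteq> 0" "j \<noteq> 2" for j
  proof -
    have "sum (pmf p) {0, 2, j} \<le> 1"
      using measure_pmf.prob_le_1[of p "{0, 2, j}"]
      by (simp only: measure_measure_pmf_finite finite.emptyI finite.insertI)
    moreover have "sum (pmf p) {0, 2, j} = pmf p 0 + (pmf p 2 + pmf p j)" using that by simp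
    ultimately show ?thesis using assms pmf_nonneg[of p j] by linarith
  qed
  have inf1: "infsum f {2..} = f 2" if "\<And>j. j \<noteq> 0 \<Longrightarrow> j \<noteq> 2 \<Longrightarrow> f j = 0" for f :: "nat \<Rightarrow> real"
  proof -
    have "infsum f {2..} = infsum f {2}" by (rule infsum_cong_neutral) (use that in auto)
    then show ?thesis by simp
  qed
  have var: "offspring_var p = 1" unfolding offspring_var_def by (subst inf1) (auto simp: z assms)
  have chi: "chi p = 1" by (simp add: chi_def var assms)
  have lam: "lam p = 1" by (simp add: lam_def chi)
  have sq: "infsum (sq_term p r) {2..} = r\<^sup>2 / 4" for r
    by (subst inf1) (auto simp: z assms power2_eq_square)
  have "sq_term p 2 summable_on {2..}"
  proof -
    have "sq_term p 2 summable_on {2..} \<longleftrightarrow> sq_term p 2 summable_on {2}"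
      by (rule summable_on_cong_neutral) (auto simp: z)
    then show ?thesis by simp
  qed
  then have "max_term p \<ge> 1" using max_term_attained(3)[of 2 p 2] assms by (simp add: sq)
  moreover obtain r where "max_term p = r - r\<^sup>2 / 4"
    using max_term_attained(1)[of 2 p] assms by (auto simp: sq)
  moreover have "r - r\<^sup>2 / 4 \<le> 1" using zero_le_power2[of "r / 2 - 1"] by (simp add: power2_eq_square algebra_simps)
  ultimately have "max_term p = 1" by linarith
  then show ?thesis by (simp add: c_const_def lam assms)
qed

text \<open>
  The squared weights, with the leaf weight \<open>p\<^sub>0\<^sup>2\<close> replaced by \<open>max_term p\<close>, have the maximizing \<open>r\<close> as a
  fixed point.  Maximizing over \<open>r\<close> gives the best exponential rate that this argument can yield.
\<close>

lemma sum_sq_weights_le: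
  "\<exists>r>0. \<forall>a. (\<Sum>W\<in>trees a. (weight (pmf p) W)\<^sup>2) \<le> r * ((pmf p 0)\<^sup>2 / max_term p) ^ a"
proof -
  obtain d where d: "d \<ge> 2" "pmf p d > 0" using ex_branching by blast
  obtain r where r: "r \<ge> 0" "sq_term p r summable_on {2..}" "max_term p = r - infsum (sq_term p r) {2..}"
    using max_term_attained(1)[OF d] by blast
  define M where "M = max_term p"
  have M: "M > 0" using max_term_pos by (simp add: M_def)
  have S0: "infsum (sq_term p r) {2..} \<ge> 0" using r(1) by (intro infsum_nonneg) auto
  have r0: "r > 0" using r(3) S0 M by (simp add: M_def)
  define y where "y = M / (pmf p 0)\<^sup>2"
  have y: "y > 0" using M p0 by (simp add: y_def)
  define f where "f = (\<lambda>j. (pmf p j)\<^sup>2)(0 := (pmf p 0)\<^sup>2 * y)"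
  have f0: "f j \<ge> 0" for j using y by (simp add: f_def)
  have fM: "f 0 = M" using p0 by (simp add: f_def y_def)
  have sub: "(\<Sum>j\<le>m. f j * r ^ j) \<le> r" for m
  proof -
    have "(\<Sum>j\<le>m. f j * r ^ j) \<le> (\<Sum>j\<in>{0, 1} \<union> {2..m}. f j * r ^ j)"
      using f0 r(1) by (intro sum_mono2) (auto simp: not_le less_2_cases_iff)
    also have "\<dots> = M + (\<Sum>j\<in>{2..m}. sq_term p r j)"
    proof -
      have "(\<Sum>j\<in>{2..m}. f j * r ^ j) = (\<Sum>j\<in>{2..m}. sq_term p r j)"
        by (intro sum.cong) (auto simp: f_def)
      moreover have "(\<Sum>j\<in>{0, 1 :: nat}. f j * r ^ j) = M" using p1 fM by (simp add: f_def)
      ultimately show ?thesis by (subst sum.union_disjoint) auto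
    qed
    also have "(\<Sum>j\<in>{2..m}. sq_term p r j) \<le> infsum (sq_term p r) {2..}"
      using r by (intro finite_sum_le_infsum) auto
    finally show ?thesis using r(3) by (simp add: M_def)
  qed
  have "(\<Sum>W\<in>trees a. (weight (pmf p) W)\<^sup>2) \<le> r * ((pmf p 0)\<^sup>2 / M) ^ a" for a
  proof -
    have "(\<Sum>W\<in>trees a. (weight (pmf p) W)\<^sup>2) * y ^ a = (\<Sum>W\<in>trees a. weight f W)"
    proof -
      have "weight f W = (weight (pmf p) W)\<^sup>2 * y ^ num_leaves W" for W
        using weight_scale_leaf[of "\<lambda>j. (pmf p j)\<^sup>2" y W] by (simp only: f_def weight_square)
      then show ?thesis unfolding sum_distrib_right by (intro sum.cong) (auto simp: trees_def)
    qed
    also have "\<dots> \<le> (\<Sum>W\<in>trunc a. weight f W)"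
      using trees_subset_trunc by (intro sum_mono2) (auto intro: weight_nonneg f0)
    also have "\<dots> \<le> r" using f0 r(1) sub by (rule sum_weight_trunc_le)
    finally have "(\<Sum>W\<in>trees a. (weight (pmf p) W)\<^sup>2) \<le> r / y ^ a" using y by (simp add: field_simps)
    also have "\<dots> = r * ((pmf p 0)\<^sup>2 / M) ^ a" by (simp add: y_def power_divide)
    finally show ?thesis .
  qed
  then show ?thesis using r0 by (auto simp: M_def)
qed

definition expected_X :: "nat \<Rightarrow> nat \<Rightarrow> real" where
  "expected_X n a = measure_pmf.expectation (two_copies p n) (\<lambda>TT. real (X n a TT))"

text \<open>
  The bounds for trees with a marked copy are applied as Chernoff bounds: the coefficient of
  \<open>x ^ n\<close> is at most \<open>x ^ (- n)\<close> times the value at \<open>x = xi u\<close>, with \<open>u\<close> still free.  A pattern with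
  \<open>a\<close> leaves has between \<open>a\<close> and \<open>2 * a\<close> vertices.
\<close>

lemma expected_X_le:
  assumes q: "q n > 0" and an: "1 \<le> a" "a \<le> n" and u: "0 < u" "u < 1"
    and H: "\<And>v. a \<le> v \<Longrightarrow> v \<le> 2 * a \<Longrightarrow> (1 / (1 - dpgf u)) ^ v \<le> H"
    and B: "(\<Sum>W\<in>trees a. (weight (pmf p) W)\<^sup>2) \<le> B"
  shows "expected_X n a \<le> fact (n - a) / fact n * B * (H / xi u ^ (n - a))\<^sup>2 / (q n)\<^sup>2"
proof -
  have x: "xi u > 0" using xi_pos u by simp
  have G: "1 / (1 - dpgf u) > 0" using dpgf_le_self[of u] u by simp
  have one: "(embedding_weight p n W)\<^sup>2 \<le> (weight (pmf p) W)\<^sup>2 * (H / xi u ^ (n - a))\<^sup>2" if W: "W \<in> trees a" for W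
  proof -
    have num_leaves: "num_leaves W = a" "nounary W" using W by (auto simp: trees_def)
    have "embedding_weight p n W * xi u ^ n \<le> weight (pmf p) W * xi u ^ a * (1 / (1 - dpgf u)) ^ num_verts W"
      using embedding_weight_le[OF u, of n W] num_leaves by simp
    also have "\<dots> \<le> weight (pmf p) W * xi u ^ a * H"
      using H[of "num_verts W"] num_leaves_le_num_verts[of W] num_verts_less_twice_num_leaves[OF num_leaves(2)] num_leaves x
      by (intro mult_left_mono mult_nonneg_nonneg weight_nonneg) auto
    also have "\<dots> = weight (pmf p) W * (H / xi u ^ (n - a)) * xi u ^ n"
    proof -
      have "xi u ^ n = xi u ^ a * xi u ^ (n - a)" using an by (simp flip: power_add)
      then show ?thesis using x by simp
    qed
    finally have "embedding_weight p n W \<le> weight (pmf p) W * (H / xi u ^ (n - a))"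
      by (rule mult_right_le_imp_le) (use x in simp)
    moreover have "embedding_weight p n W \<ge> 0" unfolding embedding_weight_def by (intro sum_nonneg mult_nonneg_nonneg weight_nonneg) auto
    ultimately have "(embedding_weight p n W)\<^sup>2 \<le> (weight (pmf p) W * (H / xi u ^ (n - a)))\<^sup>2" by (rule power_mono)
    then show ?thesis by (simp only: power_mult_distrib)
  qed
  have "(\<Sum>W\<in>trees a. (embedding_weight p n W)\<^sup>2) \<le> (\<Sum>W\<in>trees a. (weight (pmf p) W)\<^sup>2) * (H / xi u ^ (n - a))\<^sup>2"
    unfolding sum_distrib_right using one by (intro sum_mono)
  also have "\<dots> \<le> B * (H / xi u ^ (n - a))\<^sup>2" using B by (intro mult_right_mono) auto
  finally have "fact (n - a) / fact n * (\<Sum>W\<in>trees a. (embedding_weight p n W)\<^sup>2) / (q n)\<^sup>2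
     \<le> fact (n - a) / fact n * (B * (H / xi u ^ (n - a))\<^sup>2) / (q n)\<^sup>2"
    by (intro divide_right_mono mult_left_mono) auto
  moreover have "expected_X n a \<le> fact (n - a) / fact n * (\<Sum>W\<in>trees a. (embedding_weight p n W)\<^sup>2) / (q n)\<^sup>2"
    unfolding expected_X_def by (rule expectation_X_le[OF p1 q an(2)])
  ultimately show ?thesis by simp
qed

end

context critical_offspring begin

text \<open>
  Depending on whether \<open>chi p\<close> is below or above 1, the largest or the smallest number of vertices
  is the worst; this is the origin of the maximum in \<open>lam\<close>.
\<close>

lemma inverse_chi_power_le:
  assumes "a \<le> v" "v \<le> 2 * a"
  shows "(1 / chi p) ^ v \<le> lam p ^ a"
proof (cases "1 / chi p \<ge> 1")
  case True
  then have "(1 / chi p) ^ v \<le> (1 / chi p) ^ (2 * a)" using assms by (intro power_increasing) auto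
  also have "\<dots> = (1 / (chi p)\<^sup>2) ^ a" by (simp add: power_mult power_divide)
  also have "\<dots> \<le> lam p ^ a" by (intro power_mono) (auto simp: lam_def)
  finally show ?thesis .
next
  case False
  then have "(1 / chi p) ^ v \<le> (1 / chi p) ^ a"
    using assms chi_pos by (intro power_decreasing) auto
  also have "\<dots> \<le> lam p ^ a" using chi_pos by (intro power_mono) (auto simp: lam_def)
  finally show ?thesis .
qed

text \<open>
  The free parameter is chosen such that \<open>1 - x\<close> is about \<open>\<delta> = a / n\<close>, the saddle point for patterns with
  \<open>2 * a\<close> vertices.  Then \<open>x ^ (- (n - a)) \<le> exp a\<close>, and each vertex of the pattern contributes about
  \<open>1 / (chi p * sqrt \<delta>)\<close>.  Together with \<open>(n - a)! / n! \<le> (n - a) ^ (- a)\<close> everything except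
  for the factor \<open>(1 - \<eta>) ^ 5\<close> combines to \<open>(c\<^sup>2 n / a\<^sup>2) ^ a\<close>: four powers come from the approximation of
  \<open>dpgf\<close> (at most \<open>2 * a\<close> vertices, squared), one from \<open>n - a \<ge> (1 - \<eta>) n\<close>.
\<close>

lemma expected_X_le_small:
  assumes \<eta>: "0 < \<eta>" "\<eta> < 1"
    and B: "\<And>a. (\<Sum>W\<in>trees a. (weight (pmf p) W)\<^sup>2) \<le> r * ((pmf p 0)\<^sup>2 / max_term p) ^ a" and r: "r > 0"
  shows "\<exists>\<eta>0>0. \<forall>n a. q n > 0 \<longrightarrow> 1 \<le> a \<longrightarrow> real a \<le> \<eta>0 * real n \<longrightarrow>
    expected_X n a \<le> r / (q n)\<^sup>2 * ((c_const p)\<^sup>2 * real n / (real a)\<^sup>2 / (1 - \<eta>) ^ 5) ^ a"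
proof -
  define M where "M = max_term p"
  have M: "M > 0" using max_term_pos by (simp add: M_def)
  \<comment> \<open>For \<open>s \<le> s1\<close> the cubic error in the expansion of \<open>dpgf\<close> is at most the fraction \<open>\<eta>\<close> of the main
    term \<open>mu2 * s\<close>.\<close>
  define s1 where "s1 = min (1 / 2) (2 * \<eta> * mu2 / (mu3 + 1))"
  have s1: "s1 > 0" "s1 < 1" "s1 \<le> 2 * \<eta> * mu2 / (mu3 + 1)"
    using \<eta> mu2_pos mu3_nonneg by (auto simp: s1_def)
  define \<eta>0 where "\<eta>0 = min \<eta> (s1\<^sup>2 * mu2 / (2 * pmf p 0))"
  have \<eta>0: "\<eta>0 > 0" "\<eta>0 \<le> \<eta>" "\<eta>0 \<le> s1\<^sup>2 * mu2 / (2 * pmf p 0)"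
    using \<eta> s1 mu2_pos p0 by (auto simp: \<eta>0_def)
  have "expected_X n a \<le> r / (q n)\<^sup>2 * ((c_const p)\<^sup>2 * real n / (real a)\<^sup>2 / (1 - \<eta>) ^ 5) ^ a"
    if q: "q n > 0" and a1: "1 \<le> a" and an: "real a \<le> \<eta>0 * real n" for n a
  proof -
    have n0: "real n > 0"
    proof (rule ccontr)
      assume "\<not> real n > 0"
      then show False using an a1 by simp
    qed
    define \<delta> where "\<delta> = real a / real n"
    have \<delta>: "0 < \<delta>" "\<delta> \<le> \<eta>0" using an a1 n0 by (auto simp: \<delta>_def field_simps)
    then have \<delta>1: "\<delta> < 1" "1 - \<eta> \<le> 1 - \<delta>" using \<eta> \<eta>0 by auto
    have aln: "a < n"
    proof -
      have "real a < real n" using \<delta>1(1) n0 by (simp add: \<delta>_def)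
      then show ?thesis by simp
    qed
    \<comment> \<open>This makes the second order term of \<open>1 - xi (1 - s)\<close> equal to \<open>\<delta>\<close>.\<close>
    define s where "s = sqrt (2 * pmf p 0 * \<delta> / mu2)"
    have s2: "s\<^sup>2 = 2 * pmf p 0 * \<delta> / mu2" using p0 \<delta> mu2_pos by (simp add: s_def)
    have s0: "s > 0" using p0 \<delta> mu2_pos by (simp add: s_def)
    have "s\<^sup>2 \<le> s1\<^sup>2"
    proof -
      have "\<delta> \<le> s1\<^sup>2 * mu2 / (2 * pmf p 0)" using \<delta> \<eta>0 by linarith
      then have "2 * pmf p 0 * \<delta> \<le> s1\<^sup>2 * mu2" using p0 by (simp add: pos_le_divide_eq mult_ac)
      then show ?thesis unfolding s2 using mu2_pos by (simp add: pos_divide_le_eq)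
    qed
    then have ss1: "s \<le> s1" by (rule power2_le_imp_le) (use s1(1) in simp)
    have s01: "0 \<le> s" "s \<le> 1" using s0 ss1 s1 by auto
    have u: "0 < 1 - s" "1 - s < 1" using s0 ss1 s1 by auto
    have x: "1 - \<delta> \<le> xi (1 - s)"
      using one_minus_xi_le[OF s01] unfolding s2 using p0 mu2_pos by simp
    have xpow: "1 / xi (1 - s) ^ (n - a) \<le> exp (real a)"
    proof -
      have "1 / (1 - \<delta>) = 1 + real a / real (n - a)"
        using aln n0 by (simp add: \<delta>_def field_simps of_nat_diff)
      also have "\<dots> \<le> exp (real a / real (n - a))" by (rule exp_ge_add_one_self)
      finally have "(1 / (1 - \<delta>)) ^ (n - a) \<le> exp (real a / real (n - a)) ^ (n - a)"
        using \<delta>1 by (intro power_mono) auto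
      also have "\<dots> = exp (real a)" using aln by (simp flip: exp_of_nat_mult)
      finally have "1 / (1 - \<delta>) ^ (n - a) \<le> exp (real a)" by (simp add: power_divide)
      moreover have "1 / xi (1 - s) ^ (n - a) \<le> 1 / (1 - \<delta>) ^ (n - a)"
        using x \<delta>1 by (intro divide_left_mono power_mono mult_pos_pos zero_less_power) auto
      ultimately show ?thesis by linarith
    qed
    have m2s: "mu2 * s = chi p * sqrt \<delta>"
    proof -
      have "(mu2 * s)\<^sup>2 = (chi p * sqrt \<delta>)\<^sup>2"
        unfolding power_mult_distrib s2 using p0 mu2_pos \<delta>
        by (simp add: chi_def offspring_var_eq power2_eq_square)
      then show ?thesis using s0 mu2_pos chi_pos \<delta> by (simp add: power2_eq_iff_nonneg)
    qed
    have "mu3 / 2 * s\<^sup>2 \<le> \<eta> * (mu2 * s)"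
    proof -
      have "mu3 * s \<le> (mu3 + 1) * s1" using ss1 s0 mu3_nonneg by (intro mult_mono) auto
      also have "\<dots> \<le> 2 * \<eta> * mu2" using s1(3) mu3_nonneg by (simp add: field_simps)
      finally have "(mu3 * s) * (s / 2) \<le> (2 * \<eta> * mu2) * (s / 2)" using s0 by (intro mult_right_mono) auto
      then show ?thesis by (simp add: power2_eq_square mult_ac)
    qed
    then have "1 - dpgf (1 - s) \<ge> (1 - \<eta>) * (chi p * sqrt \<delta>)"
      using dpgf_taylor_le[OF s01] unfolding m2s[symmetric] by (simp add: algebra_simps)
    moreover have den: "(1 - \<eta>) * (chi p * sqrt \<delta>) > 0" using \<eta> chi_pos \<delta> by simp
    ultimately have G: "1 / (1 - dpgf (1 - s)) \<le> 1 / ((1 - \<eta>) * (chi p * sqrt \<delta>))"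
      and G0: "0 \<le> 1 / (1 - dpgf (1 - s))"
      by (auto intro!: divide_left_mono mult_pos_pos)
    define H where "H = (1 / (1 - \<eta>)) ^ (2 * a) * lam p ^ a * (1 / \<delta>) ^ a"
    have H: "(1 / (1 - dpgf (1 - s))) ^ v \<le> H" if v: "a \<le> v" "v \<le> 2 * a" for v
    proof -
      have "(1 / (1 - dpgf (1 - s))) ^ v \<le> (1 / ((1 - \<eta>) * (chi p * sqrt \<delta>))) ^ v"
        using G G0 by (rule power_mono)
      also have "\<dots> = (1 / (1 - \<eta>)) ^ v * (1 / chi p) ^ v * (1 / sqrt \<delta>) ^ v"
        by (simp add: power_divide power_mult_distrib)
      also have "\<dots> \<le> (1 / (1 - \<eta>)) ^ (2 * a) * lam p ^ a * (1 / sqrt \<delta>) ^ (2 * a)"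
        using \<eta> \<delta> \<delta>1 v chi_pos lam_pos
        by (intro mult_mono power_increasing inverse_chi_power_le mult_nonneg_nonneg) auto
      also have "(1 / sqrt \<delta>) ^ (2 * a) = (1 / \<delta>) ^ a" using \<delta> by (simp add: power_mult power_divide)
      finally show ?thesis by (simp add: H_def)
    qed
    have H0: "H \<ge> 0" using \<eta> lam_pos \<delta> by (simp add: H_def)
    have Hx: "H / xi (1 - s) ^ (n - a) \<le> H * exp (real a)"
      using mult_left_mono[OF xpow H0] by simp
    have fac: "fact (n - a) / fact n \<le> (1 / ((1 - \<eta>) * real n) ^ a :: real)"
    proof -
      have "real ((n - a) ^ a * fact (n - a)) \<le> real (fact (n - a + a))"
        by (rule of_nat_mono[OF power_mult_fact_le])
      then have "real (n - a) ^ a * fact (n - a) \<le> fact n" using aln by simp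
      moreover have "((1 - \<eta>) * real n) ^ a \<le> real (n - a) ^ a"
      proof (rule power_mono)
        have "(1 - \<eta>) * real n \<le> (1 - \<delta>) * real n" using \<delta>1 n0 by (intro mult_right_mono) auto
        also have "\<dots> = real (n - a)" using n0 aln by (simp add: \<delta>_def field_simps of_nat_diff)
        finally show "(1 - \<eta>) * real n \<le> real (n - a)" .
      qed (use \<eta> in simp)
      ultimately have "((1 - \<eta>) * real n) ^ a * fact (n - a) \<le> fact n"
        by (meson fact_ge_zero mult_right_mono order_trans)
      then show ?thesis using n0 \<eta> by (simp add: field_simps)
    qed
    have "expected_X n a \<le> fact (n - a) / fact n * (r * ((pmf p 0)\<^sup>2 / M) ^ a) * (H / xi (1 - s) ^ (n - a))\<^sup>2 / (q n)\<^sup>2"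
      using B[of a] aln by (intro expected_X_le q a1 u H) (auto simp: M_def)
    also have "\<dots> \<le> 1 / ((1 - \<eta>) * real n) ^ a * (r * ((pmf p 0)\<^sup>2 / M) ^ a) * (H * exp (real a))\<^sup>2 / (q n)\<^sup>2"
      using fac r M Hx H0 xi_pos[of "1 - s"] u \<eta> n0
      by (intro divide_right_mono mult_mono power_mono mult_nonneg_nonneg) auto
    also have "\<dots> = r / (q n)\<^sup>2 * (1 / ((1 - \<eta>) * real n) * ((pmf p 0)\<^sup>2 / M) *
        ((1 / (1 - \<eta>)) ^ 2 * lam p * (1 / \<delta>) * exp 1)\<^sup>2) ^ a"
    proof -
      have "(H * exp (real a)) = ((1 / (1 - \<eta>)) ^ 2 * lam p * (1 / \<delta>) * exp 1) ^ a"
        unfolding H_def power_mult_distrib power_mult by (simp flip: exp_of_nat_mult)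
      moreover have "(Z ^ a)\<^sup>2 = (Z\<^sup>2) ^ a" for Z :: real by (simp flip: power_mult add: mult.commute)
      ultimately show ?thesis by (simp add: power_mult_distrib power_divide mult_ac)
    qed
    also have "1 / ((1 - \<eta>) * real n) * ((pmf p 0)\<^sup>2 / M) * ((1 / (1 - \<eta>)) ^ 2 * lam p * (1 / \<delta>) * exp 1)\<^sup>2
      = (c_const p)\<^sup>2 * real n / (real a)\<^sup>2 / (1 - \<eta>) ^ 5"
    proof -
      have alg: "1 / (k * N) * (P\<^sup>2 / M) * ((1 / k)\<^sup>2 * L * (1 / (A / N)) * E)\<^sup>2
          = E\<^sup>2 * P\<^sup>2 * L\<^sup>2 / M * N / A\<^sup>2 / k ^ 5"
        if "k \<noteq> 0" "N \<noteq> 0" "A \<noteq> 0" for k N P L A E :: real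
        using that by (simp add: field_simps eval_nat_numeral)
      show ?thesis unfolding c_const_sq \<delta>_def M_def[symmetric]
        by (rule alg) (use \<eta> n0 a1 in auto)
    qed
    finally show ?thesis .
  qed
  then show ?thesis using \<eta>0(1) by blast
qed

text \<open>
  If \<open>a\<close> is a positive fraction of \<open>n\<close>, all exponential factors are harmless compared with \<open>a!\<close>, and
  the fixed value \<open>u = 1 / 2\<close> suffices.
\<close>

lemma expected_X_le_large:
  assumes \<eta>0: "\<eta>0 > 0"
    and B: "\<And>a. (\<Sum>W\<in>trees a. (weight (pmf p) W)\<^sup>2) \<le> r * ((pmf p 0)\<^sup>2 / max_term p) ^ a" and r: "r > 0"
  shows "\<exists>Z>0. \<forall>n a. q n > 0 \<longrightarrow> 1 \<le> a \<longrightarrow> a \<le> n \<longrightarrow> \<eta>0 * real n \<le> real a \<longrightarrow>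
    expected_X n a \<le> r / (q n)\<^sup>2 * (Z ^ a / fact a)"
proof -
  define M where "M = max_term p"
  have M: "M > 0" using max_term_pos by (simp add: M_def)
  define x where "x = xi (1 / 2)"
  have x: "0 < x" "x \<le> 1" using xi_pos[of "1 / 2"] xi_le_1[of "1 / 2"] by (auto simp: x_def)
  obtain L :: nat where L: "1 / \<eta>0 \<le> real L" using real_arch_simple by blast
  define Z where "Z = (pmf p 0)\<^sup>2 / M * (4 / x ^ L)\<^sup>2"
  have Z: "Z > 0" using M x p0 by (simp add: Z_def)
  have G: "0 \<le> 1 / (1 - dpgf (1 / 2))" "1 / (1 - dpgf (1 / 2)) \<le> 2"
    using dpgf_le_self[of "1 / 2"] by (auto simp: field_simps)
  have "expected_X n a \<le> r / (q n)\<^sup>2 * (Z ^ a / fact a)"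
    if q: "q n > 0" and a: "1 \<le> a" "a \<le> n" and na: "\<eta>0 * real n \<le> real a" for n a
  proof -
    have H: "(1 / (1 - dpgf (1 / 2))) ^ v \<le> 4 ^ a" if "a \<le> v" "v \<le> 2 * a" for v
    proof -
      have "(1 / (1 - dpgf (1 / 2))) ^ v \<le> 2 ^ v" using G by (intro power_mono) auto
      also have "\<dots> \<le> 2 ^ (2 * a)" using that by (intro power_increasing) auto
      finally show ?thesis by (simp add: power_mult)
    qed
    have "real n \<le> 1 / \<eta>0 * real a" using na \<eta>0 by (simp add: field_simps)
    also have "\<dots> \<le> real L * real a" using L by (intro mult_right_mono) auto
    finally have nL: "n \<le> L * a" by (simp flip: of_nat_mult)
    have "x ^ (L * a) \<le> x ^ (n - a)" using x nL by (intro power_decreasing) auto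
    then have Hx: "4 ^ a / x ^ (n - a) \<le> (4 / x ^ L) ^ a"
      using x by (simp add: power_divide power_mult divide_left_mono)
    have fac: "fact (n - a) / fact n \<le> (1 / fact a :: real)"
    proof -
      have "fact a * fact (n - a) * real (n choose a) = fact n"
        using binomial_fact_lemma[OF a(2)] by (metis of_nat_fact of_nat_mult)
      moreover have "real (n choose a) \<ge> 1" using a by (simp add: Suc_leI)
      ultimately have "fact a * fact (n - a) \<le> (fact n :: real)"
        by (metis fact_ge_zero mult.right_neutral mult_left_mono mult_nonneg_nonneg)
      then show ?thesis by (simp add: field_simps)
    qed
    have "expected_X n a \<le> fact (n - a) / fact n * (r * ((pmf p 0)\<^sup>2 / M) ^ a) * (4 ^ a / xi (1 / 2) ^ (n - a))\<^sup>2 / (q n)\<^sup>2"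
      using B[of a] a by (intro expected_X_le q H) (auto simp: M_def)
    also have "\<dots> \<le> 1 / fact a * (r * ((pmf p 0)\<^sup>2 / M) ^ a) * ((4 / x ^ L) ^ a)\<^sup>2 / (q n)\<^sup>2"
      unfolding x_def[symmetric] using fac r M Hx x
      by (intro divide_right_mono mult_mono power_mono mult_nonneg_nonneg) auto
    also have "((4 / x ^ L) ^ a)\<^sup>2 = ((4 / x ^ L)\<^sup>2) ^ a" by (simp flip: power_mult add: mult.commute)
    also have "1 / fact a * (r * ((pmf p 0)\<^sup>2 / M) ^ a) * ((4 / x ^ L)\<^sup>2) ^ a / (q n)\<^sup>2 = r / (q n)\<^sup>2 * (Z ^ a / fact a)"
      unfolding Z_def power_mult_distrib by (simp add: mult_ac)
    finally show ?thesis .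
  qed
  then show ?thesis using Z by blast
qed

text \<open>
  The hypothesis on \<open>a\<close> gives \<open>c\<^sup>2 n / a\<^sup>2 \<le> (1 + \<epsilon>) ^ (-2)\<close>, and \<open>\<tau> = (1 + \<epsilon>)\<^sup>2 (1 - \<epsilon>) > 1\<close> for
  \<open>\<epsilon> \<le> 1 / 2\<close>.  So there is a factor \<open>\<tau> ^ a\<close> to spare.  With \<open>\<omega> = \<tau> ^ (1/8)\<close> it is divided
  as follows: \<open>\<omega> ^ 5\<close> for the errors in the bound for small \<open>a\<close>, \<open>\<omega>\<close> for \<open>1 / (leafprob n)\<^sup>2\<close>, one
  \<open>\<omega>\<close> for constants, and one \<open>\<omega> = 1 / \<rho>\<close> that is kept in the conclusion.
\<close>

lemma expected_X_eventually_le: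
  assumes gcd: "Gcd {j :: nat. j \<ge> 1 \<and> pmf p (j + 1) > 0} = 1"
    and \<epsilon>: "0 < \<epsilon>" "\<epsilon> \<le> 1 / 2"
  shows "\<exists>\<rho>. 0 < \<rho> \<and> \<rho> < 1 \<and> (\<forall>\<^sub>F n in sequentially. \<forall>a. real a \<ge> (1 + \<epsilon>) * c_const p * sqrt (real n) \<longrightarrow>
      expected_X n a \<le> ((1 - \<epsilon>) * \<rho>) ^ a)"
proof -
  define \<tau> where "\<tau> = (1 + \<epsilon>)\<^sup>2 * (1 - \<epsilon>)"
  have \<tau>: "\<tau> > 1"
  proof -
    have "\<epsilon> * \<epsilon> \<le> \<epsilon> * (1 / 2)" using \<epsilon> by (intro mult_left_mono) auto
    then have "\<epsilon> + \<epsilon>\<^sup>2 < 1" using \<epsilon> unfolding power2_eq_square by linarith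
    then have "\<epsilon> * (1 - \<epsilon> - \<epsilon>\<^sup>2) > 0" using \<epsilon> by (intro mult_pos_pos) auto
    moreover have "\<tau> = 1 + \<epsilon> * (1 - \<epsilon> - \<epsilon>\<^sup>2)" by (simp add: \<tau>_def power2_eq_square algebra_simps)
    ultimately show ?thesis by simp
  qed
  define \<omega> where "\<omega> = root 8 \<tau>"
  have \<omega>: "\<omega> > 1" "\<omega> ^ 8 = \<tau>" using \<tau> by (auto simp: \<omega>_def)
  define c' where "c' = (1 + \<epsilon>) * c_const p"
  have c': "c' > 0" using c_const_pos \<epsilon> by (simp add: c'_def)
  obtain r where r: "r > 0"
    and B: "\<And>a. (\<Sum>W\<in>trees a. (weight (pmf p) W)\<^sup>2) \<le> r * ((pmf p 0)\<^sup>2 / max_term p) ^ a"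
    using sum_sq_weights_le by blast
  define \<eta> where "\<eta> = 1 - 1 / \<omega>"
  have \<eta>: "0 < \<eta>" "\<eta> < 1" "1 - \<eta> = 1 / \<omega>" using \<omega> by (auto simp: \<eta>_def)
  obtain \<eta>0 where \<eta>0: "\<eta>0 > 0"
    and small: "\<And>n a. q n > 0 \<Longrightarrow> 1 \<le> a \<Longrightarrow> real a \<le> \<eta>0 * real n \<Longrightarrow>
      expected_X n a \<le> r / (q n)\<^sup>2 * ((c_const p)\<^sup>2 * real n / (real a)\<^sup>2 / (1 - \<eta>) ^ 5) ^ a"
    using expected_X_le_small[OF \<eta>(1,2) B r] by blast
  obtain Z where Z: "Z > 0"
    and large: "\<And>n a. q n > 0 \<Longrightarrow> 1 \<le> a \<Longrightarrow> a \<le> n \<Longrightarrow> \<eta>0 * real n \<le> real a \<Longrightarrow>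
      expected_X n a \<le> r / (q n)\<^sup>2 * (Z ^ a / fact a)"
    using expected_X_le_large[OF \<eta>0 B r] by blast
  \<comment> \<open>For \<open>a \<ge> c' * sqrt n\<close> this makes \<open>exp (2 * \<delta> * sqrt n)\<close> at most \<open>\<omega> ^ a\<close>.\<close>
  define \<delta> where "\<delta> = c' * ln \<omega> / 2"
  have \<delta>: "\<delta> > 0" using c' \<omega> by (simp add: \<delta>_def)
  obtain c0 where c0: "c0 > 0" and qlow: "eventually (\<lambda>n. q n \<ge> c0 * exp (- \<delta> * sqrt (real n))) sequentially"
    using leafprob_subexponential[OF gcd \<delta>] by blast
  define \<rho> where "\<rho> = 1 / \<omega>"
  have \<rho>: "0 < \<rho>" "\<rho> < 1" using \<omega> by (auto simp: \<rho>_def)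
  define C where "C = r / c0\<^sup>2"
  have C: "C > 0" using r c0 by (simp add: C_def)
  define Y where "Y = \<omega> * Z / ((1 - \<epsilon>) * \<rho>)"
  have "(\<lambda>a. C * \<rho> ^ a) \<longlonglongrightarrow> C * 0" using \<rho> by (intro tendsto_intros LIMSEQ_power_zero) auto
  then have "eventually (\<lambda>a. C * \<rho> ^ a < 1) sequentially" by (rule order_tendstoD) simp
  moreover have "(\<lambda>a. C * (inverse (fact a) * Y ^ a)) \<longlonglongrightarrow> C * 0"
    by (intro tendsto_intros summable_LIMSEQ_zero summable_exp)
  then have "eventually (\<lambda>a. C * (inverse (fact a) * Y ^ a) < 1) sequentially" by (rule order_tendstoD) simp
  ultimately have "eventually (\<lambda>a. C * \<rho> ^ a < 1 \<and> C * (inverse (fact a) * Y ^ a) < 1) sequentially"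
    by eventually_elim simp
  then obtain A where A: "\<And>a. a \<ge> A \<Longrightarrow> C * \<rho> ^ a < 1 \<and> C * (inverse (fact a) * Y ^ a) < 1"
    by (auto simp: eventually_sequentially)
  have "filterlim (\<lambda>n. c' * sqrt (real n)) at_top sequentially" using c' by real_asymp
  then have "eventually (\<lambda>n. c' * sqrt (real n) \<ge> real (A + 1)) sequentially"
    by (simp add: filterlim_at_top)
  then have "\<forall>\<^sub>F n in sequentially. \<forall>a. real a \<ge> c' * sqrt (real n) \<longrightarrow> expected_X n a \<le> ((1 - \<epsilon>) * \<rho>) ^ a"
    using qlow
  proof eventually_elim
    case (elim n)
    have q: "q n > 0" using elim(2) c0 by (rule_tac less_le_trans) auto
    show ?case
    proof (intro allI impI)
      fix a :: nat assume a: "real a \<ge> c' * sqrt (real n)"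
      have "real (A + 1) \<le> real a" using a elim(1) by linarith
      then have aA: "A \<le> a" "1 \<le> a" by auto
      show "expected_X n a \<le> ((1 - \<epsilon>) * \<rho>) ^ a"
      proof (cases "a \<le> n")
        case False
        then have "expected_X n a = 0" unfolding expected_X_def by (intro expectation_X_0) simp
        then show ?thesis using \<epsilon> \<rho> by simp
      next
        case True
        have n0: "real n > 0" using True aA by simp
        have rq: "r / (q n)\<^sup>2 \<le> C * \<omega> ^ a"
        proof -
          have "\<delta> * sqrt (real n) = (ln \<omega> / 2) * (c' * sqrt (real n))" by (simp add: \<delta>_def)
          also have "\<dots> \<le> (ln \<omega> / 2) * real a" using a \<omega> by (intro mult_left_mono) auto
          finally have "c0 * exp (- (ln \<omega> / 2) * real a) \<le> c0 * exp (- \<delta> * sqrt (real n))"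
            using c0 by (intro mult_left_mono) auto
          also have "\<dots> \<le> q n" by (rule elim(2))
          finally have "(c0 * exp (- (ln \<omega> / 2) * real a))\<^sup>2 \<le> (q n)\<^sup>2" using c0 by (intro power_mono) auto
          moreover have "(exp (- (ln \<omega> / 2) * real a))\<^sup>2 = 1 / \<omega> ^ a"
          proof -
            have "(exp (- (ln \<omega> / 2) * real a))\<^sup>2 = exp (real a * (- ln \<omega>))"
              by (simp flip: exp_of_nat_mult add: mult.commute)
            also have "\<dots> = exp (- ln \<omega>) ^ a" by (rule exp_of_nat_mult)
            also have "exp (- ln \<omega>) = 1 / \<omega>" using \<omega> by (simp add: exp_minus inverse_eq_divide)
            finally show ?thesis by (simp add: power_divide)
          qed
          ultimately have "c0\<^sup>2 / \<omega> ^ a \<le> (q n)\<^sup>2" by (simp add: power_mult_distrib)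
          then have "r / (q n)\<^sup>2 \<le> r / (c0\<^sup>2 / \<omega> ^ a)"
            using r c0 \<omega> q by (intro divide_left_mono mult_pos_pos) auto
          then show ?thesis by (simp add: C_def)
        qed
        show ?thesis
        proof (cases "real a \<le> \<eta>0 * real n")
          case s: True
          have "(c' * sqrt (real n))\<^sup>2 \<le> (real a)\<^sup>2" using a c' by (intro power_mono) auto
          then have "(1 + \<epsilon>)\<^sup>2 * ((c_const p)\<^sup>2 * real n) \<le> (real a)\<^sup>2"
            by (simp add: c'_def power_mult_distrib)
          then have "(c_const p)\<^sup>2 * real n / (real a)\<^sup>2 \<le> 1 / (1 + \<epsilon>)\<^sup>2"
            using aA \<epsilon> by (simp add: field_simps)
          then have "(c_const p)\<^sup>2 * real n / (real a)\<^sup>2 / (1 - \<eta>) ^ 5 \<le> 1 / (1 + \<epsilon>)\<^sup>2 / (1 - \<eta>) ^ 5"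
            using \<eta> \<omega> by (intro divide_right_mono) auto
          also have "\<dots> = \<omega> ^ 5 / (1 + \<epsilon>)\<^sup>2" by (simp add: \<eta>(3) power_divide)
          finally have b: "(c_const p)\<^sup>2 * real n / (real a)\<^sup>2 / (1 - \<eta>) ^ 5 \<le> \<omega> ^ 5 / (1 + \<epsilon>)\<^sup>2" .
          have "expected_X n a \<le> r / (q n)\<^sup>2 * ((c_const p)\<^sup>2 * real n / (real a)\<^sup>2 / (1 - \<eta>) ^ 5) ^ a"
            by (rule small[OF q aA(2) s])
          also have "\<dots> \<le> (C * \<omega> ^ a) * (\<omega> ^ 5 / (1 + \<epsilon>)\<^sup>2) ^ a"
            using rq b C \<omega> \<eta> by (intro mult_mono power_mono) auto
          also have "\<dots> = C * (\<omega> ^ 6 / (1 + \<epsilon>)\<^sup>2) ^ a"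
          proof -
            have "\<omega> * (\<omega> ^ 5 / (1 + \<epsilon>)\<^sup>2) = \<omega> ^ 6 / (1 + \<epsilon>)\<^sup>2" by (simp add: eval_nat_numeral)
            then show ?thesis by (simp only: mult.assoc power_mult_distrib[symmetric])
          qed
          also have "\<omega> ^ 6 / (1 + \<epsilon>)\<^sup>2 = (1 - \<epsilon>) * \<rho> * \<rho>"
          proof -
            have e1: "\<omega> ^ 6 * \<omega>\<^sup>2 = (1 - \<epsilon>) * (1 + \<epsilon>)\<^sup>2"
              using \<omega>(2) by (simp add: \<tau>_def mult.commute flip: power_add)
            have alg: "w / K = e * (1 / v) * (1 / v)" if "w * v\<^sup>2 = e * K" "K \<noteq> 0" "v \<noteq> 0" for w K e v :: real
              using that by (simp add: field_simps power2_eq_square)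
            show ?thesis unfolding \<rho>_def by (rule alg[OF e1]) (use \<omega>(1) \<epsilon> in auto)
          qed
          also have "C * ((1 - \<epsilon>) * \<rho> * \<rho>) ^ a = (C * \<rho> ^ a) * ((1 - \<epsilon>) * \<rho>) ^ a"
            by (simp add: power_mult_distrib)
          also have "\<dots> \<le> 1 * ((1 - \<epsilon>) * \<rho>) ^ a"
            using A[OF aA(1)] \<epsilon> \<rho> by (intro mult_right_mono) auto
          finally show ?thesis by simp
        next
          case l: False
          have "expected_X n a \<le> r / (q n)\<^sup>2 * (Z ^ a / fact a)"
            using l by (intro large[OF q aA(2) True]) simp
          also have "\<dots> \<le> (C * \<omega> ^ a) * (Z ^ a / fact a)"
            using rq Z by (intro mult_right_mono) auto
          also have "\<dots> = (C * (inverse (fact a) * Y ^ a)) * ((1 - \<epsilon>) * \<rho>) ^ a"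
          proof -
            have "\<omega> * Z = Y * ((1 - \<epsilon>) * \<rho>)" using \<epsilon> \<rho> by (simp add: Y_def)
            then have eq: "\<omega> ^ a * Z ^ a = Y ^ a * ((1 - \<epsilon>) * \<rho>) ^ a"
              by (simp only: power_mult_distrib[symmetric])
            have "(C * \<omega> ^ a) * (Z ^ a / fact a) = C * inverse (fact a) * (\<omega> ^ a * Z ^ a)"
              by (simp add: inverse_eq_divide)
            also have "\<dots> = C * inverse (fact a) * (Y ^ a * ((1 - \<epsilon>) * \<rho>) ^ a)" by (simp only: eq)
            finally show ?thesis by (simp only: mult.assoc)
          qed
          also have "\<dots> \<le> 1 * ((1 - \<epsilon>) * \<rho>) ^ a"
            using A[OF aA(1)] \<epsilon> \<rho> by (intro mult_right_mono) auto
          finally show ?thesis by simp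
        qed
      qed
    qed
  qed
  then show ?thesis using \<rho> unfolding c'_def by blast
qed

text \<open>
  The bounds for the individual \<open>a\<close> above the threshold \<open>t\<close> have to be summed.  The surplus \<open>\<rho> ^ a\<close>
  makes the sum at most \<open>(1 - \<epsilon>) powr t\<close> times the tail of a geometric series, which is below 1 once
  \<open>t\<close> is large.
\<close>

lemma prob_max_common_eventually:
  assumes gcd: "Gcd {j :: nat. j \<ge> 1 \<and> pmf p (j + 1) > 0} = 1"
    and \<epsilon>: "0 < \<epsilon>" "\<epsilon> \<le> 1 / 2" and \<rho>: "0 < \<rho>" "\<rho> < 1"
    and ev: "\<forall>\<^sub>F n in sequentially. \<forall>a. real a \<ge> (1 + \<epsilon>) * c_const p * sqrt (real n) \<longrightarrow>
      expected_X n a \<le> ((1 - \<epsilon>) * \<rho>) ^ a"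
  shows "\<forall>\<^sub>F n in sequentially. measure_pmf.prob (two_copies p n)
            {TT. real (max_common n TT) \<le> (1 + \<epsilon>) * c_const p * sqrt (real n)}
          \<ge> 1 - (1 - \<epsilon>) powr ((1 + \<epsilon>) * c_const p * sqrt (real n))"
proof -
  define c' where "c' = (1 + \<epsilon>) * c_const p"
  have c': "c' > 0" using c_const_pos \<epsilon> by (simp add: c'_def)
  have "(\<lambda>a. \<rho> ^ a / (1 - \<rho>)) \<longlonglongrightarrow> 0 / (1 - \<rho>)" using \<rho> by (intro tendsto_intros LIMSEQ_power_zero) auto
  then have "eventually (\<lambda>a. \<rho> ^ a / (1 - \<rho>) < 1) sequentially" by (rule order_tendstoD) simp
  then obtain A where A: "\<rho> ^ A / (1 - \<rho>) < 1" by (auto simp: eventually_sequentially)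
  have "filterlim (\<lambda>n. c' * sqrt (real n)) at_top sequentially" using c' by real_asymp
  then have "eventually (\<lambda>n. c' * sqrt (real n) \<ge> real A) sequentially"
    by (simp add: filterlim_at_top)
  moreover have "eventually (\<lambda>n. q n > 0) sequentially" by (rule leafprob_eventually_pos[OF gcd])
  ultimately show ?thesis using ev eventually_ge_at_top[of 1]
    unfolding c'_def[symmetric]
  proof eventually_elim
    case (elim n)
    define t where "t = c' * sqrt (real n)"
    let ?M = "two_copies p n" let ?S = "{a. a \<le> n \<and> real a > t}"
    have finS: "finite ?S" by (rule finite_subset[of _ "{..n}"]) auto
    have sub: "?S \<subseteq> {A..<Suc n}" using elim(1) by (auto simp: t_def)
    have "measure_pmf.prob ?M {TT. real (max_common n TT) > t} \<le> (\<Sum>a\<in>?S. expected_X n a)"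
      unfolding expected_X_def by (rule prob_max_common_gt_le[OF p1 elim(2) elim(4)])
    also have "\<dots> \<le> (\<Sum>a\<in>?S. (1 - \<epsilon>) powr t * \<rho> ^ a)"
    proof (rule sum_mono)
      fix a assume a: "a \<in> ?S"
      then have "expected_X n a \<le> ((1 - \<epsilon>) * \<rho>) ^ a" using elim(3) by (auto simp: t_def)
      also have "\<dots> = (1 - \<epsilon>) powr real a * \<rho> ^ a"
        using \<epsilon> by (simp add: power_mult_distrib powr_realpow)
      also have "\<dots> \<le> (1 - \<epsilon>) powr t * \<rho> ^ a"
        using a \<epsilon> \<rho> by (intro mult_right_mono powr_mono') auto
      finally show "expected_X n a \<le> (1 - \<epsilon>) powr t * \<rho> ^ a" .
    qed
    also have "\<dots> = (1 - \<epsilon>) powr t * (\<Sum>a\<in>?S. \<rho> ^ a)" by (simp add: sum_distrib_left)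
    also have "\<dots> \<le> (1 - \<epsilon>) powr t * 1"
    proof (intro mult_left_mono)
      have "(\<Sum>a\<in>?S. \<rho> ^ a) \<le> (\<Sum>a\<in>{A..<Suc n}. \<rho> ^ a)"
        using sub \<rho> by (intro sum_mono2) auto
      also have "\<dots> \<le> \<rho> ^ A / (1 - \<rho>)"
      proof (cases "A \<le> n")
        case True
        then show ?thesis using sum_gp_strict[of \<rho>] sum_power_shift[of A n \<rho>] \<rho>
          by (simp add: atLeastLessThanSuc_atLeastAtMost sum_gp0 mult_left_le divide_right_mono)
      next
        case False then show ?thesis using \<rho> by simp
      qed
      finally show "(\<Sum>a\<in>?S. \<rho> ^ a) \<le> 1" using A by linarith
    qed simp
    finally have "measure_pmf.prob ?M {TT. real (max_common n TT) > t} \<le> (1 - \<epsilon>) powr t" by simp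
    moreover have "measure_pmf.prob ?M {TT. real (max_common n TT) \<le> t}
        = 1 - measure_pmf.prob ?M {TT. real (max_common n TT) > t}"
    proof -
      have "{TT. real (max_common n TT) \<le> t} = UNIV - {TT. real (max_common n TT) > t}" by auto
      then show ?thesis using measure_pmf.prob_compl[of "{TT. real (max_common n TT) > t}" ?M] by simp
    qed
    ultimately show ?case by (simp add: t_def)
  qed
qed

end

theorem theorem3p5:
  fixes p :: "nat pmf"
  assumes mean: "(\<lambda>j. real j * pmf p j) sums 1"
    and radius: "conv_radius (\<lambda>j. pmf p j) > 1"
    and p0: "pmf p 0 > 0"
    and p1: "pmf p 1 = 0"
    and gcd: "Gcd {j :: nat. j \<ge> 1 \<and> pmf p (j + 1) > 0} = 1"
  shows "(pmf p 2 > 0 \<longrightarrow> (\<forall>n\<ge>1. prob_n_leaves p n > 0)) \<and>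
    (\<forall>\<^sub>F n in sequentially. prob_n_leaves p n > 0) \<and>
    (pmf p 0 = 1 / 2 \<and> pmf p 2 = 1 / 2 \<longrightarrow> c_const p = exp 1 / 2) \<and>
    (\<forall>\<epsilon>::real. 0 < \<epsilon> \<and> \<epsilon> \<le> 1 / 2 \<longrightarrow>
      (\<forall>\<^sub>F n in sequentially.
        (\<forall>a::nat. real a \<ge> (1 + \<epsilon>) * c_const p * sqrt (real n) \<longrightarrow>
           measure_pmf.expectation (two_copies p n) (\<lambda>TT. real (X n a TT)) \<le> (1 - \<epsilon>) ^ a) \<and>
        measure_pmf.prob (two_copies p n)
            {TT. real (max_common n TT) \<le> (1 + \<epsilon>) * c_const p * sqrt (real n)}
          \<ge> 1 - (1 - \<epsilon>) powr ((1 + \<epsilon>) * c_const p * sqrt (real n))))"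
proof -
  interpret critical_offspring p
    using mean radius p0 p1 by unfold_locales
  have eq: "prob_n_leaves p n = q n" for n by (rule prob_n_leaves_eq[OF p1])
  show ?thesis
  proof (intro conjI impI allI)
    fix n :: nat assume "pmf p 2 > 0" "n \<ge> 1"
    then show "prob_n_leaves p n > 0" unfolding eq by (rule leafprob_pos_binary)
  next
    show "\<forall>\<^sub>F n in sequentially. prob_n_leaves p n > 0"
      unfolding eq by (rule leafprob_eventually_pos[OF gcd])
  next
    assume "pmf p 0 = 1 / 2 \<and> pmf p 2 = 1 / 2"
    then show "c_const p = exp 1 / 2" by (intro c_const_binary) auto
  next
    fix \<epsilon> :: real assume "0 < \<epsilon> \<and> \<epsilon> \<le> 1 / 2"
    then have \<epsilon>: "0 < \<epsilon>" "\<epsilon> \<le> 1 / 2" by auto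
    obtain \<rho> where \<rho>: "0 < \<rho>" "\<rho> < 1"
      and ev: "\<forall>\<^sub>F n in sequentially. \<forall>a. real a \<ge> (1 + \<epsilon>) * c_const p * sqrt (real n) \<longrightarrow>
        expected_X n a \<le> ((1 - \<epsilon>) * \<rho>) ^ a"
      using expected_X_eventually_le[OF gcd \<epsilon>] by blast
    have le: "((1 - \<epsilon>) * \<rho>) ^ a \<le> (1 - \<epsilon>) ^ a" for a
      using \<epsilon> \<rho> by (intro power_mono) (auto simp: mult_left_le)
    show "\<forall>\<^sub>F n in sequentially.
        (\<forall>a::nat. real a \<ge> (1 + \<epsilon>) * c_const p * sqrt (real n) \<longrightarrow>
           measure_pmf.expectation (two_copies p n) (\<lambda>TT. real (X n a TT)) \<le> (1 - \<epsilon>) ^ a) \<and>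
        measure_pmf.prob (two_copies p n)
            {TT. real (max_common n TT) \<le> (1 + \<epsilon>) * c_const p * sqrt (real n)}
          \<ge> 1 - (1 - \<epsilon>) powr ((1 + \<epsilon>) * c_const p * sqrt (real n))"
      using ev prob_max_common_eventually[OF gcd \<epsilon> \<rho> ev]
    proof eventually_elim
      case (elim n)
      then show ?case using le unfolding expected_X_def[symmetric] by (blast intro: order_trans)
    qed
  qed
qed

end
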